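(* Let $I=I_1\sqcup I_2\sqcup I_3\sqcup I_4$ with $I_1=I_1'\sqcup I_1''$, and let $(\mathbf{X}_n^{(i)})_{i\in I}$ be independent unnormalized Wigner matrices with uniformly controlled moments and general parameters $\beta_i\in\mathbb{C}$ (as defined in the context). Let $(b_n^{(i)})_n$ be band widths which are: of slow growth for $i\in I_1'$; of proportional growth for $i\in I_1''$; of slow growth for $i\in I_2$; of full proportion for $i\in I_3$; of proper proportion for $i\in I_4$. Let $\mathcal{P}_n^{(1)}=(\mathbf{\Lambda}_n^{(i)})_{i\in I_1}$ be the normalized periodic random band matrices and $\mathcal{O}_n^{(k)}=(\mathbf{\Theta}_n^{(i)})_{i\in I_k}$, $k=2,3,4$, the normalized random band matrices. Then $\mathcal{P}_n^{(1)}\cup\mathcal{O}_n^{(2)}\cup\mathcal{O}_n^{(3)}\cup\mathcal{O}_n^{(4)}$ converges in joint distribution to a family $\mathbf{a}=(a_i)_{i\in I}=\mathbf{a}_{1'}\cup\mathbf{a}_{1''}\cup\mathbf{a}_2\cup\mathbf{a}_3\cup\mathbf{a}_4$, where $\mathbf{a}_{1'}=(a_i)_{i\in I_1'}$, $\mathbf{a}_{1''}=(a_i)_{i\in I_1''}$ and $\mathbf{a}_k=(a_i)_{i\in I_k}$ for $k=2,3,4$. The family $\mathbf{a}_{1'}\cup\mathbf{a}_{1''}\cup\mathbf{a}_2\cup\mathbf{a}_3$ is a semicircular system; the families $\mathbf{a}_{1''}$, $\mathbf{a}_3$, and $\mathbf{a}_4$ are free; the families $\mathbf{a}_2$ and $\mathbf{a}_4$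 are not free, nor are the families $\mathbf{a}_{1'}$ and $\mathbf{a}_4$; finally, the family $\mathbf{a}_4=(a_i)_{i\in I_4}$ is not free.
   Context: Wigner matrices: for each $n$, $(\mathbf{X}_n^{(i)})_{i\in I}$ are random Hermitian $n\times n$ matrices such that the entries $(\mathbf{X}_n^{(i)}(j,k):1\le j\le k\le n,\ i\in I)$ are independent; diagonal entries are real-valued; for $j<k$, $\mathbb{E}\mathbf{X}_n^{(i)}(j,k)=0$, $\mathbb{E}|\mathbf{X}_n^{(i)}(j,k)|^2=1$, $\mathbb{E}[\mathbf{X}_n^{(i)}(j,k)^2]=\beta_i$; and for every finite $I_0\subset I$ and $\ell\in\mathbb{N}$, $\sup_n\sup_{i\in I_0}\sup_{1\le j\le k\le n}\mathbb{E}|\mathbf{X}_n^{(i)}(j,k)|^\ell<\infty$. Band widths $b_n$ are nonnegative integers. Slow growth: $b_n\to\infty$, $b_n=o(n)$. Proportional growth: $b_n/n\to c\in(0,1]$; full proportion: $c=1$; proper proportion: $c\in(0,1)$. Random band matrices: $\mathbf{\Xi}_n(j,k)=\mathbf{1}\{|j-k|\le b_n\}\mathbf{X}_n(j,k)$; $\mathbf{\Theta}_n=(2b_n)^{-1/2}\mathbf{\Xi}_n$ for slow growth and $\mathbf{\Theta}_n=(2c-c^2)^{-1/2}n^{-1/2}\mathbf{\Xi}_n$ for proportional growth. Periodic random band matrices: with $|j-k|_n=\min\{|j-k|,n-|j-k|\}$, $\mathbf{\Lambda}_n(j,k)=(2b_n)^{-1/2}\mathbf{1}\{|j-k|_n\le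 b_n\}\mathbf{X}_n(j,k)$. Convergence in joint distribution: in the $*$-probability spaces of random $n\times n$ matrices with entries having all moments, equipped with $\mathbb{E}\frac1n\mathrm{tr}$, the expectation of every non-commutative polynomial in the family converges to that of the limit family in a $*$-probability space. A semicircular system is a family of freely independent self-adjoint standard semicircular variables (density $\frac1{2\pi}\sqrt{4-x^2}$ on $[-2,2]$). A family $(a_i)$ is free if the unital algebras generated by the individual $a_i$ are free; several families are free if the unital algebras they generate are free. The negative statements are understood for non-empty families, and the last one for $\#(I_4)\ge2$.
   Formalization: For i in I_1'' with b_n/n→c_i, the semicircular system contains sqrt(max(1,2c_i))·a_i instead of a_i; and the free families are (a_i: i∈I_1'', c_i≥1/2), a_3, and (a_i: i∈I_1'', c_i<1/2)∪a_4, since both clauses fail as printed. *)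

theory Defs
  imports
    "HOL-Probability.Probability"
    "HOL-Library.Poly_Mapping"
    "HOL-Library.Landau_Symbols"
    "HOL-Library.Nonpos_Ints"
    "Jordan_Normal_Form.Schur_Decomposition"
begin

section \<open>Non-commutative polynomials\<close>

text \<open>
  The free monoid is a wrapper around lists, so that the convolution product of
  \<^type>\<open>poly_mapping\<close> is the product of polynomials in non-commuting indeterminates.
\<close>

datatype 'i nc_word = NC_Word (letters: "'i list")

instantiation nc_word :: (type) monoid_add
begin

definition zero_nc_word :: "'a nc_word" where
  "zero_nc_word = NC_Word []"

definition plus_nc_word :: "'a nc_word \<Rightarrow> 'a nc_word \<Rightarrow> 'a nc_word" where
  "plus_nc_word u v = NC_Word (letters u @ letters v)"

instance
  by standard (simp_all add: zero_nc_word_def plus_nc_word_def)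

end

type_synonym 'i nc_poly = "'i nc_word \<Rightarrow>\<^sub>0 complex"

definition nc_vars :: "'i nc_poly \<Rightarrow> 'i set" where
  "nc_vars p = (\<Union>w\<in>Poly_Mapping.keys p. set (letters w))"


section \<open>Star-probability spaces and freeness\<close>

locale star_prob_space = vector_space scl
  for scl :: "complex \<Rightarrow> 'a::ring_1 \<Rightarrow> 'a" +
  fixes star :: "'a \<Rightarrow> 'a"
    and \<phi> :: "'a \<Rightarrow> complex"
  assumes smult_mult_left: "scl z x * y = scl z (x * y)"
    and smult_mult_right: "x * scl z y = scl z (x * y)"
    and star_star: "star (star x) = x"
    and star_add: "star (x + y) = star x + star y"
    and star_smult: "star (scl z x) = scl (cnj z) (star x)"
    and star_mult: "star (x * y) = star y * star x"
    and phi_add: "\<phi> (x + y) = \<phi> x + \<phi> y"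
    and phi_smult: "\<phi> (scl z x) = z * \<phi> x"
    and phi_one: "\<phi> 1 = 1"
    and phi_pos: "\<phi> (star x * x) \<in> \<real>\<^sub>\<ge>\<^sub>0"

definition nc_eval :: "(complex \<Rightarrow> 'a::ring_1 \<Rightarrow> 'a) \<Rightarrow> ('i \<Rightarrow> 'a) \<Rightarrow> 'i nc_poly \<Rightarrow> 'a" where
  "nc_eval scl a p =
    (\<Sum>w\<in>Poly_Mapping.keys p. scl (Poly_Mapping.lookup p w) (prod_list (map a (letters w))))"

definition unital_subalgebra :: "(complex \<Rightarrow> 'a::ring_1 \<Rightarrow> 'a) \<Rightarrow> 'a set \<Rightarrow> bool" where
  "unital_subalgebra scl B \<longleftrightarrow>
    1 \<in> B \<and> (\<forall>x\<in>B. \<forall>y\<in>B. x + y \<in> B \<and> x * y \<in> B) \<and> (\<forall>z. \<forall>x\<in>B. scl z x \<in> B)"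

definition generated_algebra :: "(complex \<Rightarrow> 'a::ring_1 \<Rightarrow> 'a) \<Rightarrow> 'a set \<Rightarrow> 'a set" where
  "generated_algebra scl S = unital_subalgebra scl hull S"

definition free_subalgebras :: "('a::ring_1 \<Rightarrow> complex) \<Rightarrow> 'k set \<Rightarrow> ('k \<Rightarrow> 'a set) \<Rightarrow> bool" where
  "free_subalgebras \<phi> K B \<longleftrightarrow>
    (\<forall>ks xs. ks \<noteq> [] \<longrightarrow> length xs = length ks \<longrightarrow> set ks \<subseteq> K \<longrightarrow> distinct_adj ks \<longrightarrow>
      (\<forall>j<length ks. xs ! j \<in> B (ks ! j) \<and> \<phi> (xs ! j) = 0) \<longrightarrow> \<phi> (prod_list xs) = 0)"

definition free_family ::
  "(complex \<Rightarrow> 'a::ring_1 \<Rightarrow> 'a) \<Rightarrow> ('a \<Rightarrow> complex) \<Rightarrow> 'i set \<Rightarrow> ('i \<Rightarrow> 'a) \<Rightarrow> bool" where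
  "free_family scl \<phi> J a \<longleftrightarrow> free_subalgebras \<phi> J (\<lambda>i. generated_algebra scl {a i})"

text \<open>Freeness of the subfamilies of \<open>a\<close> indexed by the sets in the list \<open>Js\<close>.\<close>

definition free_families ::
  "(complex \<Rightarrow> 'a::ring_1 \<Rightarrow> 'a) \<Rightarrow> ('a \<Rightarrow> complex) \<Rightarrow> 'i set list \<Rightarrow> ('i \<Rightarrow> 'a) \<Rightarrow> bool" where
  "free_families scl \<phi> Js a \<longleftrightarrow>
    free_subalgebras \<phi> {..<length Js} (\<lambda>k. generated_algebra scl (a ` (Js ! k)))"

definition standard_semicircular ::
  "('a::ring_1 \<Rightarrow> 'a) \<Rightarrow> ('a \<Rightarrow> complex) \<Rightarrow> 'a \<Rightarrow> bool" where
  "standard_semicircular star \<phi> x \<longleftrightarrow> star x = x \<and>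
    (\<forall>m. \<phi> (x ^ m) =
      complex_of_real (LBINT t:{-2..2}. t ^ m * (1 / (2 * pi) * sqrt (4 - t\<^sup>2))))"

definition semicircular_system ::
  "(complex \<Rightarrow> 'a::ring_1 \<Rightarrow> 'a) \<Rightarrow> ('a \<Rightarrow> 'a) \<Rightarrow> ('a \<Rightarrow> complex) \<Rightarrow> 'i set \<Rightarrow> ('i \<Rightarrow> 'a) \<Rightarrow> bool"
  where
  "semicircular_system scl star \<phi> J a \<longleftrightarrow>
    (\<forall>i\<in>J. standard_semicircular star \<phi> (a i)) \<and> free_family scl \<phi> J a"


section \<open>Random matrices and convergence in joint distribution\<close>

definition trace_mat :: "complex mat \<Rightarrow> complex" where
  "trace_mat A = (\<Sum>j<dim_row A. A $$ (j, j))"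

definition nc_eval_mat :: "nat \<Rightarrow> ('i \<Rightarrow> complex mat) \<Rightarrow> 'i nc_poly \<Rightarrow> complex mat" where
  "nc_eval_mat n A p = Matrix.mat n n (\<lambda>jk.
    \<Sum>w\<in>Poly_Mapping.keys p.
      Poly_Mapping.lookup p w * (foldr (\<lambda>i B. A i * B) (letters w) (1\<^sub>m n) $$ jk))"

definition converges_in_joint_distribution ::
  "(nat \<Rightarrow> 'w measure) \<Rightarrow> 'i set \<Rightarrow> (nat \<Rightarrow> 'i \<Rightarrow> 'w \<Rightarrow> complex mat) \<Rightarrow>
    (complex \<Rightarrow> 'a::ring_1 \<Rightarrow> 'a) \<Rightarrow> ('a \<Rightarrow> complex) \<Rightarrow> ('i \<Rightarrow> 'a) \<Rightarrow> bool" where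
  "converges_in_joint_distribution M I Y scl \<phi> a \<longleftrightarrow>
    (\<forall>p. nc_vars p \<subseteq> I \<longrightarrow>
      (\<lambda>n. integral\<^sup>L (M n)
             (\<lambda>\<omega>. 1 / of_nat n * trace_mat (nc_eval_mat n (\<lambda>i. Y n i \<omega>) p)))
        \<longlonglongrightarrow> \<phi> (nc_eval scl a p))"

text \<open>
  Matrix indices run over \<open>0, \<dots>, n - 1\<close>. The probability space may depend on \<open>n\<close>, and no
  centering is imposed on the diagonal.
\<close>

definition wigner_family ::
  "(nat \<Rightarrow> 'w measure) \<Rightarrow> 'i set \<Rightarrow> ('i \<Rightarrow> complex) \<Rightarrow> (nat \<Rightarrow> 'i \<Rightarrow> 'w \<Rightarrow> complex mat) \<Rightarrow> bool"
  where
  "wigner_family M I \<beta> X \<longleftrightarrow>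
    (\<forall>n. prob_space (M n)) \<and>
    (\<forall>n. \<forall>i\<in>I. \<forall>\<omega>\<in>space (M n).
      X n i \<omega> \<in> carrier_mat n n \<and> mat_adjoint (X n i \<omega>) = X n i \<omega>) \<and>
    (\<forall>n. prob_space.indep_vars (M n) (\<lambda>_. borel) (\<lambda>(i, j, k) \<omega>. X n i \<omega> $$ (j, k))
      {(i, j, k). i \<in> I \<and> j \<le> k \<and> k < n}) \<and>
    (\<forall>n. \<forall>i\<in>I. \<forall>j k. j < k \<and> k < n \<longrightarrow>
      integral\<^sup>L (M n) (\<lambda>\<omega>. X n i \<omega> $$ (j, k)) = 0 \<and>
      integral\<^sup>L (M n) (\<lambda>\<omega>. (cmod (X n i \<omega> $$ (j, k)))\<^sup>2) = 1 \<and>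
      integral\<^sup>L (M n) (\<lambda>\<omega>. (X n i \<omega> $$ (j, k))\<^sup>2) = \<beta> i) \<and>
    (\<forall>I0. finite I0 \<and> I0 \<subseteq> I \<longrightarrow> (\<forall>l::nat. \<exists>C. \<forall>n. \<forall>i\<in>I0. \<forall>j k. j \<le> k \<and> k < n \<longrightarrow>
      integrable (M n) (\<lambda>\<omega>. cmod (X n i \<omega> $$ (j, k)) ^ l) \<and>
      integral\<^sup>L (M n) (\<lambda>\<omega>. cmod (X n i \<omega> $$ (j, k)) ^ l) \<le> C))"


section \<open>Random band matrices\<close>

definition slow_growth :: "(nat \<Rightarrow> nat) \<Rightarrow> bool" where
  "slow_growth b \<longleftrightarrow> filterlim b at_top sequentially \<and> (\<lambda>n. real (b n)) \<in> o(\<lambda>n. real n)"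

definition proportional_growth :: "(nat \<Rightarrow> nat) \<Rightarrow> real \<Rightarrow> bool" where
  "proportional_growth b c \<longleftrightarrow> 0 < c \<and> c \<le> 1 \<and> (\<lambda>n. real (b n) / real n) \<longlonglongrightarrow> c"

definition full_proportion :: "(nat \<Rightarrow> nat) \<Rightarrow> bool" where
  "full_proportion b \<longleftrightarrow> proportional_growth b 1"

definition proper_proportion :: "(nat \<Rightarrow> nat) \<Rightarrow> real \<Rightarrow> bool" where
  "proper_proportion b c \<longleftrightarrow> proportional_growth b c \<and> c < 1"

definition band_matrix :: "nat \<Rightarrow> nat \<Rightarrow> complex mat \<Rightarrow> complex mat" where
  "band_matrix n b A = Matrix.mat n n (\<lambda>(j, k).
    if \<bar>int j - int k\<bar> \<le> int b then A $$ (j, k) else 0)"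

definition cyclic_dist :: "nat \<Rightarrow> nat \<Rightarrow> nat \<Rightarrow> int" where
  "cyclic_dist n j k = min \<bar>int j - int k\<bar> (int n - \<bar>int j - int k\<bar>)"

definition periodic_band_matrix :: "nat \<Rightarrow> nat \<Rightarrow> complex mat \<Rightarrow> complex mat" where
  "periodic_band_matrix n b A = Matrix.mat n n (\<lambda>(j, k).
    if cyclic_dist n j k \<le> int b then A $$ (j, k) else 0)"

definition Theta_slow :: "nat \<Rightarrow> nat \<Rightarrow> complex mat \<Rightarrow> complex mat" where
  "Theta_slow n b A = complex_of_real (1 / sqrt (2 * real b)) \<cdot>\<^sub>m band_matrix n b A"

definition Theta_prop :: "real \<Rightarrow> nat \<Rightarrow> nat \<Rightarrow> complex mat \<Rightarrow> complex mat" where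
  "Theta_prop c n b A =
    complex_of_real (1 / (sqrt (2 * c - c\<^sup>2) * sqrt (real n))) \<cdot>\<^sub>m band_matrix n b A"

definition Lambda :: "nat \<Rightarrow> nat \<Rightarrow> complex mat \<Rightarrow> complex mat" where
  "Lambda n b A = complex_of_real (1 / sqrt (2 * real b)) \<cdot>\<^sub>m periodic_band_matrix n b A"

text \<open>
  With \<open>b n / n\<close> tending to \<open>c\<close>, a row of a periodic band matrix has about
  \<open>min (2 * c) 1 * n\<close> entries in the band, since the cyclic distance never exceeds \<open>n / 2\<close>.
  The normalization \<open>(2 * b n) powr (-1/2)\<close> therefore gives the limit the variance
  \<open>1 / max 1 (2 * c)\<close>, which is \<open>1\<close> exactly when \<open>c \<le> 1/2\<close>. The following factor restores
  unit variance. The band covers all but a vanishing fraction of the entries exactly when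
  \<open>1/2 \<le> c\<close>; for \<open>c < 1/2\<close> the limit need not be free from that of a non-periodic band
  matrix of proper proportion.
\<close>

definition periodic_correction :: "real \<Rightarrow> real" where
  "periodic_correction c = sqrt (max 1 (2 * c))"

end

(*
  Expanding the trace of a word in the matrices gives a sum over closed walks. Only the paired walks
  with the maximal number of vertices survive in the limit; each of them retraces a plane tree in a
  unique way, so the sum over them obeys the recursion of the moments of operator-valued semicircular
  elements over functions on the unit interval, the covariance of a letter being the limit of its
  normalised band. Slow growth gives the identity, proportional growth an integral operator. Elements
  whose covariance is a multiple of the mean are semicircular and free from everything else. Slowly
  growing and non-periodic bands of proper proportion interact through the row sums of the latter,
  which are tent functions: these are not constant, and any two of them are positively correlated.
*)

theory Submission
  imports Defs
begin

section \<open>Paired walks\<close>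

text \<open>The diagonal is not centered and the parameters \<open>\<beta> i\<close> are arbitrary,
  yet neither reaches the limit: a walk with the maximal number of vertices has no loops and crosses
  each of its edges once in each direction, so it only meets E|X|^2 = 1. The bound on all other
  paired walks does not depend on the shape of the band. It uses that the normalised entries tend to
  0 and that the rows have bounded mass: row mass pays for the choice of a new vertex, and one
  unmatched step supplies a vanishing factor. The limit of the covariances cannot be taken uniformly
  in the row, because rows near the boundary behave differently. It is taken along all sequences of
  rows with J n / n -> x for 0 < x < 1, a mode of convergence that passes through averages over
  windows of width o(n) as well as through Riemann sums. The limit family consists of the
  indeterminates of the polynomial ring; traciality and positivity of its state are inherited from
  the matrices. Freeness is obtained without cumulants, from a Schwinger-Dyson equation for the
  letters whose covariance is a multiple of the mean.\<close>

text \<open>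
  A walk is given by its starting vertex \<open>j\<close> and the list \<open>W\<close> of the vertices visited afterwards.
\<close>

definition steps :: "nat \<Rightarrow> 'i list \<Rightarrow> nat list \<Rightarrow> ('i \<times> nat \<times> nat) list" where
  "steps j w W = zip w (zip (j # W) W)"

lemma steps_simps [simp]:
  "steps j [] W = []" "steps j w [] = []"
  "steps j (i # w) (k # W) = (i, j, k) # steps k w W"
  by (simp_all add: steps_def)

lemma length_steps [simp]: "length W = length w \<Longrightarrow> length (steps j w W) = length w"
  by (simp add: steps_def)

lemma nth_steps:
  "length W = length w \<Longrightarrow> p < length w \<Longrightarrow> steps j w W ! p = (w ! p, (j # W) ! p, W ! p)"
  by (simp add: steps_def)

lemma map_fst_steps: "length W = length w \<Longrightarrow> map fst (steps j w W) = w"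
  by (simp add: steps_def)

lemma steps_append:
  "length A = length u \<Longrightarrow> steps j (u @ v) (A @ B) = steps j u A @ steps (last (j # A)) v B"
proof (induction u arbitrary: j A)
  case (Cons i u)
  then show ?case by (cases A) auto
qed simp

text \<open>Reversal turns the end of the walk into its start and makes the old start
  \<open>j\<close> the last vertex visited, hence \<open>butlast (j # A)\<close>. It serves to walk
  an excursion backwards without changing its keys.\<close>

lemma steps_rev:
  "length A = length u \<Longrightarrow>
    steps (last (j # A)) (rev u) (rev (butlast (j # A))) =
      rev (map (\<lambda>(i, a, b). (i, b, a)) (steps j u A))"
proof (induction u arbitrary: j A)
  case (Cons i u)
  then obtain k A' where A: "A = k # A'" by (cases A) auto
  have len: "length (rev (butlast (k # A'))) = length (rev u)"
    using Cons.prems A by (simp del: butlast.simps)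
  have last: "last (last (k # A') # rev (butlast (k # A'))) = k"
    by (cases A' rule: rev_cases) (simp_all add: butlast_append last_rev)
  have "steps (last (j # A)) (rev (i # u)) (rev (butlast (j # A))) =
     steps (last (k # A')) (rev u @ [i]) (rev (butlast (k # A')) @ [j])"
    by (simp add: A)
  also have "\<dots> = steps (last (k # A')) (rev u) (rev (butlast (k # A'))) @ [(i, k, j)]"
    unfolding steps_append[OF len] last by simp
  finally show ?case using Cons.IH[of A' k] Cons.prems by (simp add: A)
qed simp

lemma steps_vertices:
  assumes "(i, a, b) \<in> set (steps j w W)"
  shows "a \<in> set (j # W)" "b \<in> set W" "i \<in> set w"
proof -
  have "(a, b) \<in> set (zip (j # W) W)" and i: "i \<in> set w"
    using assms unfolding steps_def by (meson in_set_zipE)+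
  then show "a \<in> set (j # W)" "b \<in> set W" "i \<in> set w"
    by (meson in_set_zipE)+
qed

lemma walk_split:
  assumes "length A = length u" "z \<in> set (j # A)"
  obtains u1 u2 A1 A2 where "u = u1 @ u2" "A = A1 @ A2" "length A1 = length u1"
    "length A2 = length u2" "last (j # A1) = z"
proof -
  obtain p where p: "p < length (j # A)" "(j # A) ! p = z"
    using assms(2) by (metis in_set_conv_nth)
  have "last (j # take p A) = z"
    using p by (cases p) (auto simp: take_Suc_conv_app_nth)
  then show thesis
    using p assms(1) by (intro that[of "take p u" "drop p u" "take p A" "drop p A"]) auto
qed

section \<open>Pairing of steps and the bound on the number of vertices\<close>

fun key :: "'i \<times> nat \<times> nat \<Rightarrow> 'i \<times> nat set" where
  "key (i, a, b) = (i, {a, b})"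

abbreviation step_keys :: "nat \<Rightarrow> 'i list \<Rightarrow> nat list \<Rightarrow> ('i \<times> nat set) multiset" where
  "step_keys j w W \<equiv> mset (map key (steps j w W))"

text \<open>Keys forget the direction because the entries at (a, b) and (b, a) are conjugate, hence
  dependent. Loops are exempt: off-diagonal entries are centered, diagonal ones need not be.\<close>

definition paired :: "nat \<Rightarrow> 'i list \<Rightarrow> nat list \<Rightarrow> bool" where
  "paired j w W \<longleftrightarrow>
    (\<forall>i a b. (i, a, b) \<in> set (steps j w W) \<longrightarrow> a \<noteq> b \<longrightarrow> 2 \<le> count (step_keys j w W) (i, {a, b}))"

text \<open>\<open>S\<close> collects the vertices already visited. Started with
  \<open>S = {j}\<close>, the listed steps form a spanning tree of the graph of the walk, so there
  is one of them for each vertex other than \<open>j\<close>.\<close>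

fun new_steps :: "nat set \<Rightarrow> nat \<Rightarrow> 'i list \<Rightarrow> nat list \<Rightarrow> ('i \<times> nat \<times> nat) list" where
  "new_steps S j (i # w) (k # W) =
    (if k \<in> S then new_steps S k w W else (i, j, k) # new_steps (insert k S) k w W)"
| "new_steps S j w W = []"

lemma set_new_steps: "set (new_steps S j w W) \<subseteq> set (steps j w W)"
  by (induction S j w W rule: new_steps.induct) auto

lemma new_steps_fresh:
  "j \<in> S \<Longrightarrow> (i, a, b) \<in> set (new_steps S j w W) \<Longrightarrow> b \<notin> S \<and> a \<noteq> b"
  by (induction S j w W rule: new_steps.induct) (auto split: if_splits)

lemma length_new_steps:
  "length W = length w \<Longrightarrow> length (new_steps S j w W) = card (set W - S)"
proof (induction S j w W rule: new_steps.induct)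
  case (1 S j i w k W)
  show ?case
  proof (cases "k \<in> S")
    case False
    have "set (k # W) - S = insert k (set W - insert k S)" using False by auto
    then show ?thesis using 1 False by simp
  next
    case True
    then have "set (k # W) - S = set W - S" by auto
    then show ?thesis using 1 True by simp
  qed
qed auto

text \<open>A discovery leads to a vertex outside the set visited so far, so its edge contains a
  vertex that no earlier discovery has touched.\<close>

lemma distinct_new_keys: "j \<in> S \<Longrightarrow> distinct (map key (new_steps S j w W))"
proof (induction S j w W rule: new_steps.induct)
  case (1 S j i w k W)
  have "key (i, j, k) \<notin> key ` set (new_steps (insert k S) k w W)"
  proof
    assume "key (i, j, k) \<in> key ` set (new_steps (insert k S) k w W)"
    then obtain a b where ab: "(i, a, b) \<in> set (new_steps (insert k S) k w W)" "{j, k} = {a, b}"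
      by auto
    from new_steps_fresh[OF _ ab(1)] have "b \<notin> insert k S" by simp
    then show False using ab(2) 1(3) by (auto simp: doubleton_eq_iff)
  qed
  then show ?case using 1 by auto
qed auto

lemma count_mset_distinct: "distinct xs \<Longrightarrow> count (mset xs) x = (if x \<in> set xs then 1 else 0)"
  by (meson count_mset_0_iff distinct_count_atmost_1)

text \<open>The keys of the discoveries are distinct, and pairing provides a second crossing for
  each of them, so they fit twice into the multiset of all keys.\<close>

lemma double_new_keys:
  assumes "paired j w W"
  shows "mset (map key (new_steps {j} j w W)) + mset (map key (new_steps {j} j w W)) \<subseteq># step_keys j w W"
proof (rule mset_subset_eqI)
  fix e :: "'a \<times> nat set"
  let ?K = "map key (new_steps {j} j w W)"
  have d: "distinct ?K" by (rule distinct_new_keys) simp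
  show "count (mset ?K + mset ?K) e \<le> count (step_keys j w W) e"
  proof (cases "e \<in> set ?K")
    case True
    then obtain i a b where ab: "(i, a, b) \<in> set (new_steps {j} j w W)" "e = (i, {a, b})" by auto
    have "a \<noteq> b" using new_steps_fresh[OF _ ab(1)] by simp
    moreover have "(i, a, b) \<in> set (steps j w W)" using ab(1) set_new_steps by blast
    ultimately have "2 \<le> count (step_keys j w W) e" using assms ab(2) by (auto simp: paired_def)
    moreover have "count (mset ?K) e = 1" using d True by (simp only: count_mset_distinct if_True)
    ultimately show ?thesis by (simp only: count_union)
  next
    case False
    then have "count (mset ?K) e = 0" by (simp only: count_mset_0_iff not_False_eq_True)
    then show ?thesis by (simp only: count_union)
  qed
qed

lemma fst_key [simp]: "fst (key s) = fst s"
  by (cases s) auto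

text \<open>Keeping the letters, and not only their number, matters for the weights: a discovery by
  the letter i is charged to two occurrences of i in the word.\<close>

lemma paired_colours:
  assumes "paired j w W" "length W = length w"
  shows "mset (map fst (new_steps {j} j w W)) + mset (map fst (new_steps {j} j w W)) \<subseteq># mset w"
proof -
  have "image_mset fst (mset (map key (new_steps {j} j w W)) + mset (map key (new_steps {j} j w W)))
      \<subseteq># image_mset fst (step_keys j w W)"
    by (rule image_mset_subseteq_mono[OF double_new_keys[OF assms(1)]])
  moreover have "fst \<circ> key = (fst :: 'a \<times> nat \<times> nat \<Rightarrow> 'a)" by auto
  ultimately show ?thesis using map_fst_steps[OF assms(2), of j]
    by (simp add: image_mset.compositionality flip: mset_map)
qed

lemma card_walk: "card (set (j # W)) = Suc (card (set W - {j}))"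
proof -
  have "set (j # W) = insert j (set W - {j})" by auto
  then show ?thesis by (metis Diff_iff card_insert_disjoint finite_Diff finite_set singletonI)
qed

text \<open>Each vertex other than the start uses up two steps of the walk.\<close>

lemma paired_card_le:
  assumes "paired j w W" "length W = length w"
  shows "2 * card (set (j # W)) \<le> length w + 2"
proof -
  have "size (mset (map fst (new_steps {j} j w W)) + mset (map fst (new_steps {j} j w W))) \<le> size (mset w)"
    by (rule size_mset_mono[OF paired_colours[OF assms]])
  then show ?thesis unfolding card_walk using length_new_steps[OF assms(2), of "{j}" j] by simp
qed

text \<open>The equality case of \<open>paired_card_le\<close>: every step is a discovery or the
  second crossing of a discovered edge, so the graph of the walk is a tree without loops.\<close>

definition tree_walk :: "nat \<Rightarrow> 'i list \<Rightarrow> nat list \<Rightarrow> bool" where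
  "tree_walk j w W \<longleftrightarrow> paired j w W \<and> last (j # W) = j \<and> 2 * card (set (j # W)) = length w + 2"

text \<open>With the maximal number of vertices the doubled discoveries exhaust all steps; the
  discoveries have distinct keys, and each joins two different vertices.\<close>

lemma tree_walk_keys:
  assumes "tree_walk j w W" "length W = length w"
  shows "e \<in># step_keys j w W \<Longrightarrow> count (step_keys j w W) e = 2"
    and "(i, a, b) \<in> set (steps j w W) \<Longrightarrow> a \<noteq> b"
proof -
  let ?K = "map key (new_steps {j} j w W)"
  have p: "paired j w W" and c: "2 * card (set (j # W)) = length w + 2"
    using assms by (auto simp: tree_walk_def)
  have eq: "mset ?K + mset ?K = step_keys j w W"
  proof (rule ccontr)
    assume "mset ?K + mset ?K \<noteq> step_keys j w W"
    then have "mset ?K + mset ?K \<subset># step_keys j w W"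
      using double_new_keys[OF p] by simp
    then have "size (mset ?K + mset ?K) < size (step_keys j w W)" by (rule mset_subset_size)
    then show False using c length_new_steps[OF assms(2), of "{j}" j] assms(2)
      unfolding card_walk by simp
  qed
  have d: "distinct ?K" by (rule distinct_new_keys) simp
  show "count (step_keys j w W) e = 2" if "e \<in># step_keys j w W"
  proof -
    have "e \<in> set ?K" using that unfolding eq[symmetric] by simp
    moreover have "count (step_keys j w W) e = count (mset ?K) e + count (mset ?K) e"
      unfolding eq[symmetric] by (rule count_union)
    moreover have "count (mset ?K) e = 1" using d calculation(1) by (simp only: count_mset_distinct if_True)
    ultimately show ?thesis by simp
  qed
  show "a \<noteq> b" if "(i, a, b) \<in> set (steps j w W)"
  proof
    assume "a = b"
    have "(i, {a, b}) \<in># step_keys j w W" using that by force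
    then have "(i, {a, b}) \<in> set ?K" unfolding eq[symmetric] by simp
    then obtain a' b' where "(i, a', b') \<in> set (new_steps {j} j w W)" "{a, b} = {a', b'}" by auto
    then show False using new_steps_fresh[of j "{j}" i a' b' w W] \<open>a = b\<close> by auto
  qed
qed

section \<open>Retracings of plane trees\<close>

text \<open>
  The number of non-crossing pairings of the steps of a walk such that paired steps carry the same
  letter and traverse the same edge in opposite directions.
\<close>

function (sequential) retracings :: "nat \<Rightarrow> 'i list \<Rightarrow> nat list \<Rightarrow> nat" where
  "retracings j (i # w) (k # W) =
    (\<Sum>p<length w. if w ! p = i \<and> W ! p = j
      then retracings k (take p w) (take p W) * retracings j (drop (Suc p) w) (drop (Suc p) W)
      else 0)"
| "retracings j [] W = 1"
| "retracings j w [] = 0"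
  by pat_completeness auto
termination by (relation "Wellfounded.measure (\<lambda>(j, w, W). length w)") auto

lemma retracings_cases:
  assumes "retracings j w W \<noteq> 0" "length W = length w" "w \<noteq> []"
  obtains i k u v A B where "w = i # u @ i # v" "W = k # A @ j # B" "length A = length u"
    "length B = length v" "retracings k u A \<noteq> 0" "retracings j v B \<noteq> 0"
proof -
  obtain i w' where w: "w = i # w'" using assms by (cases w) auto
  obtain k W' where W: "W = k # W'" using assms w by (cases W) auto
  from assms(1) obtain p where p: "p < length w'" "w' ! p = i" "W' ! p = j"
    "retracings k (take p w') (take p W') \<noteq> 0"
    "retracings j (drop (Suc p) w') (drop (Suc p) W') \<noteq> 0"
    unfolding w W by (auto elim!: sum.not_neutral_contains_not_neutral split: if_splits)
  have "w' = take p w' @ i # drop (Suc p) w'" "W' = take p W' @ j # drop (Suc p) W'"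
    using p id_take_nth_drop[of p w'] id_take_nth_drop[of p W'] assms(2) by (simp_all add: w W)
  then show thesis
    using p assms(2)
    by (intro that[of i "take p w'" "drop (Suc p) w'" k "take p W'" "drop (Suc p) W'"])
       (simp_all add: w W)
qed

lemma retracings_closed:
  "retracings j w W \<noteq> 0 \<Longrightarrow> length W = length w \<Longrightarrow> last (j # W) = j"
proof (induction "length w" arbitrary: j w W rule: less_induct)
  case less
  show ?case
  proof (cases "w = []")
    case False
    from retracings_cases[OF less.prems this] obtain i k u v A B where *:
      "w = i # u @ i # v" "W = k # A @ j # B" "length A = length u"
      "length B = length v" "retracings k u A \<noteq> 0" "retracings j v B \<noteq> 0" by metis
    have "last (j # B) = j" using less.hyps[of v j B] * by simp
    then show ?thesis using * by simp
  qed (use less.prems in auto)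
qed

text \<open>The partner of a step crosses the same edge backwards. Consequently an edge contributes
  entries in conjugate pairs, and on a tree the second moment without conjugation never
  appears.\<close>

lemma retracings_balanced:
  "retracings j w W \<noteq> 0 \<Longrightarrow> length W = length w \<Longrightarrow>
    count (mset (steps j w W)) (c, a, b) = count (mset (steps j w W)) (c, b, a)"
proof (induction "length w" arbitrary: j w W rule: less_induct)
  case less
  show ?case
  proof (cases "w = []")
    case False
    from retracings_cases[OF less.prems this] obtain i k u v A B where *:
      "w = i # u @ i # v" "W = k # A @ j # B" "length A = length u"
      "length B = length v" "retracings k u A \<noteq> 0" "retracings j v B \<noteq> 0" by metis
    have "last (k # A) = k" using retracings_closed * by blast
    then have "mset (steps j w W) =
        {#(i, j, k), (i, k, j)#} + mset (steps k u A) + mset (steps j v B)"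
      using * by (simp add: steps_append)
    moreover have "count (mset (steps k u A)) (c, a, b) = count (mset (steps k u A)) (c, b, a)"
      using less.hyps[of u k A] * by simp
    moreover have "count (mset (steps j v B)) (c, a, b) = count (mset (steps j v B)) (c, b, a)"
      using less.hyps[of v j B] * by simp
    moreover have "count {#(i, j, k), (i, k, j)#} (c, a, b) = count {#(i, j, k), (i, k, j)#} (c, b, a)"
      by (cases "c = i"; cases "j = a"; cases "k = b"; cases "j = b"; cases "k = a"; simp)
    ultimately show ?thesis by (simp only: count_union)
  qed (use less.prems in auto)
qed

text \<open>For a \<noteq> b the steps (i, a, b) and (i, b, a) differ but share their key, and
  balance provides the second one.\<close>

lemma retracings_paired:
  assumes "retracings j w W \<noteq> 0" "length W = length w"
  shows "paired j w W"
  unfolding paired_def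
proof (intro allI impI)
  fix i a b assume ab: "(i, a, b) \<in> set (steps j w W)" "a \<noteq> b"
  let ?s = "mset (steps j w W)"
  have "{#(i, a, b), (i, b, a)#} \<subseteq># ?s"
  proof (rule mset_subset_eqI)
    fix x
    have "count ?s (i, a, b) > 0" using ab by simp
    moreover have "count ?s (i, b, a) > 0"
      using retracings_balanced[OF assms, of i a b] calculation by simp
    ultimately show "count {#(i, a, b), (i, b, a)#} x \<le> count ?s x"
      using ab(2) by (auto simp: Suc_le_eq)
  qed
  then have "image_mset key {#(i, a, b), (i, b, a)#} \<subseteq># image_mset key ?s"
    by (rule image_mset_subseteq_mono)
  then have "count (image_mset key {#(i, a, b), (i, b, a)#}) (i, {a, b})
      \<le> count (image_mset key ?s) (i, {a, b})"
    by (rule mset_subset_eq_count)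
  then show "2 \<le> count (step_keys j w W) (i, {a, b})"
    by (simp add: insert_commute)
qed

text \<open>Any bound in terms of the length alone serves the purpose. For a tail of length m the
  recursion has m terms of size at most p! (m - 1 - p)! \<le> m!, and m m! \<le> (m + 1)!.\<close>

lemma retracings_le_fact: "length W = length w \<Longrightarrow> retracings j w W \<le> fact (length w)"
proof (induction "length w" arbitrary: j w W rule: less_induct)
  case less
  show ?case
  proof (cases w)
    case (Cons i w')
    then obtain k W' where W: "W = k # W'" using less.prems by (cases W) auto
    have len: "length W' = length w'" using less.prems Cons W by simp
    have "retracings j w W \<le> (\<Sum>p<length w'. fact (length w'))"
      unfolding Cons W retracings.simps
    proof (intro sum_mono)
      fix p assume "p \<in> {..<length w'}"
      then have p: "p < length w'" by simp
      have "retracings k (take p w') (take p W') \<le> fact p"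
        using less.hyps[of "take p w'" "take p W'" k] p len by (simp add: Cons)
      moreover have "retracings j (drop (Suc p) w') (drop (Suc p) W') \<le> fact (length w' - Suc p)"
        using less.hyps[of "drop (Suc p) w'" "drop (Suc p) W'" j] p len by (simp add: Cons)
      moreover have "fact p * fact (length w' - Suc p) \<le> (fact (length w') :: nat)"
      proof -
        have "fact p * fact (length w' - Suc p) dvd (fact (p + (length w' - Suc p)) :: nat)"
          by (rule fact_fact_dvd_fact)
        then have "fact p * fact (length w' - Suc p) \<le> (fact (p + (length w' - Suc p)) :: nat)"
          by (simp add: dvd_imp_le)
        also have "\<dots> \<le> fact (length w')" using p by (intro fact_mono) simp
        finally show ?thesis .
      qed
      ultimately show "(if w' ! p = i \<and> W' ! p = j
          then retracings k (take p w') (take p W') * retracings j (drop (Suc p) w') (drop (Suc p) W')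
          else 0) \<le> fact (length w')"
        by (auto intro: order_trans[OF mult_mono])
    qed
    also have "\<dots> \<le> fact (length w)" by (simp add: Cons)
    finally show ?thesis .
  qed simp
qed

lemma count_mset_map_nth:
  "count (mset (map f xs)) y = card {l. l < length xs \<and> f (xs ! l) = y}"
  unfolding count_mset count_list_eq_length_filter length_filter_conv_card
  by (rule arg_cong[of _ _ card]) auto

lemma count_mset_le1_unique:
  assumes "count (mset xs) x = 1" "p < length xs" "q < length xs" "xs ! p = x" "xs ! q = x"
  shows "p = q"
proof (rule ccontr)
  assume "p \<noteq> q"
  have "card {p, q} \<le> card {i. i < length xs \<and> xs ! i = x}"
    using assms by (intro card_mono) auto
  moreover have "count (mset xs) x = card {i. i < length xs \<and> xs ! i = x}"
    using count_mset_map_nth[of "\<lambda>x. x" xs x] by simp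
  ultimately show False using assms(1) \<open>p \<noteq> q\<close> by simp
qed

lemma mset_map_key_flip: "mset (map key (rev (map (\<lambda>(i, a, b). (i, b, a)) xs))) = mset (map key xs)"
  by (induction xs) (auto simp: insert_commute)

text \<open>
  The first step has a unique partner. If the partner had the same direction, or if the excursion
  between the two steps met the remaining walk, the other steps could be rearranged into a shorter
  paired walk through the same vertices, contradicting \<open>paired_card_le\<close>.
\<close>

lemma tree_walk_retracings:
  "tree_walk j w W \<Longrightarrow> length W = length w \<Longrightarrow> retracings j w W = 1"
proof (induction "length w" arbitrary: j w W rule: less_induct)
  case less
  show ?case
  proof (cases w)
    case (Cons i w')
    then obtain k W' where W: "W = k # W'" using less.prems by (cases W) auto
    note w = Cons
    have len: "length W' = length w'" using less.prems w W by simp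
    have card_V: "2 * card (set (j # W)) = length w + 2" and last_W: "last (j # W) = j"
      using less.prems by (auto simp: tree_walk_def)
    note keys2 = tree_walk_keys(1)[OF less.prems]
    have jk: "j \<noteq> k" by (rule tree_walk_keys(2)[OF less.prems, of i]) (simp add: w W)
    define e where "e = (i, {j, k})"
    have "count (step_keys j w W) e = 2" by (rule keys2) (simp add: w W e_def)
    then have count1: "count (mset (map key (steps k w' W'))) e = 1" by (simp add: w W e_def)
    then have "e \<in> set (map key (steps k w' W'))" by (metis count_mset_0_iff zero_neq_one)
    then obtain p where "p < length (map key (steps k w' W'))" "map key (steps k w' W') ! p = e"
      unfolding in_set_conv_nth by blast
    then have p: "p < length w'" "key (steps k w' W' ! p) = e" using len by simp_all
    define u v A B x y where defs: "u = take p w'" "v = drop (Suc p) w'" "A = take p W'"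
      "B = drop (Suc p) W'" "x = (k # W') ! p" "y = W' ! p"
    have wp: "w' ! p = i" and xy: "{x, y} = {j, k}"
      using p nth_steps[OF len p(1), of k] by (auto simp: e_def defs)
    have w': "w' = u @ i # v" using id_take_nth_drop[OF p(1)] wp unfolding defs by metis
    have W': "W' = A @ y # B" using id_take_nth_drop[of p W'] p(1) len unfolding defs by metis
    have lenA: "length A = length u" and lenB: "length B = length v" using len p(1) by (auto simp: defs)
    have xlast: "last (k # A) = x"
    proof (cases p)
      case (Suc q)
      then have "q < length W'" using p(1) len by simp
      then show ?thesis using Suc by (simp add: defs take_Suc_conv_app_nth)
    qed (simp add: defs)
    have st: "steps j w W = (i, j, k) # steps k u A @ (i, x, y) # steps y v B"
      unfolding w W w' W' steps_simps steps_append[OF lenA] xlast by simp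
    have kxy: "key (i, x, y) = e" using xy by (simp add: e_def)
    \<comment> \<open>\<open>Q\<close> holds the keys of all steps except the first one and its
      partner; each of them has multiplicity exactly 2.\<close>
    define Q where "Q = step_keys k u A + step_keys y v B"
    have Q: "step_keys j w W = {#e, e#} + Q"
      unfolding st Q_def by (simp add: kxy del: key.simps) (simp add: e_def)
    have countQ: "count Q f = 2" if "f \<in># Q" for f
    proof -
      have "count ({#e, e#} + Q) f = 2" using keys2[of f] that unfolding Q by simp
      moreover have "count ({#e, e#} + Q) e = 2" using keys2[of e] unfolding Q by simp
      then have "e \<notin># Q" by (simp add: not_in_iff)
      ultimately show ?thesis using that by (cases "f = e") auto
    qed
    \<comment> \<open>A walk with these keys is paired but two steps shorter, too short to visit all
      vertices of the original walk. Both rearrangements below are refuted by this.\<close>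
    have no_short: False if "length C = length z" "step_keys a z C = Q"
      "set (a # C) = set (j # W)" for a z C
    proof -
      have "paired a z C"
        unfolding paired_def
      proof (intro allI impI)
        fix c s t assume "(c, s, t) \<in> set (steps a z C)"
        then have "(c, {s, t}) \<in># step_keys a z C" by force
        then show "2 \<le> count (step_keys a z C) (c, {s, t})" unfolding that(2) by (simp only: countQ order_refl)
      qed
      from paired_card_le[OF this that(1)] have "2 * card (set (j # W)) \<le> length z + 2"
        using that(3) by simp
      moreover have "length z + 2 = length w"
        using arg_cong[OF Q, of size] arg_cong[OF that(2), of size] that(1) less.prems by simp
      ultimately show False using card_V by simp
    qed
    have lastB: "last (y # B) = j" using last_W unfolding W W' by simp
    have "x = k \<and> y = j"
    proof (rule ccontr)
      assume "\<not> (x = k \<and> y = j)"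
      then have xj: "x = j" "y = k" using xy by (auto simp: doubleton_eq_iff)
      \<comment> \<open>If the partner runs from \<open>j\<close> to \<open>k\<close> again, both
        \<open>A\<close> and \<open>B\<close> lead from \<open>k\<close> to \<open>j\<close>;
        walking \<open>B\<close> backwards after \<open>A\<close> closes the walk at
        \<open>k\<close>.\<close>
      let ?C = "A @ rev (butlast (k # B))"
      have "steps k (u @ rev v) ?C = steps k u A @ rev (map (\<lambda>(i, a, b). (i, b, a)) (steps k v B))"
        using steps_append[OF lenA, of k "rev v"] steps_rev[OF lenB, of k] xlast lastB xj by simp
      then have "step_keys k (u @ rev v) ?C = Q"
        using mset_map_key_flip[of "steps k v B"] unfolding Q_def xj by simp
      moreover have "set (k # ?C) = set (j # W)"
      proof -
        have "set (k # B) = insert j (set (butlast (k # B)))"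
          using lastB xj append_butlast_last_id[of "k # B"] by (metis list.distinct(1) set_append list.simps(15) list.set(1) Un_insert_right sup_bot_right)
        moreover have "j \<in> set (k # A)" using xlast xj by (metis last_in_set list.distinct(1))
        ultimately show ?thesis unfolding W W' xj by auto
      qed
      ultimately show False using no_short[of ?C "u @ rev v" k] lenA lenB by (simp del: butlast.simps)
    qed
    then have x: "x = k" and y: "y = j" by auto
    have disj: "set (k # A) \<inter> set (j # B) = {}"
    proof (rule ccontr)
      assume "set (k # A) \<inter> set (j # B) \<noteq> {}"
      then obtain z where z: "z \<in> set (k # A)" "z \<in> set (j # B)" by blast
      obtain u1 u2 A1 A2 where A: "u = u1 @ u2" "A = A1 @ A2" "length A1 = length u1"
        "length A2 = length u2" "last (k # A1) = z" using walk_split[OF lenA z(1)] by metis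
      obtain v1 v2 B1 B2 where B: "v = v1 @ v2" "B = B1 @ B2" "length B1 = length v1"
        "length B2 = length v2" "last (j # B1) = z" using walk_split[OF lenB z(2)] by metis
      \<comment> \<open>The second walk is closed at \<open>j\<close>, so it can be entered at the
        common vertex \<open>z\<close>: follow \<open>B2\<close> to \<open>j\<close>, then
        \<open>B1\<close> back to \<open>z\<close>, and resume the excursion.\<close>
      let ?C = "A1 @ B2 @ B1 @ A2" and ?z = "u1 @ v2 @ v1 @ u2"
      have l2: "last (z # B2) = j" using lastB y B(5) unfolding B(2) by (cases B2) auto
      have stA: "steps k u A = steps k u1 A1 @ steps z u2 A2"
        unfolding A(1,2) steps_append[OF A(3)] A(5) ..
      have stB: "steps j v B = steps j v1 B1 @ steps z v2 B2"
        unfolding B(1,2) steps_append[OF B(3)] B(5) ..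
      have "steps k ?z ?C = steps k u1 A1 @ steps z v2 B2 @ steps j v1 B1 @ steps z u2 A2"
        unfolding steps_append[OF A(3)] steps_append[OF B(3)] steps_append[OF B(4)] A(5) l2 B(5) ..
      then have "step_keys k ?z ?C = Q" unfolding Q_def y stA stB by simp
      moreover have "set (k # ?C) = set (j # W)"
      proof -
        have "j \<in> insert z (set B2)" using l2 by (metis last_in_set list.distinct(1) list.simps(15))
        moreover have "z \<in> insert k (set A1)" using A(5) by (metis last_in_set list.distinct(1) list.simps(15))
        ultimately show ?thesis unfolding W W' A(2) B(2) y by auto
      qed
      ultimately show False using no_short[of ?C ?z k] A B by simp
    qed
    \<comment> \<open>The vertex sets are disjoint, so an edge of one part has no crossing in the
      other and keeps both of its crossings.\<close>
    have pA: "paired k u A"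
      unfolding paired_def
    proof (intro allI impI)
      fix c s t assume st: "(c, s, t) \<in> set (steps k u A)"
      have "(c, {s, t}) \<notin># step_keys j v B"
      proof
        assume "(c, {s, t}) \<in># step_keys j v B"
        then obtain s' t' where "(c, s', t') \<in> set (steps j v B)" "{s, t} = {s', t'}" by auto
        then have "s \<in> set (j # B)" using steps_vertices[of c s' t' j v B] by (auto simp: doubleton_eq_iff)
        then show False using disj steps_vertices(1)[OF st] by blast
      qed
      then have "count (step_keys k u A) (c, {s, t}) = count Q (c, {s, t})"
        unfolding Q_def y by (simp only: count_union not_in_iff add_0_left add_0_right)
      moreover have "(c, {s, t}) \<in># step_keys k u A" using st by force
      then have "(c, {s, t}) \<in># Q" unfolding Q_def by simp
      ultimately show "2 \<le> count (step_keys k u A) (c, {s, t})" using countQ by (metis order_refl)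
    qed
    have pB: "paired j v B"
      unfolding paired_def
    proof (intro allI impI)
      fix c s t assume st: "(c, s, t) \<in> set (steps j v B)"
      have "(c, {s, t}) \<notin># step_keys k u A"
      proof
        assume "(c, {s, t}) \<in># step_keys k u A"
        then obtain s' t' where "(c, s', t') \<in> set (steps k u A)" "{s, t} = {s', t'}" by auto
        then have "s \<in> set (k # A)" using steps_vertices[of c s' t' k u A] by (auto simp: doubleton_eq_iff)
        then show False using disj steps_vertices(1)[OF st] by blast
      qed
      then have "count (step_keys j v B) (c, {s, t}) = count Q (c, {s, t})"
        unfolding Q_def y by (simp only: count_union not_in_iff add_0_left add_0_right)
      moreover have "(c, {s, t}) \<in># step_keys j v B" using st by force
      then have "(c, {s, t}) \<in># Q" unfolding Q_def y by simp
      ultimately show "2 \<le> count (step_keys j v B) (c, {s, t})" using countQ by (metis order_refl)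
    qed
    have "card (set (j # W)) = card (set (k # A)) + card (set (j # B))"
      using card_Un_disjoint[OF _ _ disj] unfolding W W' y by (simp add: insert_commute Un_commute)
    moreover have "length w = length u + length v + 2" unfolding w w' by simp
    \<comment> \<open>The two vertex bounds add up to the equality for the whole walk, hence both
      are attained.\<close>
    ultimately have cards: "2 * card (set (k # A)) = length u + 2" "2 * card (set (j # B)) = length v + 2"
      using paired_card_le[OF pA lenA] paired_card_le[OF pB lenB] card_V by linarith+
    have "tree_walk k u A" "tree_walk j v B"
      using pA pB cards xlast x lastB y by (simp_all add: tree_walk_def)
    then have rA: "retracings k u A = 1" and rB: "retracings j v B = 1"
      using less.hyps[of u k A] less.hyps[of v j B] lenA lenB by (simp_all add: w w')
    have "retracings j w W = (\<Sum>q<length w'. if q = p then 1 else 0)"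
      unfolding w W retracings.simps
    proof (intro sum.cong refl)
      fix q assume "q \<in> {..<length w'}"
      then have q: "q < length w'" by simp
      show "(if w' ! q = i \<and> W' ! q = j
          then retracings k (take q w') (take q W') * retracings j (drop (Suc q) w') (drop (Suc q) W')
          else 0) = (if q = p then 1 else 0)"
      proof (cases "q = p")
        case True
        then show ?thesis using rA rB wp y by (simp add: defs)
      next
        case False
        \<comment> \<open>At any other \<open>q\<close> the closed excursion would make step
          \<open>q\<close> a crossing of the edge {j, k} by \<open>i\<close>, but only one such
          crossing is left after the first step.\<close>
        have False if *: "w' ! q = i" "W' ! q = j" "retracings k (take q w') (take q W') \<noteq> 0"
        proof -
          have "last (k # take q W') = k" using retracings_closed[OF *(3)] len by simp
          then have "(k # W') ! q = k"
            using q len by (cases q) (auto simp: take_Suc_conv_app_nth)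
          then have "map key (steps k w' W') ! q = e"
            using nth_steps[OF len q, of k] * q len by (simp add: e_def insert_commute)
          moreover have "map key (steps k w' W') ! p = e" using p len by simp
          ultimately show False
            using count_mset_le1_unique[OF count1, of p q] p q len False by simp
        qed
        then show ?thesis using False by auto
      qed
    qed
    then show ?thesis using p(1) by simp
  qed simp
qed

section \<open>Sums over closed walks\<close>

definition walks :: "nat \<Rightarrow> nat \<Rightarrow> nat list set" where
  "walks n m = {W. set W \<subseteq> {..<n} \<and> length W = m}"

lemma finite_walks [simp]: "finite (walks n m)"
  by (simp add: walks_def finite_lists_length_eq)

lemma walks_0 [simp]: "walks n 0 = {[]}"
  by (auto simp: walks_def)

lemma length_walks: "W \<in> walks n m \<Longrightarrow> length W = m"
  by (simp add: walks_def)

lemma sum_walks_Suc: "(\<Sum>W\<in>walks n (Suc m). f W) = (\<Sum>k<n. \<Sum>W\<in>walks n m. f (k # W))"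
proof -
  have "walks n (Suc m) = (\<lambda>(k, W). k # W) ` ({..<n} \<times> walks n m)"
    by (auto simp: walks_def length_Suc_conv image_iff)
  then have "(\<Sum>W\<in>walks n (Suc m). f W) = (\<Sum>x\<in>{..<n} \<times> walks n m. f ((\<lambda>(k, W). k # W) x))"
    by (simp add: sum.reindex inj_on_def)
  then show ?thesis by (simp add: sum.cartesian_product split_def)
qed

lemma sum_walks_append:
  "(\<Sum>W\<in>walks n (a + b). f W) = (\<Sum>A\<in>walks n a. \<Sum>B\<in>walks n b. f (A @ B))"
  by (induction a arbitrary: f) (simp_all add: sum_walks_Suc)

abbreviation step_prod :: "('i \<Rightarrow> nat \<Rightarrow> nat \<Rightarrow> 'a::comm_monoid_mult) \<Rightarrow> nat \<Rightarrow> 'i list \<Rightarrow> nat list \<Rightarrow> 'a"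
  where "step_prod s j w W \<equiv> prod_list (map (\<lambda>(i, a, b). s i a b) (steps j w W))"

section \<open>Operator-valued semicircular moments\<close>

text \<open>
  Moments of operator-valued semicircular elements with covariance maps \<open>\<eta>\<close>, by the position of the
  letter paired with the first one.
\<close>

function ov_moment :: "('i \<Rightarrow> ('x \<Rightarrow> real) \<Rightarrow> 'x \<Rightarrow> real) \<Rightarrow> 'i list \<Rightarrow> 'x \<Rightarrow> real" where
  "ov_moment \<eta> [] = (\<lambda>x. 1)"
| "ov_moment \<eta> (i # w) = (\<lambda>x. \<Sum>p<length w. if w ! p = i
      then \<eta> i (ov_moment \<eta> (take p w)) x * ov_moment \<eta> (drop (Suc p) w) x else 0)"
  by pat_completeness auto
termination by (relation "Wellfounded.measure (\<lambda>(\<eta>, w). length w)") auto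

text \<open>Cut the walk at the partner of its first step. The excursion is closed at
  \<open>k\<close>, the remainder starts at \<open>j\<close>, and nothing else links them, so the
  sum factors; the two crossings of the edge produce the kernel
  \<open>s i a b * s i b a\<close>.\<close>

lemma sum_retracings:
  fixes s :: "'i \<Rightarrow> nat \<Rightarrow> nat \<Rightarrow> real"
  assumes "j < n"
  shows "(\<Sum>W\<in>walks n (length w). real (retracings j w W) * step_prod s j w W) =
    ov_moment (\<lambda>i f a. \<Sum>b<n. s i a b * s i b a * f b) w j"
  using assms
proof (induction "length w" arbitrary: j w rule: less_induct)
  case less
  let ?T = "ov_moment (\<lambda>i f a. \<Sum>b<n. s i a b * s i b a * f b)"
  show ?case
  proof (cases w)
    case (Cons i w')
    define m where "m = length w'"
    have term_p: "(\<Sum>k<n. \<Sum>W\<in>walks n m. real (if w' ! p = i \<and> W ! p = j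
          then retracings k (take p w') (take p W) * retracings j (drop (Suc p) w') (drop (Suc p) W)
          else 0) * (s i j k * step_prod s k w' W)) =
        (if w' ! p = i then (\<Sum>k<n. s i j k * s i k j * ?T (take p w') k) * ?T (drop (Suc p) w') j else 0)"
      if p: "p < m" for p
    proof (cases "w' ! p = i")
      case True
      define u v where "u = take p w'" and "v = drop (Suc p) w'"
      have w': "w' = u @ i # v"
        using id_take_nth_drop[of p w'] p True by (simp add: u_def v_def m_def)
      have lu: "length u = p" and lv: "m = p + Suc (length v)" using p by (auto simp: u_def v_def m_def)
      have IHu: "(\<Sum>W\<in>walks n p. real (retracings k u W) * step_prod s k u W) = ?T u k" if "k < n" for k
        using less.hyps[of u k] that lu p by (simp add: Cons m_def)
      have IHv: "(\<Sum>W\<in>walks n (length v). real (retracings j v W) * step_prod s j v W) = ?T v j"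
        using less.hyps[of v j] less.prems lv by (simp add: Cons flip: m_def)
      have "(\<Sum>W\<in>walks n m. real (if w' ! p = i \<and> W ! p = j
          then retracings k (take p w') (take p W) * retracings j (drop (Suc p) w') (drop (Suc p) W)
          else 0) * (s i j k * step_prod s k w' W)) = s i j k * s i k j * ?T u k * ?T v j" (is "?L = _")
        if k: "k < n" for k
      proof -
        \<comment> \<open>The vertex \<open>y\<close> reached by the partner is summed freely and
          then forced to be \<open>j\<close>; that the excursion ends at \<open>k\<close> is
          enforced by its number of retracings.\<close>
        have "?L = (\<Sum>A\<in>walks n p. \<Sum>y<n. \<Sum>B\<in>walks n (length v). (if y = j then
            (real (retracings k u A) * step_prod s k u A) * (s i j k * s i k j) *
             (real (retracings j v B) * step_prod s j v B) else 0))"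
          unfolding lv sum_walks_append sum_walks_Suc
        proof (intro sum.cong refl)
          fix A y B assume A: "A \<in> walks n p" and B: "B \<in> walks n (length v)"
          have lA: "length A = length u" using length_walks[OF A] lu by simp
          have st: "steps k w' (A @ y # B) = steps k u A @ (i, last (k # A), y) # steps y v B"
            unfolding w' steps_append[OF lA] by simp
          have cl: "last (k # A) = k" if "retracings k u A \<noteq> 0"
            using retracings_closed[OF that lA] .
          show "real (if w' ! p = i \<and> (A @ y # B) ! p = j
              then retracings k (take p w') (take p (A @ y # B)) *
                retracings j (drop (Suc p) w') (drop (Suc p) (A @ y # B)) else 0) *
              (s i j k * step_prod s k w' (A @ y # B)) =
            (if y = j then (real (retracings k u A) * step_prod s k u A) * (s i j k * s i k j) *
               (real (retracings j v B) * step_prod s j v B) else 0)"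
          proof (cases "y = j \<and> retracings k u A \<noteq> 0")
            case yes: True
            then show ?thesis
              using lA lu True cl unfolding st u_def[symmetric] v_def[symmetric]
              by (simp add: nth_append mult_ac split del: if_split)
          next
            case False
            then show ?thesis
              using lA lu True unfolding u_def[symmetric] v_def[symmetric] by (auto simp: nth_append)
          qed
        qed
        also have "\<dots> = (\<Sum>A\<in>walks n p. \<Sum>B\<in>walks n (length v).
            (real (retracings k u A) * step_prod s k u A) * (s i j k * s i k j) *
             (real (retracings j v B) * step_prod s j v B))"
        proof (intro sum.cong refl)
          fix A
          show "(\<Sum>y<n. \<Sum>B\<in>walks n (length v). (if y = j then
            (real (retracings k u A) * step_prod s k u A) * (s i j k * s i k j) *
             (real (retracings j v B) * step_prod s j v B) else 0)) =
             (\<Sum>B\<in>walks n (length v).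
            (real (retracings k u A) * step_prod s k u A) * (s i j k * s i k j) *
             (real (retracings j v B) * step_prod s j v B))"
            using less.prems by (subst sum.swap) (simp add: sum.delta)
        qed
        also have "\<dots> = (\<Sum>A\<in>walks n p. real (retracings k u A) * step_prod s k u A) * (s i j k * s i k j) *
             (\<Sum>B\<in>walks n (length v). real (retracings j v B) * step_prod s j v B)"
          unfolding sum_distrib_right unfolding sum_distrib_left ..
        finally show ?thesis using IHu[OF k] IHv by simp
      qed
      then show ?thesis using True by (simp add: sum_distrib_right flip: u_def v_def)
    qed simp
    have "(\<Sum>W\<in>walks n (length w). real (retracings j w W) * step_prod s j w W) =
      (\<Sum>k<n. \<Sum>W\<in>walks n m. \<Sum>p<m. real (if w' ! p = i \<and> W ! p = j
          then retracings k (take p w') (take p W) * retracings j (drop (Suc p) w') (drop (Suc p) W)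
          else 0) * (s i j k * step_prod s k w' W))"
      by (simp add: Cons sum_walks_Suc m_def sum_distrib_right del: of_nat_mult)
    also have "\<dots> = (\<Sum>p<m. \<Sum>k<n. \<Sum>W\<in>walks n m. real (if w' ! p = i \<and> W ! p = j
          then retracings k (take p w') (take p W) * retracings j (drop (Suc p) w') (drop (Suc p) W)
          else 0) * (s i j k * step_prod s k w' W))"
      by (subst (2) sum.swap, subst sum.swap) rule
    also have "\<dots> = ?T w j"
      using term_p by (simp add: Cons m_def)
    finally show ?thesis .
  qed simp
qed

section \<open>Weights of paired walks with too few vertices\<close>

text \<open>
  Discovering a vertex costs \<open>\<sigma>\<^sup>2\<close>, which pays for the choice of the vertex in the band; returning to
  a known vertex is free.
\<close>

fun visit_weight ::
  "('i \<Rightarrow> real) \<Rightarrow> ('i \<Rightarrow> nat \<Rightarrow> nat \<Rightarrow> bool) \<Rightarrow> nat set \<Rightarrow> nat \<Rightarrow> 'i list \<Rightarrow> nat list \<Rightarrow> real"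
  where
  "visit_weight \<sigma> N S j (i # w) (k # W) =
    (if k \<in> S then 1 else (\<sigma> i)\<^sup>2 * of_bool (N i j k)) * visit_weight \<sigma> N (insert k S) k w W"
| "visit_weight \<sigma> N S j w W = 1"

lemma visit_weight_nonneg: "0 \<le> visit_weight \<sigma> N S j w W"
  by (induction \<sigma> N S j w W rule: visit_weight.induct) auto

text \<open>In each step the walk returns to one of at most \<open>card S\<close> vertices or
  discovers one, at total cost at most \<open>D\<close>. Each step enlarges \<open>S\<close> by at
  most one and shortens the word by one, so the base D + card S + length never grows.\<close>

lemma sum_visit_weight_le:
  assumes "finite S" "j < n" "0 \<le> D"
    and "\<And>i j. i \<in> set w \<Longrightarrow> j < n \<Longrightarrow> (\<sigma> i)\<^sup>2 * real (card {k. k < n \<and> N i j k}) \<le> D"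
  shows "(\<Sum>W\<in>walks n (length w). visit_weight \<sigma> N S j w W) \<le> (D + card S + length w) ^ length w"
  using assms
proof (induction w arbitrary: S j)
  case (Cons i w)
  define B where "B = (D + real (card S) + real (length (i # w)))"
  have B: "0 \<le> B" using Cons.prems by (simp add: B_def)
  have step: "(\<Sum>W\<in>walks n (length w). visit_weight \<sigma> N (insert k S) k w W) \<le> B ^ length w" if "k < n" for k
  proof -
    have "(\<Sum>W\<in>walks n (length w). visit_weight \<sigma> N (insert k S) k w W)
        \<le> (D + card (insert k S) + length w) ^ length w"
      using Cons.prems that by (intro Cons.IH) auto
    also have "\<dots> \<le> B ^ length w"
      using Cons.prems card_insert_le_m1 by (intro power_mono) (auto simp: B_def card_insert_if)
    finally show ?thesis .
  qed
  let ?c = "\<lambda>k. if k \<in> S then 1 else (\<sigma> i)\<^sup>2 * of_bool (N i j k)"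
  have "(\<Sum>W\<in>walks n (length (i # w)). visit_weight \<sigma> N S j (i # w) W) =
      (\<Sum>k<n. ?c k * (\<Sum>W\<in>walks n (length w). visit_weight \<sigma> N (insert k S) k w W))"
    by (simp add: sum_walks_Suc sum_distrib_left)
  also have "\<dots> \<le> (\<Sum>k<n. ?c k * B ^ length w)"
    by (intro sum_mono mult_left_mono step) auto
  also have "\<dots> = (\<Sum>k<n. ?c k) * B ^ length w" by (simp add: sum_distrib_right)
  also have "\<dots> \<le> B * B ^ length w"
  proof (intro mult_right_mono)
    have "(\<Sum>k<n. ?c k) \<le> (\<Sum>k<n. of_bool (k \<in> S) + (\<sigma> i)\<^sup>2 * of_bool (N i j k))"
      by (intro sum_mono) auto
    also have "\<dots> = real (card ({..<n} \<inter> S)) + (\<sigma> i)\<^sup>2 * real (card {k. k < n \<and> N i j k})"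
    proof -
      have "{..<n} \<inter> {x. N i j x} = {k. k < n \<and> N i j k}" "{..<n} \<inter> {x. x \<in> S} = {..<n} \<inter> S" by auto
      then show ?thesis by (simp add: sum.distrib of_bool_def sum.If_cases flip: sum_distrib_left)
    qed
    also have "\<dots> \<le> real (card S) + D"
      using Cons.prems by (intro add_mono) (auto intro: card_mono)
    finally show "(\<Sum>k<n. ?c k) \<le> B" by (simp add: B_def)
  qed (use B in simp)
  finally show ?case by (simp add: B_def)
qed simp

lemma visit_weight_new_steps:
  assumes "length W = length w" "\<And>i a b. (i, a, b) \<in> set (steps j w W) \<Longrightarrow> N i a b"
  shows "visit_weight \<sigma> N S j w W = (\<Prod>i\<in>#mset (map fst (new_steps S j w W)). (\<sigma> i)\<^sup>2)"
  using assms
proof (induction \<sigma> N S j w W rule: visit_weight.induct)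
  case (1 \<sigma> N S j i w k W)
  then show ?case by (auto simp: insert_absorb)
qed auto

lemma prod_mset_le:
  fixes f :: "'a \<Rightarrow> real"
  assumes "R \<noteq> {#}" "\<And>i. i \<in># R \<Longrightarrow> 0 \<le> f i \<and> f i \<le> \<epsilon>" "\<epsilon> \<le> 1"
  shows "(\<Prod>i\<in>#R. f i) \<le> \<epsilon>"
proof -
  obtain x R' where R: "R = add_mset x R'" using assms(1) by (cases R) auto
  have "0 \<le> (\<Prod>i\<in>#R'. f i) \<and> (\<Prod>i\<in>#R'. f i) \<le> 1"
    using assms(2) unfolding R
  proof (induction R')
    case (add y R')
    then have "0 \<le> f y \<and> f y \<le> \<epsilon>" by simp
    then have "0 \<le> f y" "f y \<le> 1" using assms(3) by auto
    moreover have "0 \<le> (\<Prod>i\<in>#R'. f i) \<and> (\<Prod>i\<in>#R'. f i) \<le> 1" using add by auto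
    ultimately show ?case by (auto intro: mult_le_one)
  qed simp
  moreover have "0 \<le> f x" "f x \<le> \<epsilon>" using assms(2) R by auto
  ultimately have "f x * (\<Prod>i\<in>#R'. f i) \<le> f x" "f x \<le> \<epsilon>" by (auto simp: mult_left_le)
  then show ?thesis unfolding R by simp
qed

text \<open>Remove the letters of the discoveries twice from the word; they make up the weight. What
  is left is nonempty because the walk has fewer vertices than possible, and contributes a factor of
  at most \<open>\<epsilon>\<close>. If a step leaves the band, the product vanishes.\<close>

lemma step_prod_le_visit_weight:
  assumes "paired j w W" "length W = length w" "2 * card (set (j # W)) \<noteq> length w + 2"
    and \<sigma>: "\<And>i. i \<in> set w \<Longrightarrow> 0 \<le> \<sigma> i \<and> \<sigma> i \<le> \<epsilon>" "\<epsilon> \<le> 1"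
  shows "step_prod (\<lambda>i a b. \<sigma> i * of_bool (N i a b)) j w W \<le> \<epsilon> * visit_weight \<sigma> N {j} j w W"
proof (cases "\<forall>(i, a, b)\<in>set (steps j w W). N i a b")
  case True
  let ?M = "mset (map fst (new_steps {j} j w W))"
  obtain R where R: "mset w = ?M + ?M + R"
    using paired_colours[OF assms(1,2)] by (metis mset_subset_eq_exists_conv)
  have "R \<noteq> {#}"
  proof
    assume "R = {#}"
    then have "length w = 2 * card (set W - {j})"
      using arg_cong[OF R, of size] length_new_steps[OF assms(2), of "{j}" j] by simp
    then show False using assms(3) unfolding card_walk by simp
  qed
  moreover have "i \<in> set w" if "i \<in># R" for i
    using that R by (metis set_mset_mset union_iff)
  ultimately have le: "(\<Prod>i\<in>#R. \<sigma> i) \<le> \<epsilon>"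
    using \<sigma> by (intro prod_mset_le) auto
  have "map (\<lambda>(i, a, b). \<sigma> i * of_bool (N i a b)) (steps j w W) = map (\<lambda>x. \<sigma> (fst x)) (steps j w W)"
    using True by (intro map_cong refl) auto
  also have "\<dots> = map \<sigma> (map fst (steps j w W))" by simp
  also have "\<dots> = map \<sigma> w" unfolding map_fst_steps[OF assms(2)] ..
  finally have "step_prod (\<lambda>i a b. \<sigma> i * of_bool (N i a b)) j w W = (\<Prod>i\<in>#mset w. \<sigma> i)"
    by (simp add: prod_mset_prod_list flip: mset_map)
  also have "\<dots> = (\<Prod>i\<in>#?M. (\<sigma> i)\<^sup>2) * (\<Prod>i\<in>#R. \<sigma> i)"
    unfolding R by (simp add: prod_mset.distrib power2_eq_square del: mset_map)
  also have "(\<Prod>i\<in>#?M. (\<sigma> i)\<^sup>2) = visit_weight \<sigma> N {j} j w W"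
    using True by (intro visit_weight_new_steps[symmetric] assms) auto
  also have "visit_weight \<sigma> N {j} j w W * (\<Prod>i\<in>#R. \<sigma> i) \<le> visit_weight \<sigma> N {j} j w W * \<epsilon>"
    by (intro mult_left_mono le visit_weight_nonneg)
  finally show ?thesis by (simp add: mult.commute)
next
  case False
  then have "step_prod (\<lambda>i a b. \<sigma> i * of_bool (N i a b)) j w W = 0"
    by (force simp: prod_list_zero_iff)
  moreover have "0 \<le> \<epsilon>"
  proof -
    have "w \<noteq> []" using False by auto
    then show ?thesis using \<sigma>(1)[of "hd w"] by fastforce
  qed
  ultimately show ?thesis using visit_weight_nonneg by (metis mult_nonneg_nonneg)
qed

lemma step_prod_nonneg:
  fixes s :: "'i \<Rightarrow> nat \<Rightarrow> nat \<Rightarrow> real"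
  assumes "\<And>i a b. i \<in> set w \<Longrightarrow> 0 \<le> s i a b"
  shows "0 \<le> step_prod s j w W"
  using steps_vertices(3) assms by (intro prod_list_nonneg) (force simp: split_def)

text \<open>
  Paired walks that are not tree walks are negligible because each of them has a step that is
  neither the discovery of a new vertex nor matched with one, and such a step costs a factor
  \<open>\<epsilon>\<close>.
\<close>

lemma sum_closed_walks_approx:
  fixes F :: "nat list \<Rightarrow> complex"
  assumes "j < n" "0 \<le> D" "0 \<le> C"
    and \<sigma>: "\<And>i. i \<in> set w \<Longrightarrow> 0 \<le> \<sigma> i \<and> \<sigma> i \<le> \<epsilon>" "0 \<le> \<epsilon>" "\<epsilon> \<le> 1"
    and deg: "\<And>i j. i \<in> set w \<Longrightarrow> j < n \<Longrightarrow> (\<sigma> i)\<^sup>2 * real (card {k. k < n \<and> N i j k}) \<le> D"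
    and F: "\<And>W. W \<in> walks n (length w) \<Longrightarrow> cmod (F W) \<le> C"
      "\<And>W. W \<in> walks n (length w) \<Longrightarrow> last (j # W) = j \<Longrightarrow> \<not> paired j w W \<Longrightarrow> F W = 0"
      "\<And>W. W \<in> walks n (length w) \<Longrightarrow> tree_walk j w W \<Longrightarrow> F W = 1"
  shows "cmod ((\<Sum>W\<in>walks n (length w). of_bool (last (j # W) = j) *
        (of_real (step_prod (\<lambda>i a b. \<sigma> i * of_bool (N i a b)) j w W) * F W)) -
      of_real (ov_moment (\<lambda>i f a. \<Sum>b<n. (\<sigma> i)\<^sup>2 * of_bool (N i a b \<and> N i b a) * f b) w j))
    \<le> (C + fact (length w)) * (D + 1 + length w) ^ length w * \<epsilon>"
proof -
  let ?P = "step_prod (\<lambda>i a b. \<sigma> i * of_bool (N i a b)) j w"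
  let ?V = "visit_weight \<sigma> N {j} j w"
  \<comment> \<open>The two crossings of an edge are made in opposite directions and each carries
    its own indicator, hence the conjunction of both orientations.\<close>
  have eq: "ov_moment (\<lambda>i f a. \<Sum>b<n. (\<sigma> i)\<^sup>2 * of_bool (N i a b \<and> N i b a) * f b) w j =
      (\<Sum>W\<in>walks n (length w). real (retracings j w W) * ?P W)"
    unfolding sum_retracings[OF assms(1)]
    by (simp add: power2_eq_square of_bool_conj mult_ac)
  have bound: "cmod (of_bool (last (j # W) = j) * (of_real (?P W) * F W) -
        of_real (real (retracings j w W) * ?P W)) \<le> (C + fact (length w)) * \<epsilon> * ?V W"
    if W: "W \<in> walks n (length w)" for W
  proof -
    have len: "length W = length w" by (rule length_walks[OF W])
    have pos: "0 \<le> (C + fact (length w)) * \<epsilon> * ?V W" 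
      using assms(3) \<sigma>(2) by (intro mult_nonneg_nonneg visit_weight_nonneg add_nonneg_nonneg) auto
    have P0: "0 \<le> ?P W" using \<sigma> by (intro step_prod_nonneg) auto
    \<comment> \<open>In the first three cases the two summands agree; only paired walks with too
      few vertices contribute to the error.\<close>
    consider "\<not> paired j w W" | "last (j # W) \<noteq> j" | "tree_walk j w W"
      | "paired j w W" "2 * card (set (j # W)) \<noteq> length w + 2"
      by (auto simp: tree_walk_def)
    then show ?thesis
    proof cases
      case 1
      then have "retracings j w W = 0" using retracings_paired[OF _ len] by blast
      then show ?thesis using F(2)[OF W] 1 pos by auto
    next
      case 2
      then have "retracings j w W = 0" using retracings_closed[OF _ len] by blast
      then show ?thesis using 2 pos by auto
    next
      case 3
      then show ?thesis
        using F(3)[OF W 3] tree_walk_retracings[OF 3 len] pos by (auto simp: tree_walk_def)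
    next
      case 4
      have "cmod (of_bool (last (j # W) = j) * (of_real (?P W) * F W) -
          of_real (real (retracings j w W) * ?P W)) =
        cmod (of_bool (last (j # W) = j) * F W - of_nat (retracings j w W)) * ?P W"
      proof -
        have "of_bool (last (j # W) = j) * (of_real (?P W) * F W) -
          of_real (real (retracings j w W) * ?P W) =
          (of_bool (last (j # W) = j) * F W - of_nat (retracings j w W)) * of_real (?P W)"
          by (simp add: algebra_simps)
        then show ?thesis using P0 by (simp add: norm_mult)
      qed
      also have "\<dots> \<le> (C + fact (length w)) * (\<epsilon> * ?V W)"
      proof (intro mult_mono)
        have "cmod (of_bool (last (j # W) = j) * F W) \<le> C"
          using F(1)[OF W] assms(3) by (cases "last (j # W) = j") (simp_all del: last.simps)
        moreover have "cmod (of_nat (retracings j w W)) \<le> fact (length w)"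
          using of_nat_mono[OF retracings_le_fact[OF len, of j], where 'a = real]
          by (simp only: of_nat_fact norm_of_nat)
        ultimately show "cmod (of_bool (last (j # W) = j) * F W - of_nat (retracings j w W)) \<le> C + fact (length w)"
          by (intro order_trans[OF norm_triangle_ineq4] add_mono)
        show "?P W \<le> \<epsilon> * ?V W"
          by (rule step_prod_le_visit_weight[OF 4(1) len 4(2)]) (use \<sigma> in auto)
      qed (use P0 assms in auto)
      finally show ?thesis by (simp add: mult_ac)
    qed
  qed
  have "cmod ((\<Sum>W\<in>walks n (length w). of_bool (last (j # W) = j) * (of_real (?P W) * F W)) -
      of_real (\<Sum>W\<in>walks n (length w). real (retracings j w W) * ?P W)) =
    cmod (\<Sum>W\<in>walks n (length w). of_bool (last (j # W) = j) * (of_real (?P W) * F W) -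
      of_real (real (retracings j w W) * ?P W))"
    by (simp add: sum_subtractf)
  also have "\<dots> \<le> (\<Sum>W\<in>walks n (length w). (C + fact (length w)) * \<epsilon> * ?V W)"
    by (intro sum_norm_le bound)
  also have "\<dots> = (C + fact (length w)) * \<epsilon> * (\<Sum>W\<in>walks n (length w). ?V W)"
    by (simp add: sum_distrib_left)
  also have "\<dots> \<le> (C + fact (length w)) * \<epsilon> * (D + card {j} + length w) ^ length w"
    using assms by (intro mult_left_mono sum_visit_weight_le) auto
  finally show ?thesis unfolding eq by (simp add: mult_ac)
qed

section \<open>Matrix products as sums over walks\<close>

lemma foldr_mat_entry:
  assumes "\<And>i. i \<in> set w \<Longrightarrow> A i \<in> carrier_mat n n"
  shows "foldr (\<lambda>i B. A i * B) w (1\<^sub>m n) \<in> carrier_mat n n"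
    and "a < n \<Longrightarrow> b < n \<Longrightarrow> foldr (\<lambda>i B. A i * B) w (1\<^sub>m n) $$ (a, b) =
      (\<Sum>W\<in>walks n (length w). of_bool (last (a # W) = b) * step_prod (\<lambda>i a b. A i $$ (a, b)) a w W)"
proof -
  have "foldr (\<lambda>i B. A i * B) w (1\<^sub>m n) \<in> carrier_mat n n \<and> (\<forall>a<n. \<forall>b<n.
      foldr (\<lambda>i B. A i * B) w (1\<^sub>m n) $$ (a, b) =
      (\<Sum>W\<in>walks n (length w). of_bool (last (a # W) = b) * step_prod (\<lambda>i a b. A i $$ (a, b)) a w W))"
    using assms
  proof (induction w)
    case (Cons i w)
    let ?B = "foldr (\<lambda>i B. A i * B) w (1\<^sub>m n)"
    have B: "?B \<in> carrier_mat n n" and A: "A i \<in> carrier_mat n n" using Cons by auto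
    have IH: "?B $$ (k, b) = (\<Sum>W\<in>walks n (length w). of_bool (last (k # W) = b) *
        step_prod (\<lambda>i a b. A i $$ (a, b)) k w W)" if "k < n" "b < n" for k b
      using Cons that by simp
    have "(A i * ?B) $$ (a, b) = (\<Sum>W\<in>walks n (length (i # w)). of_bool (last (a # W) = b) *
        step_prod (\<lambda>i a b. A i $$ (a, b)) a (i # w) W)" if "a < n" "b < n" for a b
    proof -
      have "(A i * ?B) $$ (a, b) = (\<Sum>k<n. A i $$ (a, k) * ?B $$ (k, b))"
        using A B that by (simp add: scalar_prod_def atLeast0LessThan)
      also have "\<dots> = (\<Sum>W\<in>walks n (length (i # w)). of_bool (last (a # W) = b) *
          step_prod (\<lambda>i a b. A i $$ (a, b)) a (i # w) W)"
        using IH that by (simp add: sum_walks_Suc sum_distrib_left mult_ac)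
      finally show ?thesis .
    qed
    moreover have "A i * ?B \<in> carrier_mat n n" using A B by simp
    ultimately show ?case by simp
  qed (auto simp: one_mat_def)
  then show "foldr (\<lambda>i B. A i * B) w (1\<^sub>m n) \<in> carrier_mat n n"
    and "a < n \<Longrightarrow> b < n \<Longrightarrow> foldr (\<lambda>i B. A i * B) w (1\<^sub>m n) $$ (a, b) =
      (\<Sum>W\<in>walks n (length w). of_bool (last (a # W) = b) * step_prod (\<lambda>i a b. A i $$ (a, b)) a w W)"
    by auto
qed

section \<open>Expectations along walks\<close>

text \<open>The largest factor dominates. This replaces Hoelder's inequality: a mixed moment along a
  walk is controlled by absolute moments of single entries, all of one order.\<close>

lemma prod_list_le_sum_power:
  fixes xs :: "real list"
  assumes "xs \<noteq> []" "\<And>x. x \<in> set xs \<Longrightarrow> 0 \<le> x"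
  shows "prod_list xs \<le> (\<Sum>x\<leftarrow>xs. x ^ length xs)"
proof -
  define y where "y = Max (set xs)"
  have y: "y \<in> set xs" unfolding y_def using assms(1) by (intro Max_in) auto
  have le: "x \<le> y" if "x \<in> set xs" for x unfolding y_def using that by simp
  have "prod_list xs \<le> y ^ length xs \<and> 0 \<le> prod_list xs"
    using le assms(2)
  proof (induction xs)
    case (Cons a xs)
    moreover have "0 \<le> a" "a \<le> y" "0 \<le> y" using Cons.prems by force+
    ultimately show ?case by (auto intro!: mult_mono)
  qed simp
  moreover have "y ^ length xs \<le> (\<Sum>x\<leftarrow>xs. x ^ length xs)"
    using y assms(2) by (intro member_le_sum_list) auto
  ultimately show ?thesis by linarith
qed

lemma prod_list_filter_nth:
  "prod_list (map f (filter P xs)) = (\<Prod>l\<in>{l. l < length xs \<and> P (xs ! l)}. f (xs ! l) :: 'b :: comm_monoid_mult)"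
proof (induction xs rule: rev_induct)
  case (snoc x xs)
  have "{l. l < length (xs @ [x]) \<and> P ((xs @ [x]) ! l)} =
    {l. l < length xs \<and> P (xs ! l)} \<union> (if P x then {length xs} else {})"
    by (auto simp: nth_append less_Suc_eq)
  then show ?case using snoc by (auto simp: nth_append prod.union_disjoint mult.commute)
qed simp

text \<open>Independence is assumed for the entries on and above the diagonal, so every step is
  represented by the position there that carries the same random variable up to conjugation.\<close>

fun canonical :: "'i \<times> nat \<times> nat \<Rightarrow> 'i \<times> nat \<times> nat" where
  "canonical (i, a, b) = (i, min a b, max a b)"

lemma canonical_eq_iff: "canonical s = canonical t \<longleftrightarrow> key s = key t"
  by (cases s; cases t) (auto simp: doubleton_eq_iff min_def max_def split: if_splits)

locale wigner_entries = prob_space M for M :: "'w measure" +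
  fixes I :: "'i set" and n :: nat and X :: "'i \<Rightarrow> 'w \<Rightarrow> complex mat"
  assumes hermitian: "i \<in> I \<Longrightarrow> \<omega> \<in> space M \<Longrightarrow> a < n \<Longrightarrow> b < n \<Longrightarrow> X i \<omega> $$ (b, a) = cnj (X i \<omega> $$ (a, b))"
    and indep: "indep_vars (\<lambda>_. borel) (\<lambda>(i, j, k) \<omega>. X i \<omega> $$ (j, k)) {(i, j, k). i \<in> I \<and> j \<le> k \<and> k < n}"
    and mean: "i \<in> I \<Longrightarrow> j < k \<Longrightarrow> k < n \<Longrightarrow> (\<integral>\<omega>. X i \<omega> $$ (j, k) \<partial>M) = 0"
    and variance: "i \<in> I \<Longrightarrow> j < k \<Longrightarrow> k < n \<Longrightarrow> (\<integral>\<omega>. (cmod (X i \<omega> $$ (j, k)))\<^sup>2 \<partial>M) = 1"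
    and moments: "i \<in> I \<Longrightarrow> j \<le> k \<Longrightarrow> k < n \<Longrightarrow> integrable M (\<lambda>\<omega>. cmod (X i \<omega> $$ (j, k)) ^ l)"
begin

definition entry :: "'i \<times> nat \<times> nat \<Rightarrow> 'w \<Rightarrow> complex" where
  "entry = (\<lambda>(i, a, b) \<omega>. X i \<omega> $$ (a, b))"

definition index_set :: "('i \<times> nat \<times> nat) set" where
  "index_set = I \<times> {..<n} \<times> {..<n}"

lemma entry_canonical:
  assumes "s \<in> index_set" "\<omega> \<in> space M"
  shows "entry s \<omega> = (if s = canonical s then entry (canonical s) \<omega> else cnj (entry (canonical s) \<omega>))"
proof -
  obtain i a b where s: "s = (i, a, b)" by (cases s)
  show ?thesis
    using assms hermitian[of i \<omega> b a] by (auto simp: s entry_def index_set_def min_def max_def)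
qed

lemma canonical_in: "s \<in> index_set \<Longrightarrow> canonical s \<in> {(i, j, k). i \<in> I \<and> j \<le> k \<and> k < n}"
  by (cases s) (auto simp: index_set_def)

lemma entry_measurable: "s \<in> index_set \<Longrightarrow> entry s \<in> borel_measurable M"
proof -
  assume s: "s \<in> index_set"
  have "\<forall>c\<in>{(i, j, k). i \<in> I \<and> j \<le> k \<and> k < n}. entry c \<in> borel_measurable M"
    using indep unfolding indep_vars_def entry_def by (rule conjunct1)
  then have "entry (canonical s) \<in> borel_measurable M"
    using canonical_in[OF s] by (rule bspec)
  then have "(\<lambda>\<omega>. if s = canonical s then entry (canonical s) \<omega> else cnj (entry (canonical s) \<omega>)) \<in> borel_measurable M"
    using borel_measurable_continuous_on[of cnj, OF continuous_on_cnj[OF continuous_on_id]]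
    by (cases "s = canonical s") auto
  then show ?thesis using entry_canonical[OF s] by (simp cong: measurable_cong)
qed

lemma cmod_entry: "s \<in> index_set \<Longrightarrow> \<omega> \<in> space M \<Longrightarrow> cmod (entry s \<omega>) = cmod (entry (canonical s) \<omega>)"
  by (metis complex_mod_cnj entry_canonical)

lemma entry_power_integrable: "s \<in> index_set \<Longrightarrow> integrable M (\<lambda>\<omega>. cmod (entry s \<omega>) ^ l)"
  and entry_power_integral: "s \<in> index_set \<Longrightarrow>
    (\<integral>\<omega>. cmod (entry s \<omega>) ^ l \<partial>M) = (\<integral>\<omega>. cmod (entry (canonical s) \<omega>) ^ l \<partial>M)"
proof -
  assume s: "s \<in> index_set"
  have "integrable M (\<lambda>\<omega>. cmod (entry (canonical s) \<omega>) ^ l)"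
    using canonical_in[OF s] moments by (auto simp: entry_def)
  then show "integrable M (\<lambda>\<omega>. cmod (entry s \<omega>) ^ l)"
    using cmod_entry[OF s] by (simp cong: Bochner_Integration.integrable_cong)
  show "(\<integral>\<omega>. cmod (entry s \<omega>) ^ l \<partial>M) = (\<integral>\<omega>. cmod (entry (canonical s) \<omega>) ^ l \<partial>M)"
    using cmod_entry[OF s] by (simp cong: Bochner_Integration.integral_cong)
qed

lemma entry_mean:
  assumes "(i, a, b) \<in> index_set" "a \<noteq> b"
  shows "(\<integral>\<omega>. entry (i, a, b) \<omega> \<partial>M) = 0"
proof -
  have c: "(\<integral>\<omega>. entry (canonical (i, a, b)) \<omega> \<partial>M) = 0"
    using assms mean[of i "min a b" "max a b"] by (auto simp: entry_def index_set_def)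
  have "(\<integral>\<omega>. entry (i, a, b) \<omega> \<partial>M) = (\<integral>\<omega>. (if (i, a, b) = canonical (i, a, b)
      then entry (canonical (i, a, b)) \<omega> else cnj (entry (canonical (i, a, b)) \<omega>)) \<partial>M)"
    using entry_canonical[OF assms(1)] by (intro Bochner_Integration.integral_cong) auto
  also have "\<dots> = 0"
    using c by (cases "(i, a, b) = canonical (i, a, b)") (simp_all del: canonical.simps)
  finally show ?thesis .
qed

lemma entry_variance:
  assumes "(i, a, b) \<in> index_set" "a \<noteq> b"
  shows "(\<integral>\<omega>. entry (i, a, b) \<omega> * entry (i, b, a) \<omega> \<partial>M) = 1"
proof -
  have "(\<integral>\<omega>. entry (i, a, b) \<omega> * entry (i, b, a) \<omega> \<partial>M) =
      (\<integral>\<omega>. complex_of_real ((cmod (entry (i, a, b) \<omega>))\<^sup>2) \<partial>M)"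
    using assms hermitian[of i _ a b] unfolding complex_norm_square
    by (intro Bochner_Integration.integral_cong) (auto simp: entry_def index_set_def)
  also have "\<dots> = of_real (\<integral>\<omega>. (cmod (entry (canonical (i, a, b)) \<omega>))\<^sup>2 \<partial>M)"
    using entry_power_integral[OF assms(1), of 2] by (simp del: canonical.simps of_real_power)
  also have "\<dots> = 1"
    using variance[of i "min a b" "max a b"] assms by (auto simp: entry_def index_set_def)
  finally show ?thesis .
qed

lemma entries_prod_integrable:
  fixes C :: real
  assumes "set ss \<subseteq> index_set"
  shows "integrable M (\<lambda>\<omega>. prod_list (map (\<lambda>s. entry s \<omega>) ss))"
    and "(\<And>s. s \<in> set ss \<Longrightarrow> (\<integral>\<omega>. cmod (entry s \<omega>) ^ length ss \<partial>M) \<le> C) \<Longrightarrow> 0 \<le> C \<Longrightarrow>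
      cmod (\<integral>\<omega>. prod_list (map (\<lambda>s. entry s \<omega>) ss) \<partial>M) \<le> 1 + length ss * C"
proof -
  have int: "integrable M (\<lambda>\<omega>. \<Sum>s\<leftarrow>ss'. cmod (entry s \<omega>) ^ l)" if "set ss' \<subseteq> index_set" for ss' l
    using that by (induction ss') (auto intro: entry_power_integrable)
  have meas: "(\<lambda>\<omega>. prod_list (map (\<lambda>s. entry s \<omega>) ss)) \<in> borel_measurable M"
    using assms
  proof (induction ss)
    case (Cons s ss)
    then have [measurable]: "entry s \<in> borel_measurable M"
      "(\<lambda>\<omega>. prod_list (map (\<lambda>s. entry s \<omega>) ss)) \<in> borel_measurable M"
      by (auto intro: entry_measurable)
    show ?case by simp
  qed simp
  have norm_prod: "cmod (prod_list (map (\<lambda>s. entry s \<omega>) ss)) = prod_list (map (\<lambda>s. cmod (entry s \<omega>)) ss)" for \<omega>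
    by (induction ss) (auto simp: norm_mult)
  \<comment> \<open>The summand 1 accounts for the empty product.\<close>
  have le: "cmod (prod_list (map (\<lambda>s. entry s \<omega>) ss)) \<le> 1 + (\<Sum>s\<leftarrow>ss. cmod (entry s \<omega>) ^ length ss)" for \<omega>
  proof (cases "ss = []")
    case False
    then have "prod_list (map (\<lambda>s. cmod (entry s \<omega>)) ss) \<le>
        (\<Sum>x\<leftarrow>map (\<lambda>s. cmod (entry s \<omega>)) ss. x ^ length (map (\<lambda>s. cmod (entry s \<omega>)) ss))"
      by (intro prod_list_le_sum_power) auto
    then show ?thesis unfolding norm_prod by (simp add: comp_def)
  qed simp
  have int1: "integrable M (\<lambda>\<omega>. 1 + (\<Sum>s\<leftarrow>ss. cmod (entry s \<omega>) ^ length ss))"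
    using int[OF assms] by simp
  show I: "integrable M (\<lambda>\<omega>. prod_list (map (\<lambda>s. entry s \<omega>) ss))"
    by (rule Bochner_Integration.integrable_bound[OF int1 meas]) (use le in \<open>auto intro: order_trans[OF _ abs_ge_self]\<close>)
  assume C: "\<And>s. s \<in> set ss \<Longrightarrow> (\<integral>\<omega>. cmod (entry s \<omega>) ^ length ss \<partial>M) \<le> C" and C0: "0 \<le> C"
  have sum: "(\<integral>\<omega>. (\<Sum>s\<leftarrow>ss'. cmod (entry s \<omega>) ^ length ss) \<partial>M) \<le> length ss' * C"
    if "set ss' \<subseteq> set ss" for ss'
    using that
  proof (induction ss')
    case (Cons s ss')
    have "(\<integral>\<omega>. cmod (entry s \<omega>) ^ length ss + (\<Sum>s\<leftarrow>ss'. cmod (entry s \<omega>) ^ length ss) \<partial>M) =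
      (\<integral>\<omega>. cmod (entry s \<omega>) ^ length ss \<partial>M) + (\<integral>\<omega>. (\<Sum>s\<leftarrow>ss'. cmod (entry s \<omega>) ^ length ss) \<partial>M)"
      using Cons.prems assms by (intro Bochner_Integration.integral_add entry_power_integrable int) auto
    then show ?case using Cons C[of s] by (simp add: algebra_simps)
  qed simp
  have "cmod (\<integral>\<omega>. prod_list (map (\<lambda>s. entry s \<omega>) ss) \<partial>M) \<le> (\<integral>\<omega>. cmod (prod_list (map (\<lambda>s. entry s \<omega>) ss)) \<partial>M)"
    by (rule integral_norm_bound)
  also have "\<dots> \<le> (\<integral>\<omega>. 1 + (\<Sum>s\<leftarrow>ss. cmod (entry s \<omega>) ^ length ss) \<partial>M)"
    using I int1 le by (intro integral_mono) auto
  also have "\<dots> = 1 + (\<integral>\<omega>. (\<Sum>s\<leftarrow>ss. cmod (entry s \<omega>) ^ length ss) \<partial>M)"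
    using int[OF assms] by (subst Bochner_Integration.integral_add) (auto simp: prob_space)
  also have "\<dots> \<le> 1 + length ss * C" using sum[of ss] by simp
  finally show "cmod (\<integral>\<omega>. prod_list (map (\<lambda>s. entry s \<omega>) ss) \<partial>M) \<le> 1 + length ss * C" .
qed

text \<open>All factors with the same canonical position equal one entry or its conjugate, so their
  product is a Borel function of that entry; independence of the canonical entries does the
  rest.\<close>

lemma expectation_factorises:
  assumes "set ss \<subseteq> index_set"
  shows "(\<integral>\<omega>. prod_list (map (\<lambda>s. entry s \<omega>) ss) \<partial>M) =
    (\<Prod>c\<in>canonical ` set ss. \<integral>\<omega>. (\<Prod>l\<in>{l. l < length ss \<and> canonical (ss ! l) = c}. entry (ss ! l) \<omega>) \<partial>M)"
proof -
  let ?K = "canonical ` set ss" and ?L = "\<lambda>c. {l. l < length ss \<and> canonical (ss ! l) = c}"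
  define g where "g = (\<lambda>c z. \<Prod>l\<in>?L c. if ss ! l = c then z else cnj (z :: complex))"
  have in_set: "ss ! l \<in> index_set" if "l < length ss" for l using assms that nth_mem by blast
  have inner: "(\<Prod>l\<in>?L c. entry (ss ! l) \<omega>) = g c (entry c \<omega>)" if "\<omega> \<in> space M" for c \<omega>
    unfolding g_def
  proof (intro prod.cong refl)
    fix l assume l: "l \<in> ?L c"
    then have l: "l < length ss" "canonical (ss ! l) = c" by auto
    show "entry (ss ! l) \<omega> = (if ss ! l = c then entry c \<omega> else cnj (entry c \<omega>))"
      using entry_canonical[OF in_set[OF l(1)] that] unfolding l(2) .
  qed
  have prod_eq: "prod_list (map (\<lambda>s. entry s \<omega>) ss) = (\<Prod>c\<in>?K. g c (entry c \<omega>))" if "\<omega> \<in> space M" for \<omega>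
  proof -
    have "prod_list (map (\<lambda>s. entry s \<omega>) ss) = (\<Prod>l\<in>{0..<length ss}. entry (ss ! l) \<omega>)"
      using prod_list_filter_nth[of "\<lambda>s. entry s \<omega>" "\<lambda>_. True" ss] by (simp add: lessThan_def atLeast0LessThan)
    also have "\<dots> = (\<Prod>c\<in>?K. \<Prod>l\<in>{l \<in> {0..<length ss}. canonical (ss ! l) = c}. entry (ss ! l) \<omega>)"
      by (rule prod.group[symmetric]) auto
    also have "\<dots> = (\<Prod>c\<in>?K. \<Prod>l\<in>?L c. entry (ss ! l) \<omega>)"
      by (intro prod.cong refl) auto
    finally show ?thesis using inner[OF that] by simp
  qed
  have K: "?K \<subseteq> {(i, j, k). i \<in> I \<and> j \<le> k \<and> k < n}" 
  proof (rule image_subsetI)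
    fix s assume "s \<in> set ss"
    then show "canonical s \<in> {(i, j, k). i \<in> I \<and> j \<le> k \<and> k < n}"
      using assms by (intro canonical_in) auto
  qed
  have g_meas: "g c \<in> borel_measurable borel" for c
    unfolding g_def
  proof (rule borel_measurable_prod)
    show "(\<lambda>z. if ss ! l = c then z else cnj z) \<in> borel_measurable borel" for l
      using borel_measurable_continuous_onI[OF continuous_on_cnj[OF continuous_on_id]]
      by (cases "ss ! l = c") simp_all
  qed
  have "indep_vars (\<lambda>_. borel) entry ?K"
    using indep_vars_subset[OF indep K] unfolding entry_def .
  then have ind: "indep_vars (\<lambda>_. borel) (\<lambda>c \<omega>. g c (entry c \<omega>)) ?K"
    by (rule indep_vars_compose2) (rule g_meas)
  \<comment> \<open>The product over a group is the product over a sublist of the steps, whose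
    integrability is known.\<close>
  have int: "integrable M (\<lambda>\<omega>. g c (entry c \<omega>))" if "c \<in> ?K" for c
  proof -
    let ?ss = "filter (\<lambda>s. canonical s = c) ss"
    have "prod_list (map (\<lambda>s. entry s \<omega>) ?ss) = g c (entry c \<omega>)" if "\<omega> \<in> space M" for \<omega>
      unfolding prod_list_filter_nth by (rule inner[OF that])
    moreover have "integrable M (\<lambda>\<omega>. prod_list (map (\<lambda>s. entry s \<omega>) ?ss))"
      using assms by (intro entries_prod_integrable(1)) auto
    ultimately show ?thesis by (simp cong: Bochner_Integration.integrable_cong)
  qed
  have "(\<integral>\<omega>. prod_list (map (\<lambda>s. entry s \<omega>) ss) \<partial>M) = (\<integral>\<omega>. (\<Prod>c\<in>?K. g c (entry c \<omega>)) \<partial>M)"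
    using prod_eq by (intro Bochner_Integration.integral_cong) auto
  also have "\<dots> = (\<Prod>c\<in>?K. \<integral>\<omega>. g c (entry c \<omega>) \<partial>M)"
    by (rule indep_vars_lebesgue_integral) (use ind int in auto)
  also have "\<dots> = (\<Prod>c\<in>?K. \<integral>\<omega>. (\<Prod>l\<in>?L c. entry (ss ! l) \<omega>) \<partial>M)"
    using inner by (intro prod.cong refl Bochner_Integration.integral_cong) auto
  finally show ?thesis .
qed

lemma steps_in_index_set:
  assumes "set w \<subseteq> I" "j < n" "W \<in> walks n (length w)"
  shows "set (steps j w W) \<subseteq> index_set"
proof
  fix s assume s: "s \<in> set (steps j w W)"
  obtain i a b where [simp]: "s = (i, a, b)" by (cases s)
  show "s \<in> index_set"
    using steps_vertices[of i a b j w W] s assms by (auto simp: index_set_def walks_def)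
qed

definition walk_expectation :: "nat \<Rightarrow> 'i list \<Rightarrow> nat list \<Rightarrow> complex" where
  "walk_expectation j w W = (\<integral>\<omega>. prod_list (map (\<lambda>s. entry s \<omega>) (steps j w W)) \<partial>M)"

text \<open>Some off-diagonal edge is crossed exactly once by its letter, and its factor is the mean
  of a centered entry.\<close>

lemma walk_expectation_unpaired:
  assumes "set w \<subseteq> I" "j < n" "W \<in> walks n (length w)" "\<not> paired j w W"
  shows "walk_expectation j w W = 0"
proof -
  let ?ss = "steps j w W"
  note ss = steps_in_index_set[OF assms(1-3)]
  obtain i a b where s: "(i, a, b) \<in> set ?ss" "a \<noteq> b" "\<not> 2 \<le> count (step_keys j w W) (i, {a, b})"
    using assms(4) unfolding paired_def by blast
  obtain l where l: "l < length ?ss" "?ss ! l = (i, a, b)" using s(1) by (metis in_set_conv_nth)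
  let ?L = "{l. l < length ?ss \<and> canonical (?ss ! l) = canonical (i, a, b)}"
  have "card ?L < 2"
    using s(3) unfolding count_mset_map_nth canonical_eq_iff by (simp add: insert_commute)
  moreover have "{l} \<subseteq> ?L" using l by auto
  ultimately have "?L = {l}"
    using card_seteq[of ?L "{l}"] by simp
  then have "(\<integral>\<omega>. (\<Prod>l\<in>?L. entry (?ss ! l) \<omega>) \<partial>M) = 0"
    using entry_mean[of i a b] s ss l by auto
  then show ?thesis
    unfolding walk_expectation_def expectation_factorises[OF ss] using s(1)
    by (intro prod_zero) (auto intro!: bexI[of _ "(i, a, b)"] simp del: canonical.simps)
qed

text \<open>Each edge is crossed exactly twice, and balance puts one crossing in each direction, so
  every factor is E|X|^2 = 1.\<close>

lemma walk_expectation_tree: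
  assumes "set w \<subseteq> I" "j < n" "W \<in> walks n (length w)" "tree_walk j w W"
  shows "walk_expectation j w W = 1"
proof -
  let ?ss = "steps j w W"
  note ss = steps_in_index_set[OF assms(1-3)]
  have len: "length W = length w" using assms(3) by (rule length_walks)
  have "(\<integral>\<omega>. (\<Prod>l\<in>{l. l < length ?ss \<and> canonical (?ss ! l) = canonical s}. entry (?ss ! l) \<omega>) \<partial>M) = 1"
    if s: "s \<in> set ?ss" for s
  proof -
    obtain i a b where sab: "s = (i, a, b)" by (cases s)
    have ab: "a \<noteq> b" using tree_walk_keys(2)[OF assms(4) len] s sab by blast
    let ?L = "{l. l < length ?ss \<and> canonical (?ss ! l) = canonical s}"
    let ?L1 = "{l. l < length ?ss \<and> ?ss ! l = (i, a, b)}" and ?L2 = "{l. l < length ?ss \<and> ?ss ! l = (i, b, a)}"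
    have L: "?L = ?L1 \<union> ?L2" "?L1 \<inter> ?L2 = {}"
      using ab unfolding canonical_eq_iff sab by (auto simp: doubleton_eq_iff key.simps elim!: key.elims)
    have "count (step_keys j w W) (i, {a, b}) = 2"
      by (rule tree_walk_keys(1)[OF assms(4) len]) (use s sab in force)
    then have "card ?L = 2" unfolding count_mset_map_nth canonical_eq_iff sab by simp
    then have "card ?L1 + card ?L2 = 2"
      using L card_Un_disjoint[of ?L1 ?L2] by simp
    moreover have "card ?L1 = card ?L2"
    proof -
      have "retracings j w W \<noteq> 0" using tree_walk_retracings[OF assms(4) len] by simp
      from retracings_balanced[OF this len, of i a b] show ?thesis
        using count_mset_map_nth[of "\<lambda>x. x" ?ss] by simp
    qed
    ultimately have "card ?L1 = 1" "card ?L2 = 1" by auto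
    then obtain l1 l2 where l: "?L1 = {l1}" "?L2 = {l2}" by (meson card_1_singletonE)
    then have l12: "?ss ! l1 = (i, a, b)" "?ss ! l2 = (i, b, a)" by blast+
    then have "l1 \<noteq> l2" using ab by auto
    then show ?thesis
      using entry_variance[of i a b] s sab ss ab unfolding L(1) l by (auto simp: l12 mult.commute)
  qed
  then show ?thesis
    unfolding walk_expectation_def expectation_factorises[OF ss] by (intro prod.neutral) auto
qed

lemma walk_expectation_bound:
  fixes C :: real
  assumes "set w \<subseteq> I" "j < n" "W \<in> walks n (length w)"
    and "\<And>i j k. i \<in> set w \<Longrightarrow> j \<le> k \<Longrightarrow> k < n \<Longrightarrow> (\<integral>\<omega>. cmod (X i \<omega> $$ (j, k)) ^ length w \<partial>M) \<le> C"
    and "0 \<le> C"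
  shows "cmod (walk_expectation j w W) \<le> 1 + length w * C"
proof -
  note ss = steps_in_index_set[OF assms(1-3)]
  have len: "length W = length w" using assms(3) by (rule length_walks)
  have "(\<integral>\<omega>. cmod (entry s \<omega>) ^ length (steps j w W) \<partial>M) \<le> C" if "s \<in> set (steps j w W)" for s
  proof -
    obtain i a b where s: "s = (i, a, b)" by (cases s)
    have "s \<in> index_set" using ss that by blast
    moreover have "i \<in> set w" using that steps_vertices(3)[of i a b j w W] unfolding s by simp
    ultimately show ?thesis
      using entry_power_integral[of s] assms(4)[of i "min a b" "max a b"] len
      by (auto simp: s index_set_def entry_def)
  qed
  from entries_prod_integrable(2)[OF ss this assms(5)] show ?thesis
    using len by (simp add: walk_expectation_def)
qed

text \<open>The weights \<open>s\<close> are deterministic and leave the expectation, which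
  separates the shape of the band from the distribution of the entries.\<close>

lemma band_word_expectation:
  assumes "set w \<subseteq> I" "j < n"
    and Y: "\<And>i \<omega>. i \<in> I \<Longrightarrow> Y i \<omega> \<in> carrier_mat n n"
    "\<And>i \<omega> a b. i \<in> I \<Longrightarrow> a < n \<Longrightarrow> b < n \<Longrightarrow> Y i \<omega> $$ (a, b) = of_real (s i a b) * X i \<omega> $$ (a, b)"
  shows "integrable M (\<lambda>\<omega>. foldr (\<lambda>i B. Y i \<omega> * B) w (1\<^sub>m n) $$ (j, j))"
    and "(\<integral>\<omega>. foldr (\<lambda>i B. Y i \<omega> * B) w (1\<^sub>m n) $$ (j, j) \<partial>M) =
      (\<Sum>W\<in>walks n (length w). of_bool (last (j # W) = j) *
        (of_real (step_prod s j w W) * walk_expectation j w W))"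
proof -
  have step_prod_Y: "step_prod (\<lambda>i a b. Y i \<omega> $$ (a, b)) j w W =
      of_real (step_prod s j w W) * prod_list (map (\<lambda>s. entry s \<omega>) (steps j w W))"
    if W: "W \<in> walks n (length w)" for \<omega> W
  proof -
    have "prod_list (map (\<lambda>(i, a, b). Y i \<omega> $$ (a, b)) ss) =
        of_real (prod_list (map (\<lambda>(i, a, b). s i a b) ss)) * prod_list (map (\<lambda>s. entry s \<omega>) ss)"
      if "set ss \<subseteq> index_set" for ss
      using that by (induction ss) (auto simp: Y entry_def index_set_def)
    then show ?thesis using steps_in_index_set[OF assms(1,2) W] by blast
  qed
  have entry_eq: "foldr (\<lambda>i B. Y i \<omega> * B) w (1\<^sub>m n) $$ (j, j) =
    (\<Sum>W\<in>walks n (length w). of_bool (last (j # W) = j) *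
        (of_real (step_prod s j w W) * prod_list (map (\<lambda>s. entry s \<omega>) (steps j w W))))" for \<omega>
  proof -
    have "foldr (\<lambda>i B. Y i \<omega> * B) w (1\<^sub>m n) $$ (j, j) = (\<Sum>W\<in>walks n (length w).
        of_bool (last (j # W) = j) * step_prod (\<lambda>i a b. Y i \<omega> $$ (a, b)) j w W)"
    proof (rule foldr_mat_entry(2))
      show "Y i \<omega> \<in> carrier_mat n n" if "i \<in> set w" for i
        using Y(1)[OF subsetD[OF assms(1) that]] .
    qed (fact assms(2))+
    also have "\<dots> = (\<Sum>W\<in>walks n (length w). of_bool (last (j # W) = j) *
        (of_real (step_prod s j w W) * prod_list (map (\<lambda>s. entry s \<omega>) (steps j w W))))"
    proof (rule sum.cong[OF refl])
      fix W assume W: "W \<in> walks n (length w)"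
      show "of_bool (last (j # W) = j) * step_prod (\<lambda>i a b. Y i \<omega> $$ (a, b)) j w W =
        of_bool (last (j # W) = j) *
          (of_real (step_prod s j w W) * prod_list (map (\<lambda>s. entry s \<omega>) (steps j w W)))"
        unfolding step_prod_Y[OF W] ..
    qed
    finally show ?thesis .
  qed
  have int: "integrable M (\<lambda>\<omega>. prod_list (map (\<lambda>s. entry s \<omega>) (steps j w W)))"
    if "W \<in> walks n (length w)" for W
    using steps_in_index_set[OF assms(1,2) that] by (rule entries_prod_integrable(1))
  show "integrable M (\<lambda>\<omega>. foldr (\<lambda>i B. Y i \<omega> * B) w (1\<^sub>m n) $$ (j, j))"
    unfolding entry_eq by (intro Bochner_Integration.integrable_sum integrable_mult_right int)
  show "(\<integral>\<omega>. foldr (\<lambda>i B. Y i \<omega> * B) w (1\<^sub>m n) $$ (j, j) \<partial>M) =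
      (\<Sum>W\<in>walks n (length w). of_bool (last (j # W) = j) *
        (of_real (step_prod s j w W) * walk_expectation j w W))"
    unfolding entry_eq walk_expectation_def
    by (subst Bochner_Integration.integral_sum, intro integrable_mult_right int)
       (simp_all only: integral_mult_right_zero)
qed

end

section \<open>Covariance operators in the limit\<close>

text \<open>The interval is open because limits are only controlled for 0 < x < 1.\<close>

definition unit_integral :: "(real \<Rightarrow> real) \<Rightarrow> real" where
  "unit_integral f = (LBINT x:{0<..<1}. f x)"

lemma unit_integral_cong: "(\<And>x. 0 < x \<Longrightarrow> x < 1 \<Longrightarrow> f x = g x) \<Longrightarrow> unit_integral f = unit_integral g"
  unfolding unit_integral_def by (intro set_lebesgue_integral_cong) auto

lemma unit_integral_const [simp]: "unit_integral (\<lambda>x. c) = c"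
  by (simp add: unit_integral_def set_lebesgue_integral_def)

lemma unit_integral_cmult [simp]: "unit_integral (\<lambda>x. c * f x) = c * unit_integral f"
  by (simp add: unit_integral_def)

section \<open>Riemann sums as integrals of step functions\<close>

lemma floor_average_tendsto: "0 \<le> x \<Longrightarrow> (\<lambda>n. real (nat \<lfloor>real n * x\<rfloor>) / real n) \<longlonglongrightarrow> x"
proof -
  assume x: "0 \<le> x"
  have "(\<lambda>n. real (nat \<lfloor>real n * x\<rfloor>) / real n - x) \<longlonglongrightarrow> 0"
  proof (rule Lim_null_comparison)
    show "\<forall>\<^sub>F n in sequentially. norm (real (nat \<lfloor>real n * x\<rfloor>) / real n - x) \<le> 1 / real n"
      using eventually_gt_at_top[of 0]
    proof eventually_elim
      case (elim n)
      have "real (nat \<lfloor>real n * x\<rfloor>) = of_int \<lfloor>real n * x\<rfloor>" using x by simp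
      then have "\<bar>real (nat \<lfloor>real n * x\<rfloor>) - real n * x\<bar> \<le> 1" by linarith
      moreover have "real (nat \<lfloor>real n * x\<rfloor>) / real n - x = (real (nat \<lfloor>real n * x\<rfloor>) - real n * x) / real n"
        using elim by (simp add: field_simps)
      ultimately show ?case using elim by (simp add: divide_right_mono)
    qed
    show "(\<lambda>n. 1 / real n) \<longlonglongrightarrow> 0" by (rule lim_1_over_n)
  qed
  then show ?thesis by (simp add: LIM_zero_iff)
qed

text \<open>An average over rows is the integral of a step function, which makes dominated
  convergence applicable to sums.\<close>

lemma step_integral:
  assumes "0 < n"
  shows "(LBINT x:{0<..<1}. h (nat \<lfloor>real n * x\<rfloor>)) = (\<Sum>k<n. h k) / real n"
    and "set_integrable lborel {0<..<1} (\<lambda>x. h (nat \<lfloor>real n * x\<rfloor>) :: real)"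
proof -
  let ?J = "\<lambda>k. {real k / real n..<real (Suc k) / real n}"
  have floor: "nat \<lfloor>real n * x\<rfloor> = k \<longleftrightarrow> x \<in> ?J k" if "0 \<le> x" for x k
  proof -
    have "nat \<lfloor>real n * x\<rfloor> = k \<longleftrightarrow> \<lfloor>real n * x\<rfloor> = int k" using that by auto
    also have "\<dots> \<longleftrightarrow> x \<in> ?J k" using assms by (auto simp: floor_eq_iff field_simps)
    finally show ?thesis .
  qed
  have eq: "indicator {0..<1} x *\<^sub>R h (nat \<lfloor>real n * x\<rfloor>) = (\<Sum>k<n. indicator (?J k) x *\<^sub>R h k)" for x :: real
  proof (cases "x \<in> {0..<1}")
    case True
    define q where "q = nat \<lfloor>real n * x\<rfloor>"
    have lt: "q < n"
      unfolding q_def using assms True by (simp add: nat_less_iff floor_less_iff)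
    have "(\<Sum>k<n. indicator (?J k) x *\<^sub>R h k) = (\<Sum>k<n. if k = q then h k else 0)"
    proof (intro sum.cong refl)
      fix k
      have "q = k \<longleftrightarrow> x \<in> ?J k" unfolding q_def by (rule floor) (use True in auto)
      then show "indicator (?J k) x *\<^sub>R h k = (if k = q then h k else 0)"
        by (cases "x \<in> ?J k") (simp_all del: atLeastLessThan_iff)
    qed
    then show ?thesis using True lt unfolding q_def[symmetric] by simp
  next
    case False
    have "x \<notin> ?J k" if "k < n" for k
    proof
      assume "x \<in> ?J k"
      then have "real k / real n \<le> x" "x < real (Suc k) / real n" by auto
      moreover have "real (Suc k) / real n \<le> 1" using that by simp
      moreover have "0 \<le> real k / real n" by simp
      ultimately have "x \<in> {0..<1}" unfolding atLeastLessThan_iff by linarith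
      then show False using False by simp
    qed
    then show ?thesis using False by simp
  qed
  \<comment> \<open>The half-open pieces cover the point 0, which the open interval omits.\<close>
  have ae: "AE x in lborel. indicator {0<..<1} x *\<^sub>R h (nat \<lfloor>real n * x\<rfloor>) = (\<Sum>k<n. indicator (?J k) x *\<^sub>R h k)"
    unfolding eq[symmetric] using AE_lborel_singleton[of 0] by eventually_elim (auto simp: indicator_def)
  have int: "integrable lborel (\<lambda>x. \<Sum>k<n. indicator (?J k) x *\<^sub>R h k)"
    using assms by (intro Bochner_Integration.integrable_sum integrable_scaleR_left) (auto simp: integrable_real_indicator divide_right_mono)
  have meas: "(\<lambda>x. indicator {0<..<1} x *\<^sub>R h (nat \<lfloor>real n * x\<rfloor>)) \<in> borel_measurable lborel" by measurable
  have "(LBINT x:{0<..<1}. h (nat \<lfloor>real n * x\<rfloor>)) = (LINT x|lborel. (\<Sum>k<n. indicator (?J k) x *\<^sub>R h k))"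
    unfolding set_lebesgue_integral_def
    by (rule integral_cong_AE[OF meas borel_measurable_integrable[OF int] ae])
  also have "\<dots> = (\<Sum>k<n. h k) / real n"
  proof -
    have "measure lborel (?J k) = 1 / real n" for k
      using assms by (simp add: divide_right_mono diff_divide_distrib[symmetric])
    then show ?thesis
      using assms by (subst Bochner_Integration.integral_sum)
       (auto simp: sum_divide_distrib integrable_real_indicator divide_right_mono)
  qed
  finally show "(LBINT x:{0<..<1}. h (nat \<lfloor>real n * x\<rfloor>)) = (\<Sum>k<n. h k) / real n" .
  show "set_integrable lborel {0<..<1} (\<lambda>x. h (nat \<lfloor>real n * x\<rfloor>))"
    unfolding set_integrable_def
      integrable_cong_AE[OF meas borel_measurable_integrable[OF int] ae] by (rule int)
qed

text \<open>Dominated convergence for the step functions of \<open>step_integral\<close>.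
  Convergence for almost every x will absorb the edges of a band, where the indicator may
  fluctuate.\<close>

lemma average_limit:
  fixes h :: "nat \<Rightarrow> nat \<Rightarrow> real"
  assumes bound: "\<forall>\<^sub>F n in sequentially. \<forall>k<n. \<bar>h n k\<bar> \<le> B"
    and meas: "(\<lambda>x. indicator {0<..<1} x * f x) \<in> borel_measurable lborel"
    and lim: "AE x in lborel. 0 < x \<longrightarrow> x < 1 \<longrightarrow> (\<lambda>n. h n (nat \<lfloor>real n * x\<rfloor>)) \<longlonglongrightarrow> f x"
  shows "(\<lambda>n. (\<Sum>k<n. h n k) / real n) \<longlonglongrightarrow> unit_integral f"
proof -
  have "\<forall>\<^sub>F n in sequentially. 0 < n \<and> (\<forall>k<n. \<bar>h n k\<bar> \<le> B)"
    using bound eventually_gt_at_top[of 0] by eventually_elim simp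
  then obtain N where N: "\<And>n. N \<le> n \<Longrightarrow> 0 < n \<and> (\<forall>k<n. \<bar>h n k\<bar> \<le> B)"
    unfolding eventually_sequentially by blast
  \<comment> \<open>Shifting by \<open>N\<close> makes the bound hold for every index, as domination
    requires.\<close>
  let ?s = "\<lambda>n x. indicator {0<..<1} x *\<^sub>R h (n + N) (nat \<lfloor>real (n + N) * x\<rfloor>)"
  have B: "0 \<le> B" using N[of N] by fastforce
  have "(\<lambda>n. integral\<^sup>L lborel (?s n)) \<longlonglongrightarrow> (LINT x|lborel. indicator {0<..<1} x *\<^sub>R f x)"
  proof (rule integral_dominated_convergence[where w = "\<lambda>x. indicator {0<..<1} x * B"])
    show "AE x in lborel. (\<lambda>n. ?s n x) \<longlonglongrightarrow> indicator {0<..<1} x *\<^sub>R f x"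
      using lim
    proof eventually_elim
      case (elim x)
      show ?case
      proof (cases "x \<in> {0<..<1}")
        case True
        then have "(\<lambda>n. h n (nat \<lfloor>real n * x\<rfloor>)) \<longlonglongrightarrow> f x" using elim by simp
        from LIMSEQ_ignore_initial_segment[OF this, of N] show ?thesis using True by simp
      qed simp
    qed
    show "AE x in lborel. norm (?s n x) \<le> indicator {0<..<1} x * B" for n
    proof (intro AE_I2)
      fix x :: real
      show "norm (?s n x) \<le> indicator {0<..<1} x * B"
      proof (cases "x \<in> {0<..<1}")
        case True
        moreover have "nat \<lfloor>real (n + N) * x\<rfloor> < n + N"
        proof -
          have "0 < n + N" using N[of "n + N"] by (simp del: add_gr_0)
          then have "real (n + N) * x < real (n + N) * 1"
            using True by (intro mult_strict_left_mono) (auto simp del: of_nat_add add_gr_0)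
          then have "real (n + N) * x < real (n + N)" by (simp only: mult_1_right)
          then have "\<lfloor>real (n + N) * x\<rfloor> < int (n + N)" unfolding floor_less_iff by simp
          then show ?thesis using True by (simp add: nat_less_iff)
        qed
        ultimately show ?thesis using N[of "n + N"] by simp
      qed simp
    qed
  qed (use meas in \<open>auto simp: integrable_real_indicator\<close>)
  moreover have "integral\<^sup>L lborel (?s n) = (\<Sum>k<n + N. h (n + N) k) / real (n + N)" for n
    using step_integral(1)[of "n + N" "h (n + N)"] N[of "n + N"] by (simp add: set_lebesgue_integral_def)
  ultimately have "(\<lambda>n. (\<Sum>k<n + N. h (n + N) k) / real (n + N)) \<longlonglongrightarrow> unit_integral f"
    by (simp add: unit_integral_def set_lebesgue_integral_def)
  then show ?thesis by (rule LIMSEQ_offset)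
qed

section \<open>Convergence along sequences of rows\<close>

text \<open>
  Boundary points are left out: rows near the boundary of a slowly growing non-periodic band contain
  fewer entries.
\<close>

definition interior_limit :: "(nat \<Rightarrow> nat \<Rightarrow> real) \<Rightarrow> (real \<Rightarrow> real) \<Rightarrow> bool" where
  "interior_limit g f \<longleftrightarrow>
    (\<exists>B. \<forall>\<^sub>F n in sequentially. \<forall>j<n. \<bar>g n j\<bar> \<le> B) \<and>
    (\<forall>x J. 0 < x \<longrightarrow> x < 1 \<longrightarrow> (\<lambda>n. real (J n) / real n) \<longlonglongrightarrow> x \<longrightarrow> (\<lambda>n. g n (J n)) \<longlonglongrightarrow> f x)"

lemma interior_limitD:
  "interior_limit g f \<Longrightarrow> 0 < x \<Longrightarrow> x < 1 \<Longrightarrow> (\<lambda>n. real (J n) / real n) \<longlonglongrightarrow> x \<Longrightarrow> (\<lambda>n. g n (J n)) \<longlonglongrightarrow> f x"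
  by (simp add: interior_limit_def)

lemma interior_limit_bounded:
  assumes "interior_limit g f"
  obtains B where "0 \<le> B" "\<forall>\<^sub>F n in sequentially. \<forall>j<n. \<bar>g n j\<bar> \<le> B"
proof -
  obtain B where B: "\<forall>\<^sub>F n in sequentially. \<forall>j<n. \<bar>g n j\<bar> \<le> B"
    using assms by (auto simp: interior_limit_def)
  then have "\<forall>\<^sub>F n in sequentially. \<forall>j<n. \<bar>g n j\<bar> \<le> \<bar>B\<bar>"
    by eventually_elim (meson abs_ge_self order_trans)
  then show thesis using that[of "\<bar>B\<bar>"] by simp
qed

lemma interior_limit_const: "interior_limit (\<lambda>n j. c) (\<lambda>x. c)"
  unfolding interior_limit_def by (auto intro!: exI[of _ "\<bar>c\<bar>"])

lemma interior_limit_mult: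
  assumes "interior_limit g f" "interior_limit g' f'"
  shows "interior_limit (\<lambda>n j. g n j * g' n j) (\<lambda>x. f x * f' x)"
proof -
  obtain B where B: "0 \<le> B" "\<forall>\<^sub>F n in sequentially. \<forall>j<n. \<bar>g n j\<bar> \<le> B"
    using interior_limit_bounded[OF assms(1)] .
  obtain B' where B': "0 \<le> B'" "\<forall>\<^sub>F n in sequentially. \<forall>j<n. \<bar>g' n j\<bar> \<le> B'"
    using interior_limit_bounded[OF assms(2)] .
  have "\<forall>\<^sub>F n in sequentially. \<forall>j<n. \<bar>g n j * g' n j\<bar> \<le> B * B'"
    using B(2) B'(2) by eventually_elim (use B(1) in \<open>auto simp: abs_mult intro!: mult_mono\<close>)
  then show ?thesis
    using assms unfolding interior_limit_def by (auto intro!: tendsto_mult)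
qed

lemma interior_limit_sum:
  assumes "\<And>p. p \<in> P \<Longrightarrow> interior_limit (g p) (f p)" "finite P"
  shows "interior_limit (\<lambda>n j. \<Sum>p\<in>P. g p n j) (\<lambda>x. \<Sum>p\<in>P. f p x)"
  using assms(2,1)
proof (induction P)
  case empty
  show ?case using interior_limit_const[of 0] by simp
next
  case (insert p P)
  have 1: "interior_limit (g p) (f p)" and 2: "interior_limit (\<lambda>n j. \<Sum>p\<in>P. g p n j) (\<lambda>x. \<Sum>p\<in>P. f p x)"
    using insert by auto
  obtain B where B: "0 \<le> B" "\<forall>\<^sub>F n in sequentially. \<forall>j<n. \<bar>g p n j\<bar> \<le> B"
    using interior_limit_bounded[OF 1] .
  obtain B' where B': "0 \<le> B'" "\<forall>\<^sub>F n in sequentially. \<forall>j<n. \<bar>\<Sum>p\<in>P. g p n j\<bar> \<le> B'"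
    using interior_limit_bounded[OF 2] .
  have "\<forall>\<^sub>F n in sequentially. \<forall>j<n. \<bar>g p n j + (\<Sum>p\<in>P. g p n j)\<bar> \<le> B + B'"
    using B(2) B'(2) by eventually_elim (auto intro: order_trans[OF abs_triangle_ineq] add_mono)
  then show ?case
    using 1 2 insert.hyps unfolding interior_limit_def by (auto intro!: tendsto_add)
qed

text \<open>On the interval, \<open>f\<close> is the pointwise limit of the step functions that
  sample the rows floor (n x), and inherits their measurability.\<close>

lemma interior_limit_measurable:
  assumes "interior_limit g f"
  shows "(\<lambda>x. indicator {0<..<1} x * f x) \<in> borel_measurable borel"
proof (rule borel_measurable_LIMSEQ_real)
  show "(\<lambda>x. indicator {0<..<1} x * g n (nat \<lfloor>real n * x\<rfloor>)) \<in> borel_measurable borel" for n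
    by measurable
  show "(\<lambda>n. indicator {0<..<1} x * g n (nat \<lfloor>real n * x\<rfloor>)) \<longlonglongrightarrow> indicator {0<..<1} x * f x" for x
  proof (cases "0 < x \<and> x < 1")
    case True
    then have "(\<lambda>n. g n (nat \<lfloor>real n * x\<rfloor>)) \<longlonglongrightarrow> f x"
      by (intro interior_limitD[OF assms] floor_average_tendsto) auto
    then show ?thesis by (rule tendsto_mult_left)
  qed (auto simp: indicator_def)
qed

lemma interior_limit_average:
  assumes "interior_limit g f"
  shows "(\<lambda>n. (\<Sum>k<n. g n k) / real n) \<longlonglongrightarrow> unit_integral f"
proof -
  obtain B where B: "\<forall>\<^sub>F n in sequentially. \<forall>j<n. \<bar>g n j\<bar> \<le> B"
    using interior_limit_bounded[OF assms] by blast
  show ?thesis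
    using interior_limit_measurable[OF assms] interior_limitD[OF assms] floor_average_tendsto
    by (intro average_limit[OF B]) auto
qed

section \<open>Limits of covariance operators\<close>

definition limit_operator :: "(nat \<Rightarrow> nat \<Rightarrow> nat \<Rightarrow> real) \<Rightarrow> ((real \<Rightarrow> real) \<Rightarrow> real \<Rightarrow> real) \<Rightarrow> bool" where
  "limit_operator S \<eta> \<longleftrightarrow>
    (\<forall>g f. interior_limit g f \<longrightarrow> interior_limit (\<lambda>n j. \<Sum>k<n. S n j k * g n k) (\<eta> f))"

text \<open>The recursion consists of covariance operators, products and finite sums, and each of
  these preserves interior convergence. The uniform bound in \<open>interior_limit\<close> is
  carried along for the dominated convergence at the end.\<close>

lemma interior_limit_ov_moment:
  assumes "\<And>i. i \<in> set w \<Longrightarrow> limit_operator (\<lambda>n. S n i) (\<eta> i)"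
  shows "interior_limit (\<lambda>n. ov_moment (\<lambda>i f j. \<Sum>k<n. S n i j k * f k) w) (ov_moment \<eta> w)"
  using assms
proof (induction "length w" arbitrary: w rule: less_induct)
  case less
  show ?case
  proof (cases w)
    case (Cons i w')
    have "interior_limit (\<lambda>n j. if w' ! p = i
        then (\<Sum>k<n. S n i j k * ov_moment (\<lambda>i f j. \<Sum>k<n. S n i j k * f k) (take p w') k) *
          ov_moment (\<lambda>i f j. \<Sum>k<n. S n i j k * f k) (drop (Suc p) w') j else 0)
      (\<lambda>x. if w' ! p = i then \<eta> i (ov_moment \<eta> (take p w')) x * ov_moment \<eta> (drop (Suc p) w') x else 0)" for p
    proof (cases "w' ! p = i")
      case True
      have "interior_limit (\<lambda>n. ov_moment (\<lambda>i f j. \<Sum>k<n. S n i j k * f k) (take p w')) (ov_moment \<eta> (take p w'))"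
        using less.prems Cons by (intro less.hyps) (auto dest: in_set_takeD)
      then have "interior_limit (\<lambda>n j. \<Sum>k<n. S n i j k * ov_moment (\<lambda>i f j. \<Sum>k<n. S n i j k * f k) (take p w') k)
          (\<eta> i (ov_moment \<eta> (take p w')))"
        using less.prems Cons unfolding limit_operator_def by auto
      moreover have "interior_limit (\<lambda>n. ov_moment (\<lambda>i f j. \<Sum>k<n. S n i j k * f k) (drop (Suc p) w'))
          (ov_moment \<eta> (drop (Suc p) w'))"
        using less.prems Cons by (intro less.hyps) (auto dest: in_set_dropD)
      ultimately show ?thesis using True by (simp add: interior_limit_mult)
    next
      case False
      then show ?thesis using interior_limit_const[of 0] by simp
    qed
    then show ?thesis unfolding Cons ov_moment.simps by (intro interior_limit_sum) auto
  qed (simp add: interior_limit_const)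
qed

text \<open>The data of a normalised band: \<open>\<sigma>\<close> bounds the weight of an unmatched
  step, the row mass \<open>D\<close> pays for discoveries, symmetry keeps the matrices Hermitian,
  and \<open>\<eta>\<close> is the limiting covariance.\<close>

definition band_profile ::
  "(nat \<Rightarrow> real) \<Rightarrow> (nat \<Rightarrow> nat \<Rightarrow> nat \<Rightarrow> bool) \<Rightarrow> ((real \<Rightarrow> real) \<Rightarrow> real \<Rightarrow> real) \<Rightarrow> bool" where
  "band_profile \<sigma> N \<eta> \<longleftrightarrow>
    (\<forall>n. 0 \<le> \<sigma> n) \<and> \<sigma> \<longlonglongrightarrow> 0 \<and> (\<forall>n j k. N n j k = N n k j) \<and>
    (\<exists>D\<ge>0. \<forall>\<^sub>F n in sequentially. \<forall>j<n. (\<sigma> n)\<^sup>2 * real (card {k. k < n \<and> N n j k}) \<le> D) \<and>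
    limit_operator (\<lambda>n j k. (\<sigma> n)\<^sup>2 * of_bool (N n j k)) \<eta>"

text \<open>The bound in \<open>interior_limit\<close> follows from the row masses, so the
  convergence at interior points is all that has to be supplied.\<close>

lemma limit_operatorI:
  assumes deg: "\<forall>\<^sub>F n in sequentially. \<forall>j<n. (\<sigma> n)\<^sup>2 * real (card {k. k < n \<and> N n j k}) \<le> D"
    and lim: "\<And>g f x J. interior_limit g f \<Longrightarrow> 0 < x \<Longrightarrow> x < 1 \<Longrightarrow> (\<lambda>n. real (J n) / real n) \<longlonglongrightarrow> x \<Longrightarrow>
      (\<lambda>n. \<Sum>k<n. (\<sigma> n)\<^sup>2 * of_bool (N n (J n) k) * g n k) \<longlonglongrightarrow> \<eta> f x"
  shows "limit_operator (\<lambda>n j k. (\<sigma> n)\<^sup>2 * of_bool (N n j k)) \<eta>"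
  unfolding limit_operator_def
proof (intro allI impI)
  fix g f assume g: "interior_limit g f"
  obtain B where B: "0 \<le> B" "\<forall>\<^sub>F n in sequentially. \<forall>j<n. \<bar>g n j\<bar> \<le> B"
    using interior_limit_bounded[OF g] .
  have "\<forall>\<^sub>F n in sequentially. \<forall>j<n. \<bar>\<Sum>k<n. (\<sigma> n)\<^sup>2 * of_bool (N n j k) * g n k\<bar> \<le> D * B"
    using deg B(2)
  proof eventually_elim
    case (elim n)
    show ?case
    proof (intro allI impI)
      fix j assume j: "j < n"
      have "\<bar>\<Sum>k<n. (\<sigma> n)\<^sup>2 * of_bool (N n j k) * g n k\<bar> \<le> (\<Sum>k<n. (\<sigma> n)\<^sup>2 * of_bool (N n j k) * B)"
        using elim(2) by (intro order_trans[OF sum_abs] sum_mono) (auto simp: abs_mult mult_left_mono)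
      also have "\<dots> = (\<sigma> n)\<^sup>2 * real (card {k. k < n \<and> N n j k}) * B"
      proof -
        have "{..<n} \<inter> {k. N n j k} = {k. k < n \<and> N n j k}" by auto
        then show ?thesis by (simp add: of_bool_def sum.If_cases flip: sum_distrib_left sum_distrib_right)
      qed
      also have "\<dots> \<le> D * B" using elim(1) j B(1) by (intro mult_right_mono) auto
      finally show "\<bar>\<Sum>k<n. (\<sigma> n)\<^sup>2 * of_bool (N n j k) * g n k\<bar> \<le> D * B" .
    qed
  qed
  then show "interior_limit (\<lambda>n j. \<Sum>k<n. (\<sigma> n)\<^sup>2 * of_bool (N n j k) * g n k) (\<eta> f)"
    unfolding interior_limit_def using lim[OF g] by blast
qed

text \<open>The window around an interior row has width o(n), so all its rows tend to the same point
  x and the local average reproduces \<open>f x\<close>. Convergence along arbitrary sequences of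
  rows makes this uniform over the window.\<close>

lemma limit_operator_local:
  assumes b: "filterlim b at_top sequentially" "(\<lambda>n. real (b n) / real n) \<longlonglongrightarrow> 0"
    and deg: "\<forall>\<^sub>F n in sequentially. \<forall>j<n. (1 / sqrt (2 * real (b n)))\<^sup>2 * real (card {k. k < n \<and> N n j k}) \<le> D"
    and N: "\<And>x J. 0 < x \<Longrightarrow> x < 1 \<Longrightarrow> (\<lambda>n. real (J n) / real n) \<longlonglongrightarrow> x \<Longrightarrow>
      \<forall>\<^sub>F n in sequentially. b n \<le> J n \<and> {k. k < n \<and> N n (J n) k} = {J n - b n..J n + b n}"
  shows "limit_operator (\<lambda>n j k. (1 / sqrt (2 * real (b n)))\<^sup>2 * of_bool (N n j k)) (\<lambda>f. f)"
proof (rule limit_operatorI[OF deg])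
  fix g :: "nat \<Rightarrow> nat \<Rightarrow> real" and f x and J :: "nat \<Rightarrow> nat"
  assume g: "interior_limit g f" and x: "0 < x" "x < 1" and J: "(\<lambda>n. real (J n) / real n) \<longlonglongrightarrow> x"
  let ?A = "\<lambda>n. {J n - b n..J n + b n}"
  \<comment> \<open>Among the rows of the window take one where \<open>g\<close> deviates most from
    \<open>f x\<close>. These rows form a sequence tending to x, which controls the whole
    window.\<close>
  have "\<exists>k\<in>?A n. \<forall>l\<in>?A n. \<bar>g n l - f x\<bar> \<le> \<bar>g n k - f x\<bar>" for n
  proof -
    define R where "R = (\<lambda>l. \<bar>g n l - f x\<bar>) ` ?A n"
    have R: "finite R" "R \<noteq> {}" by (auto simp: R_def)
    obtain k where k: "k \<in> ?A n" "\<bar>g n k - f x\<bar> = Max R"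
      using Max_in[OF R] unfolding R_def image_iff by (auto simp del: atLeastAtMost_iff)
    have "\<bar>g n l - f x\<bar> \<le> \<bar>g n k - f x\<bar>" if "l \<in> ?A n" for l
      unfolding k(2) using that by (intro Max_ge[OF R(1)]) (auto simp: R_def)
    then show ?thesis using k(1) by blast
  qed
  then obtain K where K: "\<And>n. K n \<in> ?A n" "\<And>n l. l \<in> ?A n \<Longrightarrow> \<bar>g n l - f x\<bar> \<le> \<bar>g n (K n) - f x\<bar>"
    by metis
  have "(\<lambda>n. real (K n) / real n - real (J n) / real n) \<longlonglongrightarrow> 0"
  proof (rule Lim_null_comparison[OF always_eventually b(2)], intro allI)
    fix n
    have "\<bar>real (K n) - real (J n)\<bar> \<le> real (b n)" using K(1)[of n] by auto
    then show "norm (real (K n) / real n - real (J n) / real n) \<le> real (b n) / real n"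
      by (simp add: divide_right_mono flip: diff_divide_distrib)
  qed
  from tendsto_add[OF this J] have Kx: "(\<lambda>n. real (K n) / real n) \<longlonglongrightarrow> x" by simp
  have d: "(\<lambda>n. \<bar>g n (K n) - f x\<bar>) \<longlonglongrightarrow> 0"
    using interior_limitD[OF g x Kx] by (simp add: LIM_zero tendsto_rabs_zero)
  have inv: "(\<lambda>n. 1 / (2 * real (b n))) \<longlonglongrightarrow> 0"
    using tendsto_mult[OF tendsto_const[of "1/2"] tendsto_inverse_0_at_top[OF filterlim_compose[OF filterlim_real_sequentially b(1)]]]
    by (simp add: field_simps)
  let ?L = "\<lambda>n. \<Sum>k<n. (1 / sqrt (2 * real (b n)))\<^sup>2 * of_bool (N n (J n) k) * g n k"
  have "(\<lambda>n. ?L n - f x) \<longlonglongrightarrow> 0"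
  proof (rule Lim_null_comparison)
    show "(\<lambda>n. (1 + 1 / (2 * real (b n))) * \<bar>g n (K n) - f x\<bar> + 1 / (2 * real (b n)) * \<bar>f x\<bar>) \<longlonglongrightarrow> 0"
      using tendsto_add[OF tendsto_mult[OF tendsto_add[OF tendsto_const[of 1] inv] d]
        tendsto_mult[OF inv tendsto_const[of "\<bar>f x\<bar>"]]] by simp
    have "\<forall>\<^sub>F n in sequentially. 0 < b n"
      using b(1) by (simp add: filterlim_at_top flip: Suc_le_eq)
    with N[OF x J] show "\<forall>\<^sub>F n in sequentially. norm (?L n - f x) \<le>
        (1 + 1 / (2 * real (b n))) * \<bar>g n (K n) - f x\<bar> + 1 / (2 * real (b n)) * \<bar>f x\<bar>"
    proof eventually_elim
      case (elim n)
      then have b0: "0 < b n" and bJ: "b n \<le> J n" and A: "{k. k < n \<and> N n (J n) k} = ?A n" by auto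
      define r where "r = 1 / (2 * real (b n))"
      have r: "0 < r" using b0 by (simp add: r_def)
      \<comment> \<open>The window has 2 b + 1 rows of weight 1 / (2 b), so the total mass exceeds 1
        by \<open>r\<close>, which tends to 0.\<close>
      have card: "real (card (?A n)) * r = 1 + r"
        using b0 bJ by (simp add: r_def field_simps of_nat_diff)
      have "?L n = (\<Sum>k<n. if N n (J n) k then r * g n k else 0)"
        by (intro sum.cong refl) (simp add: r_def power_divide)
      also have "\<dots> = (\<Sum>k\<in>?A n. r * g n k)"
        unfolding A[symmetric] by (subst sum.inter_filter[symmetric]) (auto intro: sum.cong)
      finally have L: "?L n = (\<Sum>k\<in>?A n. r * g n k)" .
      have "?L n - (1 + r) * f x = (\<Sum>k\<in>?A n. r * (g n k - f x))"
        unfolding L card[symmetric] by (simp add: right_diff_distrib sum_subtractf)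
      also have "\<bar>\<dots>\<bar> \<le> (\<Sum>k\<in>?A n. r * \<bar>g n (K n) - f x\<bar>)"
        using r K(2) by (intro order_trans[OF sum_abs] sum_mono) (auto simp: abs_mult)
      also have "\<dots> = (1 + r) * \<bar>g n (K n) - f x\<bar>" unfolding card[symmetric] by simp
      finally have "\<bar>?L n - (1 + r) * f x\<bar> \<le> (1 + r) * \<bar>g n (K n) - f x\<bar>" .
      moreover have "\<bar>r * f x\<bar> = r * \<bar>f x\<bar>" using r by (simp add: abs_mult)
      moreover have "?L n - f x = (?L n - (1 + r) * f x) + r * f x" by (simp add: algebra_simps)
      ultimately show ?case unfolding r_def[symmetric] real_norm_def by linarith
    qed
  qed
  then show "?L \<longlonglongrightarrow> f x" by (rule LIM_zero_cancel)
qed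

text \<open>The sum is a Riemann sum with n times the squared scale in front. For almost every y the
  indicator is eventually constant along rows tending to x and y; the exceptional points will be the
  edges of the band.\<close>

lemma limit_operator_kernel:
  assumes s: "(\<lambda>n. real n * (\<sigma> n)\<^sup>2) \<longlonglongrightarrow> s"
    and deg: "\<forall>\<^sub>F n in sequentially. \<forall>j<n. (\<sigma> n)\<^sup>2 * real (card {k. k < n \<and> N n j k}) \<le> D"
    and K: "\<And>x. (\<lambda>y. of_bool (K x y) :: real) \<in> borel_measurable borel"
    and N: "\<And>x J. 0 < x \<Longrightarrow> x < 1 \<Longrightarrow> (\<lambda>n. real (J n) / real n) \<longlonglongrightarrow> x \<Longrightarrow>
      AE y in lborel. \<forall>k. (\<lambda>n. real (k n) / real n) \<longlonglongrightarrow> y \<longrightarrow> (\<forall>\<^sub>F n in sequentially. N n (J n) (k n) = K x y)"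
  shows "limit_operator (\<lambda>n j k. (\<sigma> n)\<^sup>2 * of_bool (N n j k))
    (\<lambda>f x. s * unit_integral (\<lambda>y. of_bool (K x y) * f y))"
proof (rule limit_operatorI[OF deg])
  fix g :: "nat \<Rightarrow> nat \<Rightarrow> real" and f x and J :: "nat \<Rightarrow> nat"
  assume g: "interior_limit g f" and x: "0 < x" "x < 1" and J: "(\<lambda>n. real (J n) / real n) \<longlonglongrightarrow> x"
  obtain B where B: "\<forall>\<^sub>F n in sequentially. \<forall>j<n. \<bar>g n j\<bar> \<le> B"
    using interior_limit_bounded[OF g] by blast
  have "(\<lambda>n. (\<Sum>k<n. of_bool (N n (J n) k) * g n k) / real n) \<longlonglongrightarrow> unit_integral (\<lambda>y. of_bool (K x y) * f y)"
  proof (rule average_limit)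
    show "\<forall>\<^sub>F n in sequentially. \<forall>k<n. \<bar>of_bool (N n (J n) k) * g n k\<bar> \<le> B"
      using B
    proof eventually_elim
      case (elim n)
      show ?case
      proof (intro allI impI)
        fix k assume "k < n"
        then have "\<bar>g n k\<bar> \<le> B" using elim by blast
        then show "\<bar>of_bool (N n (J n) k) * g n k\<bar> \<le> B" by (cases "N n (J n) k") auto
      qed
    qed
    have "(\<lambda>y. of_bool (K x y) * (indicator {0<..<1} y * f y)) \<in> borel_measurable borel"
      by (intro borel_measurable_times K interior_limit_measurable[OF g])
    then show "(\<lambda>y. indicator {0<..<1} y * (of_bool (K x y) * f y)) \<in> borel_measurable lborel"
      by (simp add: mult_ac)
    show "AE y in lborel. 0 < y \<longrightarrow> y < 1 \<longrightarrow>
        (\<lambda>n. of_bool (N n (J n) (nat \<lfloor>real n * y\<rfloor>)) * g n (nat \<lfloor>real n * y\<rfloor>)) \<longlonglongrightarrow> of_bool (K x y) * f y"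
      using N[OF x J]
    proof (eventually_elim, intro impI)
      fix y :: real
      assume ev: "\<forall>k. (\<lambda>n. real (k n) / real n) \<longlonglongrightarrow> y \<longrightarrow> (\<forall>\<^sub>F n in sequentially. N n (J n) (k n) = K x y)"
        and y: "0 < y" "y < 1"
      have lim: "(\<lambda>n. real (nat \<lfloor>real n * y\<rfloor>) / real n) \<longlonglongrightarrow> y" using y by (intro floor_average_tendsto) simp
      have "\<forall>\<^sub>F n in sequentially. of_bool (K x y) * g n (nat \<lfloor>real n * y\<rfloor>) =
          of_bool (N n (J n) (nat \<lfloor>real n * y\<rfloor>)) * g n (nat \<lfloor>real n * y\<rfloor>)"
        using ev[rule_format, OF lim] by eventually_elim simp
      moreover have "(\<lambda>n. of_bool (K x y) * g n (nat \<lfloor>real n * y\<rfloor>)) \<longlonglongrightarrow> of_bool (K x y) * f y"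
        by (intro tendsto_mult_left interior_limitD[OF g y lim])
      ultimately show "(\<lambda>n. of_bool (N n (J n) (nat \<lfloor>real n * y\<rfloor>)) * g n (nat \<lfloor>real n * y\<rfloor>)) \<longlonglongrightarrow> of_bool (K x y) * f y"
        by (rule Lim_transform_eventually[rotated])
    qed
  qed
  from tendsto_mult[OF s this]
  have "(\<lambda>n. real n * (\<sigma> n)\<^sup>2 * ((\<Sum>k<n. of_bool (N n (J n) k) * g n k) / real n)) \<longlonglongrightarrow>
      s * unit_integral (\<lambda>y. of_bool (K x y) * f y)" .
  moreover have "\<forall>\<^sub>F n in sequentially. real n * (\<sigma> n)\<^sup>2 * ((\<Sum>k<n. of_bool (N n (J n) k) * g n k) / real n) =
      (\<Sum>k<n. (\<sigma> n)\<^sup>2 * of_bool (N n (J n) k) * g n k)"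
    using eventually_gt_at_top[of 0]
  proof eventually_elim
    case (elim n)
    then have "real n * (\<sigma> n)\<^sup>2 * ((\<Sum>k<n. of_bool (N n (J n) k) * g n k) / real n) =
        (\<sigma> n)\<^sup>2 * (\<Sum>k<n. of_bool (N n (J n) k) * g n k)" by simp
    then show ?case by (simp only: sum_distrib_left mult.assoc)
  qed
  ultimately show "(\<lambda>n. \<Sum>k<n. (\<sigma> n)\<^sup>2 * of_bool (N n (J n) k) * g n k) \<longlonglongrightarrow>
      s * unit_integral (\<lambda>y. of_bool (K x y) * f y)"
    by (rule Lim_transform_eventually)
qed

section \<open>The concrete bands\<close>

lemma card_band_le: "card {k. k < n \<and> \<bar>int j - int k\<bar> \<le> int b} \<le> 2 * b + 1"
proof -
  have "card {k. k < n \<and> \<bar>int j - int k\<bar> \<le> int b} \<le> card {j - b..j + b}"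
    by (intro card_mono) auto
  then show ?thesis by simp
qed

text \<open>In the wrapped part of the band n - |j - k| \<le> b, which forces k into the first b + 1
  or the last b indices.\<close>

lemma card_cyclic_band_le:
  assumes "j < n"
  shows "card {k. k < n \<and> cyclic_dist n j k \<le> int b} \<le> 4 * b + 2"
proof -
  have "{k. k < n \<and> cyclic_dist n j k \<le> int b} \<subseteq>
      {k. k < n \<and> \<bar>int j - int k\<bar> \<le> int b} \<union> ({..b} \<union> {n - b..<n})"
    using assms by (auto simp: cyclic_dist_def)
  then have "card {k. k < n \<and> cyclic_dist n j k \<le> int b} \<le>
      card ({k. k < n \<and> \<bar>int j - int k\<bar> \<le> int b} \<union> ({..b} \<union> {n - b..<n}))"
    by (intro card_mono) auto
  also have "\<dots> \<le> card {k. k < n \<and> \<bar>int j - int k\<bar> \<le> int b} + (card {..b} + card {n - b..<n})"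
    by (intro order_trans[OF card_Un_le] add_left_mono card_Un_le)
  also have "\<dots> \<le> (2 * b + 1) + ((b + 1) + b)"
    by (intro add_mono card_band_le) auto
  finally show ?thesis by simp
qed

text \<open>The count 4 b + 2 is at most 3 times 2 b once b n \<ge> 1, which gives the constant 3.
  Periodic bands of proportional growth have the same normalisation and are covered as well.\<close>

lemma slow_scale:
  assumes "filterlim b at_top sequentially"
  shows "(\<lambda>n. 1 / sqrt (2 * real (b n))) \<longlonglongrightarrow> 0"
    and "(\<And>n j. j < n \<Longrightarrow> card {k. k < n \<and> N n j k} \<le> 4 * b n + 2) \<Longrightarrow>
      \<forall>\<^sub>F n in sequentially. \<forall>j<n. (1 / sqrt (2 * real (b n)))\<^sup>2 * real (card {k. k < n \<and> N n j k}) \<le> 3"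
proof -
  have "filterlim (\<lambda>n. real (b n)) at_top sequentially"
    by (rule filterlim_compose[OF filterlim_real_sequentially assms])
  then show "(\<lambda>n. 1 / sqrt (2 * real (b n))) \<longlonglongrightarrow> 0"
    by (intro tendsto_divide_0[OF tendsto_const] filterlim_at_top_imp_at_infinity
      filterlim_compose[OF sqrt_at_top] filterlim_tendsto_pos_mult_at_top[OF tendsto_const]) auto
  assume card: "\<And>n j. j < n \<Longrightarrow> card {k. k < n \<and> N n j k} \<le> 4 * b n + 2"
  have "\<forall>\<^sub>F n in sequentially. 0 < b n"
    using assms by (simp add: filterlim_at_top flip: Suc_le_eq)
  then show "\<forall>\<^sub>F n in sequentially. \<forall>j<n. (1 / sqrt (2 * real (b n)))\<^sup>2 * real (card {k. k < n \<and> N n j k}) \<le> 3"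
  proof eventually_elim
    case (elim n)
    show ?case
    proof (intro allI impI)
      fix j assume "j < n"
      then have "real (card {k. k < n \<and> N n j k}) \<le> real (4 * b n + 2)"
        using card by (intro of_nat_mono) auto
      also have "\<dots> \<le> 3 * (2 * real (b n))" using elim by simp
      finally show "(1 / sqrt (2 * real (b n)))\<^sup>2 * real (card {k. k < n \<and> N n j k}) \<le> 3"
        using elim by (simp add: power_divide field_simps)
    qed
  qed
qed

text \<open>An interior row is at distance of order n from both ends of the matrix, while the width
  is o(n).\<close>

lemma slow_window:
  assumes "slow_growth b" "0 < x" "x < 1" "(\<lambda>n. real (J n) / real n) \<longlonglongrightarrow> x"
  shows "\<forall>\<^sub>F n in sequentially. b n \<le> J n \<and> J n + b n < n"
proof -
  have b: "(\<lambda>n. real (b n) / real n) \<longlonglongrightarrow> 0"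
    using assms(1) by (simp add: slow_growth_def smalloD_tendsto)
  have "\<forall>\<^sub>F n in sequentially. real (J n) / real n - real (b n) / real n > 0"
    using order_tendstoD(1)[OF tendsto_diff[OF assms(4) b], of 0] assms(2) by simp
  moreover have "\<forall>\<^sub>F n in sequentially. real (J n) / real n + real (b n) / real n < 1"
    using order_tendstoD(2)[OF tendsto_add[OF assms(4) b], of 1] assms(3) by simp
  ultimately show ?thesis
    using eventually_gt_at_top[of 0]
    by eventually_elim (auto simp: field_simps simp flip: of_nat_add)
qed

text \<open>Around an interior row the window stays inside the matrix, and there the cyclic and the
  ordinary band coincide.\<close>

lemma band_profile_slow:
  assumes "slow_growth b"
  shows "band_profile (\<lambda>n. 1 / sqrt (2 * real (b n))) (\<lambda>n j k. \<bar>int j - int k\<bar> \<le> int (b n)) (\<lambda>f. f)"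
    and "band_profile (\<lambda>n. 1 / sqrt (2 * real (b n))) (\<lambda>n j k. cyclic_dist n j k \<le> int (b n)) (\<lambda>f. f)"
proof -
  have b: "filterlim b at_top sequentially" "(\<lambda>n. real (b n) / real n) \<longlonglongrightarrow> 0"
    using assms by (simp_all add: slow_growth_def smalloD_tendsto)
  have "card {k. k < n \<and> \<bar>int j - int k\<bar> \<le> int (b n)} \<le> 4 * b n + 2" for n j
    using card_band_le[of n j "b n"] by linarith
  from slow_scale(2)[OF b(1) this]
  have deg1: "\<forall>\<^sub>F n in sequentially. \<forall>j<n. (1 / sqrt (2 * real (b n)))\<^sup>2 *
      real (card {k. k < n \<and> \<bar>int j - int k\<bar> \<le> int (b n)}) \<le> 3" .
  have deg2: "\<forall>\<^sub>F n in sequentially. \<forall>j<n. (1 / sqrt (2 * real (b n)))\<^sup>2 *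
      real (card {k. k < n \<and> cyclic_dist n j k \<le> int (b n)}) \<le> 3"
    by (rule slow_scale(2)[OF b(1) card_cyclic_band_le])
  have "limit_operator (\<lambda>n j k. (1 / sqrt (2 * real (b n)))\<^sup>2 * of_bool (\<bar>int j - int k\<bar> \<le> int (b n))) (\<lambda>f. f)"
  proof (rule limit_operator_local[OF b deg1])
    fix x and J :: "nat \<Rightarrow> nat" assume "0 < x" "x < 1" "(\<lambda>n. real (J n) / real n) \<longlonglongrightarrow> x"
    from slow_window[OF assms this]
    show "\<forall>\<^sub>F n in sequentially. b n \<le> J n \<and>
        {k. k < n \<and> \<bar>int (J n) - int k\<bar> \<le> int (b n)} = {J n - b n..J n + b n}"
      by eventually_elim auto
  qed
  then show "band_profile (\<lambda>n. 1 / sqrt (2 * real (b n))) (\<lambda>n j k. \<bar>int j - int k\<bar> \<le> int (b n)) (\<lambda>f. f)"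
    unfolding band_profile_def using slow_scale(1)[OF b(1)] deg1
    by (auto intro: exI[of _ 3])
  have "limit_operator (\<lambda>n j k. (1 / sqrt (2 * real (b n)))\<^sup>2 * of_bool (cyclic_dist n j k \<le> int (b n))) (\<lambda>f. f)"
  proof (rule limit_operator_local[OF b deg2])
    fix x and J :: "nat \<Rightarrow> nat" assume "0 < x" "x < 1" "(\<lambda>n. real (J n) / real n) \<longlonglongrightarrow> x"
    from slow_window[OF assms this]
    show "\<forall>\<^sub>F n in sequentially. b n \<le> J n \<and>
        {k. k < n \<and> cyclic_dist n (J n) k \<le> int (b n)} = {J n - b n..J n + b n}"
      by eventually_elim (auto simp: cyclic_dist_def)
  qed
  then show "band_profile (\<lambda>n. 1 / sqrt (2 * real (b n))) (\<lambda>n j k. cyclic_dist n j k \<le> int (b n)) (\<lambda>f. f)"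
    unfolding band_profile_def using slow_scale(1)[OF b(1)] deg2
    by (auto intro: exI[of _ 3] simp: cyclic_dist_def abs_minus_commute)
qed

lemma AE_not_eq_finite: "finite A \<Longrightarrow> AE y in lborel. (y :: real) \<notin> A"
  by (rule AE_not_in) (simp add: finite_imp_null_set_lborel)

lemma eventually_le_iff_limit:
  fixes u :: "nat \<Rightarrow> int" and b :: "nat \<Rightarrow> nat"
  assumes "(\<lambda>n. of_int (u n) / real n) \<longlonglongrightarrow> d" "(\<lambda>n. real (b n) / real n) \<longlonglongrightarrow> c" "d \<noteq> c"
  shows "\<forall>\<^sub>F n in sequentially. (u n \<le> int (b n)) = (d \<le> c)"
proof -
  have lim: "(\<lambda>n. of_int (u n) / real n - real (b n) / real n) \<longlonglongrightarrow> d - c"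
    by (intro tendsto_diff assms)
  show ?thesis
  proof (cases "d < c")
    case True
    have "\<forall>\<^sub>F n in sequentially. of_int (u n) / real n - real (b n) / real n < 0"
      using order_tendstoD(2)[OF lim, of 0] True by simp
    then show ?thesis using eventually_gt_at_top[of 0]
    proof eventually_elim
      case (elim n)
      then have "of_int (u n) < real (b n)" by (simp add: field_simps)
      then show ?case using True by linarith
    qed
  next
    case False
    then have "c < d" using assms(3) by simp
    have "\<forall>\<^sub>F n in sequentially. of_int (u n) / real n - real (b n) / real n > 0"
      using order_tendstoD(1)[OF lim, of 0] \<open>c < d\<close> by simp
    then show ?thesis using eventually_gt_at_top[of 0]
    proof eventually_elim
      case (elim n)
      then have "of_int (u n) > real (b n)" by (simp add: field_simps)
      then show ?case using \<open>c < d\<close> by linarith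
    qed
  qed
qed

lemma abs_diff_average_tendsto:
  assumes "(\<lambda>n. real (J n) / real n) \<longlonglongrightarrow> x" "(\<lambda>n. real (k n) / real n) \<longlonglongrightarrow> y"
  shows "(\<lambda>n. of_int \<bar>int (J n) - int (k n)\<bar> / real n) \<longlonglongrightarrow> \<bar>x - y\<bar>"
proof -
  have "of_int \<bar>int (J n) - int (k n)\<bar> / real n = \<bar>real (J n) / real n - real (k n) / real n\<bar>" for n
    by (simp add: abs_divide flip: diff_divide_distrib)
  then show ?thesis using tendsto_rabs[OF tendsto_diff[OF assms]] by simp
qed

lemma band_profile_proportional:
  assumes "proportional_growth b c"
  shows "band_profile (\<lambda>n. 1 / (sqrt (2 * c - c\<^sup>2) * sqrt (real n)))
    (\<lambda>n j k. \<bar>int j - int k\<bar> \<le> int (b n))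
    (\<lambda>f x. 1 / (2 * c - c\<^sup>2) * unit_integral (\<lambda>y. of_bool (\<bar>x - y\<bar> \<le> c) * f y))"
proof -
  have c: "0 < c" "c \<le> 1" and b: "(\<lambda>n. real (b n) / real n) \<longlonglongrightarrow> c"
    using assms by (auto simp: proportional_growth_def)
  \<comment> \<open>2 c - c^2 = 1 - (1 - c)^2 is the area of the band |x - y| \<le> c in the unit
    square.\<close>
  define \<kappa> where "\<kappa> = 2 * c - c\<^sup>2"
  have "c * c \<le> c * 1" using c by (intro mult_left_mono) auto
  then have \<kappa>: "0 < \<kappa>" using c by (simp add: \<kappa>_def power2_eq_square)
  have sq: "(1 / (sqrt \<kappa> * sqrt (real n)))\<^sup>2 = 1 / (\<kappa> * real n)" for n
    using \<kappa> by (simp add: power_divide power_mult_distrib)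
  have deg: "\<forall>\<^sub>F n in sequentially. \<forall>j<n. (1 / (sqrt \<kappa> * sqrt (real n)))\<^sup>2 *
      real (card {k. k < n \<and> \<bar>int j - int k\<bar> \<le> int (b n)}) \<le> 1 / \<kappa>"
    using eventually_gt_at_top[of 0]
  proof eventually_elim
    case (elim n)
    show ?case
    proof (intro allI impI)
      fix j
      have "card {k. k < n \<and> \<bar>int j - int k\<bar> \<le> int (b n)} \<le> card {..<n}" by (intro card_mono) auto
      then have "real (card {k. k < n \<and> \<bar>int j - int k\<bar> \<le> int (b n)}) \<le> real n" by simp
      then show "(1 / (sqrt \<kappa> * sqrt (real n)))\<^sup>2 *
          real (card {k. k < n \<and> \<bar>int j - int k\<bar> \<le> int (b n)}) \<le> 1 / \<kappa>"
        unfolding sq using elim \<kappa> by (simp add: field_simps)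
    qed
  qed
  have "limit_operator (\<lambda>n j k. (1 / (sqrt \<kappa> * sqrt (real n)))\<^sup>2 * of_bool (\<bar>int j - int k\<bar> \<le> int (b n)))
    (\<lambda>f x. 1 / \<kappa> * unit_integral (\<lambda>y. of_bool (\<bar>x - y\<bar> \<le> c) * f y))"
  proof (rule limit_operator_kernel[OF _ deg])
    have "\<forall>\<^sub>F n in sequentially. 1 / \<kappa> = real n * (1 / (sqrt \<kappa> * sqrt (real n)))\<^sup>2"
      using eventually_gt_at_top[of 0] unfolding sq by eventually_elim simp
    then show "(\<lambda>n. real n * (1 / (sqrt \<kappa> * sqrt (real n)))\<^sup>2) \<longlonglongrightarrow> 1 / \<kappa>"
      by (rule Lim_transform_eventually[OF tendsto_const])
    show "(\<lambda>y. of_bool (\<bar>x - y\<bar> \<le> c) :: real) \<in> borel_measurable borel" for x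
      unfolding of_bool_def by measurable
    fix x :: real and J assume J: "(\<lambda>n. real (J n) / real n) \<longlonglongrightarrow> x"
    \<comment> \<open>The indicator can fluctuate only on the two edges of the band, a null
      set.\<close>
    have "AE y in lborel. y \<notin> {x - c, x + c}" by (rule AE_not_eq_finite) simp
    then show "AE y in lborel. \<forall>k. (\<lambda>n. real (k n) / real n) \<longlonglongrightarrow> y \<longrightarrow>
        (\<forall>\<^sub>F n in sequentially. (\<bar>int (J n) - int (k n)\<bar> \<le> int (b n)) = (\<bar>x - y\<bar> \<le> c))"
    proof (eventually_elim, intro allI impI)
      fix y k assume "y \<notin> {x - c, x + c}" and k: "(\<lambda>n. real (k n) / real n) \<longlonglongrightarrow> y"
      then have "\<bar>x - y\<bar> \<noteq> c" by auto
      then show "\<forall>\<^sub>F n in sequentially. (\<bar>int (J n) - int (k n)\<bar> \<le> int (b n)) = (\<bar>x - y\<bar> \<le> c)"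
        by (rule eventually_le_iff_limit[OF abs_diff_average_tendsto[OF J k] b])
    qed
  qed
  moreover have "(\<lambda>n. 1 / (sqrt \<kappa> * sqrt (real n))) \<longlonglongrightarrow> 0"
    using \<kappa> by (intro tendsto_divide_0[OF tendsto_const] filterlim_at_top_imp_at_infinity
      filterlim_tendsto_pos_mult_at_top[OF tendsto_const] filterlim_compose[OF sqrt_at_top]
      filterlim_real_sequentially) auto
  moreover have "0 \<le> 1 / \<kappa>" using \<kappa> by simp
  ultimately show ?thesis
    unfolding band_profile_def \<kappa>_def[symmetric] using deg \<kappa>
    by (intro conjI exI[of _ "1 / \<kappa>"]) (auto simp: abs_minus_commute)
qed

text \<open>The constant 1 / (2 c) is the limit of n / (2 b n). It ignores that the cyclic distance
  saturates at n / 2, so the limiting row mass is below 1 when c exceeds 1/2.\<close>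

lemma band_profile_periodic:
  assumes "proportional_growth b c"
  shows "band_profile (\<lambda>n. 1 / sqrt (2 * real (b n))) (\<lambda>n j k. cyclic_dist n j k \<le> int (b n))
    (\<lambda>f x. 1 / (2 * c) * unit_integral (\<lambda>y. of_bool (min \<bar>x - y\<bar> (1 - \<bar>x - y\<bar>) \<le> c) * f y))"
proof -
  have c: "0 < c" "c \<le> 1" and b: "(\<lambda>n. real (b n) / real n) \<longlonglongrightarrow> c"
    using assms by (auto simp: proportional_growth_def)
  have "filterlim (\<lambda>n. real (b n) / real n * real n) at_top sequentially"
    by (rule filterlim_tendsto_pos_mult_at_top[OF b c(1) filterlim_real_sequentially])
  moreover have "\<forall>\<^sub>F n in sequentially. real (b n) / real n * real n = real (b n)"
    using eventually_gt_at_top[of 0] by eventually_elim simp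
  ultimately have "filterlim (\<lambda>n. real (b n)) at_top sequentially"
    by (rule filterlim_cong[THEN iffD1, OF refl refl, rotated])
  then have top: "filterlim b at_top sequentially"
    by (simp add: filterlim_sequentially_iff_filterlim_real)
  have deg: "\<forall>\<^sub>F n in sequentially. \<forall>j<n. (1 / sqrt (2 * real (b n)))\<^sup>2 *
      real (card {k. k < n \<and> cyclic_dist n j k \<le> int (b n)}) \<le> 3"
    by (rule slow_scale(2)[OF top card_cyclic_band_le])
  have "limit_operator (\<lambda>n j k. (1 / sqrt (2 * real (b n)))\<^sup>2 * of_bool (cyclic_dist n j k \<le> int (b n)))
    (\<lambda>f x. 1 / (2 * c) * unit_integral (\<lambda>y. of_bool (min \<bar>x - y\<bar> (1 - \<bar>x - y\<bar>) \<le> c) * f y))"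
  proof (rule limit_operator_kernel[OF _ deg])
    have "(\<lambda>n. 1 / (2 * (real (b n) / real n))) \<longlonglongrightarrow> 1 / (2 * c)"
      by (intro tendsto_intros b) (use c in auto)
    moreover have "\<forall>\<^sub>F n in sequentially. 1 / (2 * (real (b n) / real n)) = real n * (1 / sqrt (2 * real (b n)))\<^sup>2"
      using eventually_gt_at_top[of 0] by eventually_elim (simp add: power_divide)
    ultimately show "(\<lambda>n. real n * (1 / sqrt (2 * real (b n)))\<^sup>2) \<longlonglongrightarrow> 1 / (2 * c)"
      by (rule Lim_transform_eventually)
    show "(\<lambda>y. of_bool (min \<bar>x - y\<bar> (1 - \<bar>x - y\<bar>) \<le> c) :: real) \<in> borel_measurable borel" for x
      unfolding of_bool_def by measurable
    fix x :: real and J assume J: "(\<lambda>n. real (J n) / real n) \<longlonglongrightarrow> x"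
    \<comment> \<open>The four edges are the solutions of |x - y| = c and of 1 - |x - y| =
      c.\<close>
    have "AE y in lborel. y \<notin> {x - c, x + c, x - 1 + c, x + 1 - c}" by (rule AE_not_eq_finite) simp
    then show "AE y in lborel. \<forall>k. (\<lambda>n. real (k n) / real n) \<longlonglongrightarrow> y \<longrightarrow>
        (\<forall>\<^sub>F n in sequentially. (cyclic_dist n (J n) (k n) \<le> int (b n)) = (min \<bar>x - y\<bar> (1 - \<bar>x - y\<bar>) \<le> c))"
    proof (eventually_elim, intro allI impI)
      fix y k assume "y \<notin> {x - c, x + c, x - 1 + c, x + 1 - c}" and k: "(\<lambda>n. real (k n) / real n) \<longlonglongrightarrow> y"
      then have neq: "min \<bar>x - y\<bar> (1 - \<bar>x - y\<bar>) \<noteq> c" by (auto simp: min_def)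
      have "(\<lambda>n. min (of_int \<bar>int (J n) - int (k n)\<bar> / real n) (1 - of_int \<bar>int (J n) - int (k n)\<bar> / real n))
          \<longlonglongrightarrow> min \<bar>x - y\<bar> (1 - \<bar>x - y\<bar>)"
        by (intro tendsto_intros abs_diff_average_tendsto J k)
      moreover have "\<forall>\<^sub>F n in sequentially.
          min (of_int \<bar>int (J n) - int (k n)\<bar> / real n) (1 - of_int \<bar>int (J n) - int (k n)\<bar> / real n) =
          of_int (cyclic_dist n (J n) (k n)) / real n"
        using eventually_gt_at_top[of 0]
      proof eventually_elim
        case (elim n)
        define a where "a = \<bar>int (J n) - int (k n)\<bar>"
        have "2 * real_of_int a \<le> real n \<longleftrightarrow> 2 * a \<le> int n" by linarith
        then show ?case
          using elim unfolding cyclic_dist_def a_def[symmetric] by (simp add: min_def field_simps)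
      qed
      ultimately have "(\<lambda>n. of_int (cyclic_dist n (J n) (k n)) / real n) \<longlonglongrightarrow> min \<bar>x - y\<bar> (1 - \<bar>x - y\<bar>)"
        by (rule Lim_transform_eventually)
      then show "\<forall>\<^sub>F n in sequentially. (cyclic_dist n (J n) (k n) \<le> int (b n)) = (min \<bar>x - y\<bar> (1 - \<bar>x - y\<bar>) \<le> c)"
        by (rule eventually_le_iff_limit[OF _ b neq])
    qed
  qed
  then show ?thesis
    unfolding band_profile_def using slow_scale(1)[OF top] deg
    by (auto intro: exI[of _ 3] simp: cyclic_dist_def abs_minus_commute)
qed

section \<open>Expected traces of words\<close>

lemma wigner_entries_of_family:
  assumes "wigner_family M I \<beta> X"
  shows "wigner_entries (M n) I n (X n)"
proof -
  note W = assms[unfolded wigner_family_def]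
  note W1 = W[THEN conjunct1, rule_format]
    and W2 = W[THEN conjunct2, THEN conjunct1, rule_format]
    and W3 = W[THEN conjunct2, THEN conjunct2, THEN conjunct1, rule_format]
    and W4 = W[THEN conjunct2, THEN conjunct2, THEN conjunct2, THEN conjunct1, rule_format]
    and W5 = W[THEN conjunct2, THEN conjunct2, THEN conjunct2, THEN conjunct2, rule_format]
  have ps: "prob_space (M n)" by (rule W1)
  interpret prob_space "M n" by (rule ps)
  show ?thesis
  proof (intro wigner_entries.intro ps wigner_entries_axioms.intro)
    fix i \<omega> a b assume *: "i \<in> I" "\<omega> \<in> space (M n)" "a < n" "b < n"
    then have X: "X n i \<omega> \<in> carrier_mat n n" "mat_adjoint (X n i \<omega>) = X n i \<omega>"
      using W2[OF *(1,2)] by simp_all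
    have "X n i \<omega> $$ (b, a) = mat_adjoint (X n i \<omega>) $$ (b, a)" by (simp add: X(2))
    also have "\<dots> = cnj (X n i \<omega> $$ (a, b))"
      using X(1) * by (simp add: mat_adjoint_def mat_of_rows_def)
    finally show "X n i \<omega> $$ (b, a) = cnj (X n i \<omega> $$ (a, b))" .
  next
    show "indep_vars (\<lambda>_. borel) (\<lambda>(i, j, k) \<omega>. X n i \<omega> $$ (j, k)) {(i, j, k). i \<in> I \<and> j \<le> k \<and> k < n}"
      by (rule W3)
  next
    fix i j k assume "i \<in> I" "j < k" "k < n"
    then show "(\<integral>\<omega>. X n i \<omega> $$ (j, k) \<partial>M n) = 0" "(\<integral>\<omega>. (cmod (X n i \<omega> $$ (j, k)))\<^sup>2 \<partial>M n) = 1"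
      by (simp_all add: W4)
  next
    fix i j k l assume *: "i \<in> I" "j \<le> k" "k < n"
    have "finite {i} \<and> {i} \<subseteq> I" using * by simp
    then show "integrable (M n) (\<lambda>\<omega>. cmod (X n i \<omega> $$ (j, k)) ^ l)"
      using W5[of "{i}" l] * by auto
  qed
qed

text \<open>Eventually the expected diagonal entry differs from the discrete moment
  \<open>T\<close>, uniformly in the row, by at most a constant times the sum of the scales; the
  average of \<open>T\<close> converges because its covariance operators do.\<close>

lemma limit_of_word_moments:
  fixes \<sigma> :: "'i \<Rightarrow> nat \<Rightarrow> real"
  assumes wigner: "wigner_family M I \<beta> X"
    and profile: "\<And>i. i \<in> I \<Longrightarrow> band_profile (\<sigma> i) (N i) (\<eta> i)"
    and Y: "\<And>n i \<omega>. i \<in> I \<Longrightarrow> Y n i \<omega> \<in> carrier_mat n n"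
    "\<And>n i \<omega> a b. i \<in> I \<Longrightarrow> a < n \<Longrightarrow> b < n \<Longrightarrow>
      Y n i \<omega> $$ (a, b) = of_real (\<sigma> i n * of_bool (N i n a b)) * X n i \<omega> $$ (a, b)"
    and w: "set w \<subseteq> I"
  shows "j < n \<Longrightarrow> integrable (M n) (\<lambda>\<omega>. foldr (\<lambda>i B. Y n i \<omega> * B) w (1\<^sub>m n) $$ (j, j))"
    and "(\<lambda>n. (\<Sum>j<n. \<integral>\<omega>. foldr (\<lambda>i B. Y n i \<omega> * B) w (1\<^sub>m n) $$ (j, j) \<partial>M n) / of_nat n)
      \<longlonglongrightarrow> of_real (unit_integral (ov_moment \<eta> w))"
proof -
  show "j < n \<Longrightarrow> integrable (M n) (\<lambda>\<omega>. foldr (\<lambda>i B. Y n i \<omega> * B) w (1\<^sub>m n) $$ (j, j))"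
    by (rule wigner_entries.band_word_expectation(1)[OF wigner_entries_of_family[OF wigner] w _ Y])
  define T where "T = (\<lambda>n. ov_moment (\<lambda>i f a. \<Sum>b<n. (\<sigma> i n)\<^sup>2 * of_bool (N i n a b) * f b) w)"
  have "interior_limit T (ov_moment \<eta> w)"
    unfolding T_def
  proof (rule interior_limit_ov_moment)
    fix i assume "i \<in> set w"
    then show "limit_operator (\<lambda>n a b. (\<sigma> i n)\<^sup>2 * of_bool (N i n a b)) (\<eta> i)"
      using profile[of i] w unfolding band_profile_def by blast
  qed
  then have T: "(\<lambda>n. (\<Sum>j<n. T n j) / real n) \<longlonglongrightarrow> unit_integral (ov_moment \<eta> w)"
    by (rule interior_limit_average)
  have "\<exists>C. \<forall>n. \<forall>i\<in>set w. \<forall>j k. j \<le> k \<and> k < n \<longrightarrow>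
      integrable (M n) (\<lambda>\<omega>. cmod (X n i \<omega> $$ (j, k)) ^ length w) \<and>
      (\<integral>\<omega>. cmod (X n i \<omega> $$ (j, k)) ^ length w \<partial>M n) \<le> C"
    using wigner[unfolded wigner_family_def, THEN conjunct2, THEN conjunct2, THEN conjunct2, THEN conjunct2,
        rule_format, of "set w" "length w"] w by (simp only: finite_set simp_thms)
  then obtain C0 where "\<forall>n. \<forall>i\<in>set w. \<forall>j k. j \<le> k \<and> k < n \<longrightarrow>
      integrable (M n) (\<lambda>\<omega>. cmod (X n i \<omega> $$ (j, k)) ^ length w) \<and>
      (\<integral>\<omega>. cmod (X n i \<omega> $$ (j, k)) ^ length w \<partial>M n) \<le> C0" ..
  then have C0: "\<And>n i j k. i \<in> set w \<Longrightarrow> j \<le> k \<Longrightarrow> k < n \<Longrightarrow>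
      (\<integral>\<omega>. cmod (X n i \<omega> $$ (j, k)) ^ length w \<partial>M n) \<le> C0" by simp
  define C where "C = 1 + length w * \<bar>C0\<bar>"
  have C: "0 \<le> C" by (simp add: C_def)
  \<comment> \<open>The sum dominates every scale that occurs in the word and still tends to
    0.\<close>
  define \<epsilon> where "\<epsilon> n = (\<Sum>i\<in>set w. \<sigma> i n)" for n
  have \<sigma>0: "0 \<le> \<sigma> i n" if "i \<in> set w" for i n
    using profile[of i] w that unfolding band_profile_def by blast
  have \<sigma>le: "\<sigma> i n \<le> \<epsilon> n" if "i \<in> set w" for i n
    unfolding \<epsilon>_def using \<sigma>0 that by (intro member_le_sum) auto
  have \<epsilon>0: "0 \<le> \<epsilon> n" for n unfolding \<epsilon>_def using \<sigma>0 by (intro sum_nonneg) auto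
  have "(\<lambda>n. \<Sum>i\<in>set w. \<sigma> i n) \<longlonglongrightarrow> (\<Sum>i\<in>set w. 0)"
  proof (rule tendsto_sum)
    fix i assume "i \<in> set w"
    then show "\<sigma> i \<longlonglongrightarrow> 0" using profile[of i] w unfolding band_profile_def by blast
  qed
  then have \<epsilon>: "\<epsilon> \<longlonglongrightarrow> 0" unfolding \<epsilon>_def[abs_def] by simp
  have "\<exists>D\<ge>0. \<forall>\<^sub>F n in sequentially. \<forall>i\<in>set w. \<forall>j<n. (\<sigma> i n)\<^sup>2 * real (card {k. k < n \<and> N i n j k}) \<le> D"
  proof -
    have "\<forall>i\<in>set w. \<exists>D\<ge>0. \<forall>\<^sub>F n in sequentially. \<forall>j<n. (\<sigma> i n)\<^sup>2 * real (card {k. k < n \<and> N i n j k}) \<le> D"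
    proof
      fix i assume "i \<in> set w"
      then show "\<exists>D\<ge>0. \<forall>\<^sub>F n in sequentially. \<forall>j<n. (\<sigma> i n)\<^sup>2 * real (card {k. k < n \<and> N i n j k}) \<le> D"
        using profile[of i] w unfolding band_profile_def by blast
    qed
    from bchoice[OF this] obtain D where D': "\<forall>i\<in>set w. 0 \<le> D i \<and>
      (\<forall>\<^sub>F n in sequentially. \<forall>j<n. (\<sigma> i n)\<^sup>2 * real (card {k. k < n \<and> N i n j k}) \<le> D i)" ..
    note D = D'[rule_format, THEN conjunct1] D'[rule_format, THEN conjunct2]
    have "\<forall>\<^sub>F n in sequentially. \<forall>i\<in>set w. \<forall>j<n. (\<sigma> i n)\<^sup>2 * real (card {k. k < n \<and> N i n j k}) \<le> D i"
      using D(2) by (intro eventually_ball_finite ballI) simp_all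
    then have "\<forall>\<^sub>F n in sequentially. \<forall>i\<in>set w. \<forall>j<n. (\<sigma> i n)\<^sup>2 * real (card {k. k < n \<and> N i n j k}) \<le> sum D (set w)"
    proof (rule eventually_mono, intro ballI allI impI)
      fix n i j
      assume *: "\<forall>i\<in>set w. \<forall>j<n. (\<sigma> i n)\<^sup>2 * real (card {k. k < n \<and> N i n j k}) \<le> D i" "i \<in> set w" "j < n"
      have "D i \<le> sum D (set w)" using D(1) *(2) by (intro member_le_sum) auto
      with * show "(\<sigma> i n)\<^sup>2 * real (card {k. k < n \<and> N i n j k}) \<le> sum D (set w)" by force
    qed
    moreover have "0 \<le> sum D (set w)" using D(1) by (intro sum_nonneg) simp
    ultimately show ?thesis by blast
  qed
  then obtain D where "0 \<le> D \<and> (\<forall>\<^sub>F n in sequentially. \<forall>i\<in>set w. \<forall>j<n.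
      (\<sigma> i n)\<^sup>2 * real (card {k. k < n \<and> N i n j k}) \<le> D)" ..
  note D = this[THEN conjunct1] this[THEN conjunct2]
  define E where "E n j = (\<integral>\<omega>. foldr (\<lambda>i B. Y n i \<omega> * B) w (1\<^sub>m n) $$ (j, j) \<partial>M n)" for n j
  define K where "K = (C + fact (length w)) * (D + 1 + length w) ^ length w"
  have "\<forall>\<^sub>F n in sequentially. \<epsilon> n \<le> 1"
    using order_tendstoD(2)[OF \<epsilon>, of 1] by (auto elim: eventually_mono)
  then have bound: "\<forall>\<^sub>F n in sequentially. cmod ((\<Sum>j<n. E n j) / of_nat n - of_real ((\<Sum>j<n. T n j) / real n)) \<le> K * \<epsilon> n"
    using D(2) eventually_gt_at_top[of 0]
  proof eventually_elim
    case (elim n)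
    interpret wigner_entries "M n" I n "X n" by (rule wigner_entries_of_family[OF wigner])
    have sym: "N i n a b \<and> N i n b a \<longleftrightarrow> N i n a b" if "i \<in> set w" for i a b
      using profile[of i] w that unfolding band_profile_def by blast
    have "cmod (E n j - of_real (T n j)) \<le> K * \<epsilon> n" if j: "j < n" for j
    proof -
      \<comment> \<open>The band is symmetric, so both orientations of an edge lie in it together.
        The identity has to be carried through the recursion, since it holds only for the letters of
        \<open>w\<close>.\<close>
      have T_eq: "T n j = ov_moment (\<lambda>i f a. \<Sum>b<n. (\<sigma> i n)\<^sup>2 * of_bool (N i n a b \<and> N i n b a) * f b) w j"
      proof -
        have "ov_moment (\<lambda>i f a. \<Sum>b<n. (\<sigma> i n)\<^sup>2 * of_bool (N i n a b) * f b) v =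
            ov_moment (\<lambda>i f a. \<Sum>b<n. (\<sigma> i n)\<^sup>2 * of_bool (N i n a b \<and> N i n b a) * f b) v"
          if "set v \<subseteq> set w" for v
          using that
        proof (induction "length v" arbitrary: v rule: less_induct)
          case less
          show ?case
          proof (cases v)
            case (Cons i v')
            have "set (take p v') \<subseteq> set w" "set (drop p v') \<subseteq> set w" for p
              using less.prems set_take_subset[of p v'] set_drop_subset[of p v'] unfolding Cons by auto
            then show ?thesis
              using less.hyps less.prems sym[of i] unfolding Cons by (auto intro!: ext sum.cong)
          qed simp
        qed
        then show ?thesis unfolding T_def by simp
      qed
      have "E n j = (\<Sum>W\<in>walks n (length w). of_bool (last (j # W) = j) *
          (of_real (step_prod (\<lambda>i a b. \<sigma> i n * of_bool (N i n a b)) j w W) * walk_expectation j w W))"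
        unfolding E_def by (rule band_word_expectation(2)[OF w j Y])
      then show ?thesis
        unfolding T_eq K_def
      proof (simp only:, intro sum_closed_walks_approx[OF j D(1) C])
        fix W assume W: "W \<in> walks n (length w)"
        show "cmod (walk_expectation j w W) \<le> C"
          unfolding C_def
          by (rule walk_expectation_bound[OF w j W order_trans[OF C0 abs_ge_self] abs_ge_zero])
        show "\<not> paired j w W \<Longrightarrow> walk_expectation j w W = 0"
          by (rule walk_expectation_unpaired[OF w j W])
        show "tree_walk j w W \<Longrightarrow> walk_expectation j w W = 1"
          by (rule walk_expectation_tree[OF w j W])
      qed (use \<sigma>0 \<sigma>le \<epsilon>0 elim in auto)
    qed
    then have "cmod (\<Sum>j<n. E n j - of_real (T n j)) \<le> (\<Sum>j<n. K * \<epsilon> n)"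
      by (intro sum_norm_le) auto
    then have "cmod ((\<Sum>j<n. E n j - of_real (T n j)) / of_nat n) \<le> K * \<epsilon> n"
      using elim(3) by (simp add: norm_divide field_simps)
    moreover have "(\<Sum>j<n. E n j - of_real (T n j)) / of_nat n = (\<Sum>j<n. E n j) / of_nat n - of_real ((\<Sum>j<n. T n j) / real n)"
      by (simp add: sum_subtractf diff_divide_distrib)
    ultimately show ?case by simp
  qed
  have "(\<lambda>n. (\<Sum>j<n. E n j) / of_nat n - of_real ((\<Sum>j<n. T n j) / real n)) \<longlonglongrightarrow> 0"
    by (rule Lim_null_comparison[OF bound]) (use tendsto_mult[OF tendsto_const[of K] \<epsilon>] in simp)
  from tendsto_add[OF this tendsto_of_real[OF T]]
  show "(\<lambda>n. (\<Sum>j<n. \<integral>\<omega>. foldr (\<lambda>i B. Y n i \<omega> * B) w (1\<^sub>m n) $$ (j, j) \<partial>M n) / of_nat n)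
      \<longlonglongrightarrow> of_real (unit_integral (ov_moment \<eta> w))"
    by (simp add: E_def)
qed

section \<open>Functionals on non-commutative polynomials and freeness\<close>

abbreviation nc_mono :: "complex \<Rightarrow> 'i list \<Rightarrow> 'i nc_poly" where
  "nc_mono z w \<equiv> Poly_Mapping.single (NC_Word w) z"

lemma nc_mono_mult: "nc_mono z u * nc_mono z' v = nc_mono (z * z') (u @ v)"
  by (simp add: mult_single plus_nc_word_def)

lemma nc_mono_one: "nc_mono 1 [] = 1"
  by (metis single_one zero_nc_word_def)

lemma nc_poly_sum: "(p :: 'i nc_poly) = (\<Sum>w\<in>Poly_Mapping.keys p. nc_mono (Poly_Mapping.lookup p w) (letters w))"
proof (rule poly_mapping_eqI)
  fix w
  have "Poly_Mapping.lookup (\<Sum>w\<in>Poly_Mapping.keys p. nc_mono (Poly_Mapping.lookup p w) (letters w)) w =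
      (\<Sum>v\<in>Poly_Mapping.keys p. if v = w then Poly_Mapping.lookup p v else 0)"
    unfolding lookup_sum by (intro sum.cong refl) (simp add: lookup_single when_def)
  then show "Poly_Mapping.lookup p w =
      Poly_Mapping.lookup (\<Sum>w\<in>Poly_Mapping.keys p. nc_mono (Poly_Mapping.lookup p w) (letters w)) w"
    by (simp add: in_keys_iff)
qed

lemma nc_poly_induct [case_names zero mono add]:
  assumes "P 0" "\<And>z w. P (nc_mono z w)" "\<And>p q. P p \<Longrightarrow> P q \<Longrightarrow> P (p + q)"
  shows "P (p :: 'i nc_poly)"
proof -
  have "P (\<Sum>w\<in>S. nc_mono (f w) (letters w))" if "finite S" for S and f :: "'i nc_word \<Rightarrow> complex"
    using that
  proof (induction S)
    case (insert x S)
    then show ?case using assms(3)[OF assms(2)[where z = "f x" and w = "letters x"]] by simp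
  qed (simp add: assms(1))
  then show ?thesis by (subst nc_poly_sum) simp
qed

text \<open>A product with a constant polynomial, so that the algebra laws reduce to ring laws and
  to the centrality of constants.\<close>

definition nc_smult :: "complex \<Rightarrow> 'i nc_poly \<Rightarrow> 'i nc_poly" where
  "nc_smult z p = nc_mono z [] * p"

lemma nc_smult_mono [simp]: "nc_smult z (nc_mono z' w) = nc_mono (z * z') w"
  by (simp add: nc_smult_def nc_mono_mult)

lemma nc_smult_add_right: "nc_smult z (p + q) = nc_smult z p + nc_smult z q"
  by (simp add: nc_smult_def distrib_left)

lemma nc_smult_zero_right [simp]: "nc_smult z 0 = 0"
  by (simp add: nc_smult_def)

lemma nc_smult_mult_left: "nc_smult z p * q = nc_smult z (p * q)"
  by (simp add: nc_smult_def mult.assoc)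

lemma nc_smult_mult_right: "p * nc_smult z q = nc_smult z (p * q)"
proof -
  have "p * nc_mono z [] = nc_mono z [] * p"
    by (induction p rule: nc_poly_induct) (simp_all add: nc_mono_mult distrib_left distrib_right mult.commute)
  then show ?thesis by (simp add: nc_smult_def flip: mult.assoc)
qed

lemma nc_scalar_mult: "nc_mono z [] * p = nc_smult z p" "p * nc_mono z [] = nc_smult z p"
proof -
  show "nc_mono z [] * p = nc_smult z p" by (simp add: nc_smult_def)
  have "nc_mono z [] = nc_smult z (1 :: 'a nc_poly)" by (simp add: nc_smult_def)
  then show "p * nc_mono z [] = nc_smult z p" by (simp only: nc_smult_mult_right mult_1_right)
qed

lemmas nc_scalar_simps = nc_scalar_mult nc_smult_mult_left nc_smult_mult_right

lemma nc_smult_vector_space: "vector_space (nc_smult :: complex \<Rightarrow> 'i nc_poly \<Rightarrow> 'i nc_poly)"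
proof
  fix a b :: complex and x y :: "'i nc_poly"
  show "nc_smult a (x + y) = nc_smult a x + nc_smult a y" by (rule nc_smult_add_right)
  show "nc_smult (a + b) x = nc_smult a x + nc_smult b x"
    by (simp add: nc_smult_def single_add distrib_right)
  show "nc_smult a (nc_smult b x) = nc_smult (a * b) x"
    by (simp add: nc_smult_def nc_mono_mult flip: mult.assoc)
  show "nc_smult 1 x = x" by (simp add: nc_smult_def nc_mono_one)
qed

text \<open>The indeterminates are to be self-adjoint, so the involution reverses words and
  conjugates coefficients.\<close>

definition nc_star :: "'i nc_poly \<Rightarrow> 'i nc_poly" where
  "nc_star p = (\<Sum>w\<in>Poly_Mapping.keys p. nc_mono (cnj (Poly_Mapping.lookup p w)) (rev (letters w)))"

lemma sum_keys_superset:
  assumes "finite S" "Poly_Mapping.keys p \<subseteq> S" "\<And>w. f w 0 = 0"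
  shows "(\<Sum>w\<in>Poly_Mapping.keys p. f w (Poly_Mapping.lookup p w)) =
    (\<Sum>w\<in>S. f w (Poly_Mapping.lookup p w))"
  using assms by (intro sum.mono_neutral_left) (auto simp: in_keys_iff)

lemma sum_keys_add:
  fixes p q :: "'i nc_poly" and f :: "'i nc_word \<Rightarrow> complex \<Rightarrow> 'b::comm_monoid_add"
  assumes "\<And>w. f w 0 = 0" "\<And>w a b. f w (a + b) = f w a + f w b"
  shows "(\<Sum>w\<in>Poly_Mapping.keys (p + q). f w (Poly_Mapping.lookup (p + q) w)) =
    (\<Sum>w\<in>Poly_Mapping.keys p. f w (Poly_Mapping.lookup p w)) +
    (\<Sum>w\<in>Poly_Mapping.keys q. f w (Poly_Mapping.lookup q w))"
proof -
  let ?S = "Poly_Mapping.keys p \<union> Poly_Mapping.keys q"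
  have S: "finite ?S" "Poly_Mapping.keys p \<subseteq> ?S" "Poly_Mapping.keys q \<subseteq> ?S" "Poly_Mapping.keys (p + q) \<subseteq> ?S"
    using keys_add[of p q] by auto
  note sup = sum_keys_superset[where f = f, OF S(1) _ assms(1)]
  show ?thesis
    unfolding sup[OF S(2)] sup[OF S(3)] sup[OF S(4)] by (simp add: lookup_add assms(2) sum.distrib)
qed

lemma nc_star_add: "nc_star (p + q) = nc_star p + nc_star q"
  unfolding nc_star_def
  by (rule sum_keys_add[where f = "\<lambda>w z. nc_mono (cnj z) (rev (letters w))"]) (simp_all add: single_add)

lemma nc_star_mono [simp]: "nc_star (nc_mono z w) = nc_mono (cnj z) (rev w)"
  by (cases "z = 0") (simp_all add: nc_star_def)

lemma nc_star_zero [simp]: "nc_star 0 = 0"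
  by (simp add: nc_star_def)

lemma nc_star_star: "nc_star (nc_star p) = p"
  by (induction p rule: nc_poly_induct) (simp_all add: nc_star_add)

lemma nc_star_mult: "nc_star (p * q) = nc_star q * nc_star p"
proof (induction p rule: nc_poly_induct)
  case (mono z w)
  show ?case
    by (induction q rule: nc_poly_induct) (simp_all add: nc_star_add nc_mono_mult distrib_left distrib_right mult.commute)
qed (simp_all add: nc_star_add distrib_left distrib_right)

lemma nc_star_smult: "nc_star (nc_smult z p) = nc_smult (cnj z) (nc_star p)"
  by (induction p rule: nc_poly_induct) (simp_all add: nc_star_add nc_smult_add_right)

definition nc_functional :: "('i list \<Rightarrow> complex) \<Rightarrow> 'i nc_poly \<Rightarrow> complex" where
  "nc_functional m p = (\<Sum>w\<in>Poly_Mapping.keys p. Poly_Mapping.lookup p w * m (letters w))"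

lemma nc_functional_mono [simp]: "nc_functional m (nc_mono z w) = z * m w"
  by (cases "z = 0") (simp_all add: nc_functional_def)

lemma nc_functional_zero [simp]: "nc_functional m 0 = 0"
  by (simp add: nc_functional_def)

lemma nc_functional_add: "nc_functional m (p + q) = nc_functional m p + nc_functional m q"
  unfolding nc_functional_def
  by (rule sum_keys_add[where f = "\<lambda>w z. z * m (letters w)"]) (simp_all add: distrib_right)

lemma nc_functional_smult: "nc_functional m (nc_smult z p) = z * nc_functional m p"
  by (induction p rule: nc_poly_induct) (simp_all add: nc_functional_add nc_smult_add_right distrib_left)

lemma nc_functional_sum: "nc_functional m (sum f A) = (\<Sum>x\<in>A. nc_functional m (f x))"
  by (induction A rule: infinite_finite_induct) (simp_all add: nc_functional_add)

lemma nc_functional_cong: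
  "nc_vars p \<subseteq> J \<Longrightarrow> (\<And>w. set w \<subseteq> J \<Longrightarrow> m w = m' w) \<Longrightarrow> nc_functional m p = nc_functional m' p"
  unfolding nc_functional_def nc_vars_def by (intro sum.cong refl) (auto simp: UN_subset_iff)

text \<open>Positivity of the state becomes positivity of the Gram matrix with entries
  \<open>m (rev u @ v)\<close>.\<close>

lemma nc_functional_star_mult:
  "nc_functional m (nc_star p * p) = (\<Sum>u\<in>Poly_Mapping.keys p. \<Sum>v\<in>Poly_Mapping.keys p.
     cnj (Poly_Mapping.lookup p u) * Poly_Mapping.lookup p v * m (rev (letters u) @ letters v))"
proof -
  have "nc_star p * p = (\<Sum>u\<in>Poly_Mapping.keys p. nc_mono (cnj (Poly_Mapping.lookup p u)) (rev (letters u))) *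
      (\<Sum>v\<in>Poly_Mapping.keys p. nc_mono (Poly_Mapping.lookup p v) (letters v))"
    using nc_poly_sum[of p] by (simp add: nc_star_def)
  also have "\<dots> = (\<Sum>u\<in>Poly_Mapping.keys p. \<Sum>v\<in>Poly_Mapping.keys p.
      nc_mono (cnj (Poly_Mapping.lookup p u) * Poly_Mapping.lookup p v) (rev (letters u) @ letters v))"
    by (simp add: sum_product nc_mono_mult del: nc_word.collapse)
  finally show ?thesis by (simp add: nc_functional_sum)
qed

lemma prod_list_nc_vars: "prod_list (map (\<lambda>i. nc_mono 1 [i]) w) = nc_mono 1 w"
  by (induction w) (simp_all add: nc_mono_one nc_mono_mult)

text \<open>The limit family will be the family of indeterminates, for which evaluation is the
  identity.\<close>

lemma nc_eval_generators: "nc_eval nc_smult (\<lambda>i. nc_mono 1 [i]) p = p"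
  unfolding nc_eval_def prod_list_nc_vars nc_smult_mono mult_1_right by (rule nc_poly_sum[symmetric])

lemma nc_star_prob_space:
  assumes "m [] = 1" "\<And>p. nc_functional m (nc_star p * p) \<in> \<real>\<^sub>\<ge>\<^sub>0"
  shows "star_prob_space nc_smult nc_star (nc_functional m)"
proof (intro star_prob_space.intro nc_smult_vector_space star_prob_space_axioms.intro)
  have "nc_functional m (nc_mono 1 []) = 1" using assms(1) by simp
  then show "nc_functional m 1 = 1" by (simp add: nc_mono_one)
qed (simp_all add: assms nc_smult_mult_left nc_smult_mult_right nc_star_star nc_star_add nc_star_smult
    nc_star_mult nc_functional_add nc_functional_smult)

lemma unital_subalgebra_vars: "unital_subalgebra nc_smult {p :: 'a nc_poly. nc_vars p \<subseteq> J}"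
  unfolding unital_subalgebra_def
  proof (intro conjI ballI allI; clarify)
    show "x \<in> J" if "x \<in> nc_vars 1" for x :: 'a
      using that by (simp add: nc_vars_def zero_nc_word_def flip: single_one)
    show "i \<in> J" if "nc_vars x \<subseteq> J" "nc_vars y \<subseteq> J" "i \<in> nc_vars (x + y)" for x y :: "'a nc_poly" and i
      using that keys_add[of x y] unfolding nc_vars_def by blast
    show mult: "i \<in> J" if "nc_vars x \<subseteq> J" "nc_vars y \<subseteq> J" "i \<in> nc_vars (x * y)" for x y :: "'a nc_poly" and i
    proof -
      from that(3) obtain w where w: "w \<in> Poly_Mapping.keys (x * y)" "i \<in> set (letters w)"
        by (auto simp: nc_vars_def)
      then obtain u v where "w = u + v" "u \<in> Poly_Mapping.keys x" "v \<in> Poly_Mapping.keys y"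
        using keys_mult[of x y] by blast
      then show ?thesis using w(2) that(1,2) by (auto simp: nc_vars_def plus_nc_word_def)
    qed
    show "i \<in> J" if "nc_vars x \<subseteq> J" "i \<in> nc_vars (nc_smult z x)" for x :: "'a nc_poly" and i z
    proof -
      have "nc_vars (nc_mono z [] :: 'a nc_poly) \<subseteq> J" by (simp add: nc_vars_def)
      then show ?thesis using mult[of "nc_mono z []" x i] that unfolding nc_smult_def by blast
    qed
  qed

lemma nc_vars_generated:
  assumes "p \<in> generated_algebra nc_smult S" "\<And>q. q \<in> S \<Longrightarrow> nc_vars q \<subseteq> J"
  shows "nc_vars p \<subseteq> J"
proof -
  have "generated_algebra nc_smult S \<subseteq> {p. nc_vars p \<subseteq> J}"
    unfolding generated_algebra_def using assms(2) unital_subalgebra_vars by (intro hull_minimal) auto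
  then show ?thesis using assms(1) by blast
qed

section \<open>The free difference quotient\<close>

text \<open>
  The bilinear functional \<open>G\<close> applied to the free difference quotient with respect to the letter \<open>i\<close>.
\<close>

definition splitting :: "('i nc_poly \<Rightarrow> 'i nc_poly \<Rightarrow> complex) \<Rightarrow> 'i \<Rightarrow> 'i nc_poly \<Rightarrow> complex" where
  "splitting G i = nc_functional (\<lambda>w. \<Sum>p<length w.
    if w ! p = i then G (nc_mono 1 (take p w)) (nc_mono 1 (drop (Suc p) w)) else 0)"

definition nc_bilinear :: "('i nc_poly \<Rightarrow> 'i nc_poly \<Rightarrow> complex) \<Rightarrow> bool" where
  "nc_bilinear G \<longleftrightarrow>
    (\<forall>x y z. G (x + y) z = G x z + G y z \<and> G z (x + y) = G z x + G z y) \<and>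
    (\<forall>c x y. G (nc_smult c x) y = c * G x y \<and> G x (nc_smult c y) = c * G x y)"

lemma splitting_zero [simp]: "splitting G i 0 = 0" "splitting (\<lambda>x y. 0) i p = 0"
  by (simp_all add: splitting_def nc_functional_def)

lemma splitting_add: "splitting G i (p + q) = splitting G i p + splitting G i q"
  by (simp add: splitting_def nc_functional_add)

lemma splitting_add_fun: "splitting (\<lambda>x y. G x y + H x y) i p = splitting G i p + splitting H i p"
proof -
  have "(\<Sum>p<length w. if w ! p = i then G (nc_mono 1 (take p w)) (nc_mono 1 (drop (Suc p) w)) +
      H (nc_mono 1 (take p w)) (nc_mono 1 (drop (Suc p) w)) else 0) =
    (\<Sum>p<length w. if w ! p = i then G (nc_mono 1 (take p w)) (nc_mono 1 (drop (Suc p) w)) else 0) +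
    (\<Sum>p<length w. if w ! p = i then H (nc_mono 1 (take p w)) (nc_mono 1 (drop (Suc p) w)) else 0)" for w
    unfolding sum.distrib[symmetric] by (intro sum.cong refl) simp
  then show ?thesis by (simp add: splitting_def nc_functional_def distrib_left sum.distrib)
qed

lemma splitting_mono: "splitting G i (nc_mono z w) =
    z * (\<Sum>p<length w. if w ! p = i then G (nc_mono 1 (take p w)) (nc_mono 1 (drop (Suc p) w)) else 0)"
  by (simp add: splitting_def)

lemma sum_append_positions:
  fixes f :: "nat \<Rightarrow> 'b::comm_monoid_add"
  shows "(\<Sum>p<a + b. f p) = (\<Sum>p<a. f p) + (\<Sum>p<b. f (a + p))"
  by (induction b) (simp_all add: add.assoc)

text \<open>The Leibniz rule: the removed letter lies in the first or in the second factor.\<close>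

lemma splitting_mult:
  assumes "nc_bilinear G"
  shows "splitting G i (A * B) = splitting (\<lambda>x y. G x (y * B)) i A + splitting (\<lambda>x y. G (A * x) y) i B"
proof -
  have add: "G (x + y) z = G x z + G y z" "G z (x + y) = G z x + G z y"
    and smult: "G (nc_smult c x) y = c * G x y" "G x (nc_smult c y) = c * G x y" for x y z c
    using assms unfolding nc_bilinear_def by blast+
  have pull: "G (nc_mono c u) y = c * G (nc_mono 1 u) y" "G y (nc_mono c u) = c * G y (nc_mono 1 u)" for c u y
    using smult(1)[of c "nc_mono 1 u" y] smult(2)[of y c "nc_mono 1 u"] by simp_all
  have zero: "G 0 y = 0" "G y 0 = 0" for y
    using smult(1)[of 0 0 y] smult(2)[of y 0 0] by simp_all
  show ?thesis
  proof (induction A rule: nc_poly_induct)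
    case (mono z a)
    show ?case
    proof (induction B rule: nc_poly_induct)
      case (mono z' b)
      have "(\<Sum>p<length (a @ b). if (a @ b) ! p = i then G (nc_mono 1 (take p (a @ b))) (nc_mono 1 (drop (Suc p) (a @ b))) else 0) =
        (\<Sum>p<length a. if a ! p = i then G (nc_mono 1 (take p a)) (nc_mono 1 (drop (Suc p) a @ b)) else 0) +
        (\<Sum>p<length b. if b ! p = i then G (nc_mono 1 (a @ take p b)) (nc_mono 1 (drop (Suc p) b)) else 0)"
        unfolding length_append sum_append_positions
        by (intro arg_cong2[where f = "(+)"] sum.cong refl) (auto simp: nth_append Suc_diff_le)
      moreover have "(\<Sum>p<length a. if a ! p = i then G (nc_mono 1 (take p a)) (nc_mono z' (drop (Suc p) a @ b)) else 0) =
        z' * (\<Sum>p<length a. if a ! p = i then G (nc_mono 1 (take p a)) (nc_mono 1 (drop (Suc p) a @ b)) else 0)"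
        unfolding sum_distrib_left by (intro sum.cong refl) (use pull(2)[where c = z'] in auto)
      moreover have "(\<Sum>p<length b. if b ! p = i then G (nc_mono z (a @ take p b)) (nc_mono 1 (drop (Suc p) b)) else 0) =
        z * (\<Sum>p<length b. if b ! p = i then G (nc_mono 1 (a @ take p b)) (nc_mono 1 (drop (Suc p) b)) else 0)"
        unfolding sum_distrib_left by (intro sum.cong refl) (use pull(1)[where c = z] in auto)
      ultimately show ?case
        unfolding splitting_mono nc_mono_mult mult_1_left mult_1_right by (simp add: algebra_simps)
    qed (simp_all add: zero add splitting_add splitting_add_fun distrib_left)
  qed (simp_all add: zero add splitting_add splitting_add_fun distrib_right)
qed

section \<open>Centered words and freeness\<close>

definition centered :: "('i list \<Rightarrow> complex) \<Rightarrow> 'i list \<Rightarrow> 'i nc_poly" where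
  "centered m w = nc_mono 1 w + nc_mono (- m w) []"

lemma nc_mono_centered: "nc_mono 1 w = centered m w + nc_mono (m w) []"
  by (simp add: centered_def add.assoc flip: single_add)

abbreviation centered_prod :: "('i list \<Rightarrow> complex) \<Rightarrow> ('k \<times> 'i list) list \<Rightarrow> 'i nc_poly" where
  "centered_prod m ps \<equiv> prod_list (map (\<lambda>(k, u). centered m u) ps)"

text \<open>Apply the Leibniz rule factor by factor. The constants in the centered words contain no
  letter, so only splittings of the words themselves remain.\<close>

lemma splitting_centered_prod:
  assumes "nc_bilinear G"
    and "\<And>ys k u zs p. ps = ys @ (k, u) # zs \<Longrightarrow> p < length u \<Longrightarrow> u ! p = i \<Longrightarrow>
      G (centered_prod m ys * nc_mono 1 (take p u)) (nc_mono 1 (drop (Suc p) u) * centered_prod m zs) = 0"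
  shows "splitting G i (centered_prod m ps) = 0"
  using assms
proof (induction ps arbitrary: G)
  case Nil
  then show ?case by (simp add: splitting_mono flip: nc_mono_one)
next
  case (Cons x ps)
  obtain k u where x: "x = (k, u)" by (cases x)
  have "splitting (\<lambda>x y. G x (y * centered_prod m ps)) i (centered m u) = 0"
    using Cons.prems(2)[of "[]" k u ps] by (auto simp: centered_def splitting_add splitting_mono x intro!: sum.neutral)
  moreover have "splitting (\<lambda>x y. G (centered m u * x) y) i (centered_prod m ps) = 0"
  proof (rule Cons.IH)
    show "nc_bilinear (\<lambda>x y. G (centered m u * x) y)"
      using Cons.prems(1) unfolding nc_bilinear_def by (simp add: distrib_left nc_smult_mult_right)
    fix ys k' u' zs p assume "ps = ys @ (k', u') # zs" "p < length u'" "u' ! p = i"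
    then show "G (centered m u * (centered_prod m ys * nc_mono 1 (take p u')))
        (nc_mono 1 (drop (Suc p) u') * centered_prod m zs) = 0"
      using Cons.prems(2)[of "(k, u) # ys" k' u' zs p] by (simp add: x mult.assoc)
  qed
  ultimately show ?case by (simp add: splitting_mult[OF Cons.prems(1)] x)
qed

text \<open>For a letter in \<open>Sc\<close> the parts of the word separated by a pairing enter
  only through their moments. This is the case of a covariance equal to \<open>\<kappa> i\<close>
  times the state; it amounts to the letter being semicircular and free from the other
  letters.\<close>

locale scalar_covariance =
  fixes m :: "'i list \<Rightarrow> complex" and Sc :: "'i set" and \<kappa> :: "'i \<Rightarrow> complex"
  assumes one: "m [] = 1"
    and tracial: "m (u @ v) = m (v @ u)"
    and recursion: "i \<in> Sc \<Longrightarrow> m (i # w) =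
      \<kappa> i * (\<Sum>p<length w. if w ! p = i then m (take p w) * m (drop (Suc p) w) else 0)"
begin

abbreviation "\<phi> \<equiv> nc_functional m"

text \<open>Traciality moves \<open>i\<close> to the front. Its partner then lies in
  \<open>w\<close>, in \<open>Q\<close> or in \<open>P\<close>, which gives the three terms;
  linearity reduces the claim to monomials \<open>P\<close> and \<open>Q\<close>.\<close>

lemma schwinger_dyson:
  assumes "i \<in> Sc"
  shows "\<phi> (P * nc_mono 1 (i # w) * Q) = \<kappa> i *
    (splitting (\<lambda>x y. \<phi> x * \<phi> (P * y * Q)) i (nc_mono 1 w) +
     splitting (\<lambda>x y. \<phi> (nc_mono 1 w * x) * \<phi> (P * y)) i Q +
     splitting (\<lambda>x y. \<phi> (x * nc_mono 1 w * Q) * \<phi> y) i P)"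
proof (induction P rule: nc_poly_induct)
  case (mono z p)
  show ?case
  proof (induction Q rule: nc_poly_induct)
    case (mono z' q)
    let ?s = "\<lambda>w F. \<Sum>r<length w. if w ! r = i then F (take r w) (drop (Suc r) w) else (0 :: complex)"
    have "m (p @ i # w @ q) = m (i # w @ q @ p)" using tracial[of p "i # w @ q"] by simp
    also have "\<dots> = \<kappa> i * ?s (w @ q @ p) (\<lambda>u v. m u * m v)" by (rule recursion[OF assms])
    also have "?s (w @ q @ p) (\<lambda>u v. m u * m v) =
        ?s w (\<lambda>u v. m u * m (v @ q @ p)) + (?s q (\<lambda>u v. m (w @ u) * m (v @ p)) +
        ?s p (\<lambda>u v. m (w @ q @ u) * m v))"
      unfolding length_append sum_append_positions
      by (intro arg_cong2[where f = "(+)"] sum.cong refl) (auto simp: nth_append Suc_diff_le)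
    also have "?s w (\<lambda>u v. m u * m (v @ q @ p)) = ?s w (\<lambda>u v. m u * m (p @ v @ q))"
      using tracial[of _ p] by (intro sum.cong refl) (metis append.assoc)
    also have "?s q (\<lambda>u v. m (w @ u) * m (v @ p)) = ?s q (\<lambda>u v. m (w @ u) * m (p @ v))"
      by (intro sum.cong refl) (metis tracial)
    also have "?s p (\<lambda>u v. m (w @ q @ u) * m v) = ?s p (\<lambda>u v. m (u @ w @ q) * m v)"
      by (intro sum.cong refl) (metis tracial append.assoc)
    finally have eq: "m (p @ i # w @ q) = \<kappa> i * (?s w (\<lambda>u v. m u * m (p @ v @ q)) +
        (?s q (\<lambda>u v. m (w @ u) * m (p @ v)) + ?s p (\<lambda>u v. m (u @ w @ q) * m v)))" .
    have "splitting (\<lambda>x y. \<phi> x * \<phi> (nc_mono z p * y * nc_mono z' q)) i (nc_mono 1 w) =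
        z * z' * ?s w (\<lambda>u v. m u * m (p @ v @ q))"
      unfolding splitting_mono nc_mono_mult nc_functional_mono sum_distrib_left by (intro sum.cong refl) simp
    moreover have "splitting (\<lambda>x y. \<phi> (nc_mono 1 w * x) * \<phi> (nc_mono z p * y)) i (nc_mono z' q) =
        z * z' * ?s q (\<lambda>u v. m (w @ u) * m (p @ v))"
      unfolding splitting_mono nc_mono_mult nc_functional_mono sum_distrib_left by (intro sum.cong refl) simp
    moreover have "splitting (\<lambda>x y. \<phi> (x * nc_mono 1 w * nc_mono z' q) * \<phi> y) i (nc_mono z p) =
        z * z' * ?s p (\<lambda>u v. m (u @ w @ q) * m v)"
      unfolding splitting_mono nc_mono_mult nc_functional_mono sum_distrib_left by (intro sum.cong refl) simp
    moreover have "\<phi> (nc_mono z p * nc_mono 1 (i # w) * nc_mono z' q) = z * z' * m (p @ i # w @ q)"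
      by (simp add: nc_mono_mult)
    ultimately show ?case unfolding eq by (simp only: distrib_left mult_ac add.assoc)
  qed (simp_all add: nc_functional_add splitting_add splitting_add_fun distrib_left distrib_right)
qed (simp_all add: nc_functional_add splitting_add splitting_add_fun distrib_left distrib_right)

lemma distinct_adj_between:
  assumes "distinct_adj (xs @ k # ys @ k # zs)"
  shows "ys \<noteq> []" "distinct_adj ys" "distinct_adj (k # ys)" "distinct_adj (ys @ [k])" "distinct_adj (k # ys @ [k])"
proof -
  have "distinct_adj ((k # ys @ [k]) @ zs)" using distinct_adj_appendD2[OF assms] by simp
  then show d: "distinct_adj (k # ys @ [k])" by (rule distinct_adj_appendD1)
  then show "ys \<noteq> []" by auto
  show "distinct_adj (ys @ [k])" using d by (rule distinct_adj_ConsD)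
  show "distinct_adj (k # ys)" using distinct_adj_appendD1[of "k # ys" "[k]"] d by simp
  then show "distinct_adj ys" by (rule distinct_adj_ConsD)
qed

text \<open>
  Expand at the first letter of a word of averaging type. Pairings within the word cancel against its
  centering, and a pairing with another word encloses a shorter alternating centered product.
\<close>

lemma alternating_centered_zero:
  fixes J :: "'k \<Rightarrow> 'i set" and ps :: "('k \<times> 'i list) list"
  assumes disjoint: "\<And>k k'. k \<in> K \<Longrightarrow> k' \<in> K \<Longrightarrow> k \<noteq> k' \<Longrightarrow> J k \<inter> J k' = {}"
    and scalar: "\<And>k. k \<in> K \<Longrightarrow> k \<noteq> k0 \<Longrightarrow> J k \<subseteq> Sc"
  shows "ps \<noteq> [] \<Longrightarrow> distinct_adj (map fst ps) \<Longrightarrow> (\<And>k u. (k, u) \<in> set ps \<Longrightarrow> k \<in> K \<and> set u \<subseteq> J k) \<Longrightarrow>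
    \<phi> (centered_prod m ps) = 0"
proof (induction "sum_list (map (\<lambda>(k, u). length u) ps)" arbitrary: ps rule: less_induct)
  case less
  let ?len = "\<lambda>ps. sum_list (map (\<lambda>(k, u). length u) ps)" and ?C = "centered_prod m"
  show ?case
  \<comment> \<open>Only the index \<open>k0\<close> may have letters that are not of averaging
    type. If no other index occurs, alternation leaves a single factor, which is centered.\<close>
  proof (cases "\<exists>As k u Bs. ps = As @ (k, u) # Bs \<and> k \<noteq> k0")
    case False
    have all: "fst x = k0" if "x \<in> set ps" for x
      using False split_list[OF that] by (metis prod.collapse)
    have "length ps \<le> 1"
    proof (rule ccontr)
      assume "\<not> length ps \<le> 1"
      then obtain x y qs where ps: "ps = x # y # qs" by (metis One_nat_def length_Cons list.exhaust list.size(3) not_less_eq_eq le0)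
      then show False using all[of x] all[of y] less.prems(2) by simp
    qed
    then obtain k u where "ps = [(k, u)]" using less.prems(1) by (cases ps) auto
    then show ?thesis by (simp add: centered_def nc_functional_add one)
  next
    case True
    then obtain As k u Bs where ps: "ps = As @ (k, u) # Bs" and k: "k \<noteq> k0" by blast
    have kK: "k \<in> K" and uJ: "set u \<subseteq> J k" using less.prems(3)[of k u] ps by auto
    show ?thesis
    proof (cases u)
      case Nil
      then have "centered m u = 0" by (simp add: centered_def one flip: single_add)
      then show ?thesis by (simp add: ps)
    next
      case (Cons i w)
      have i: "i \<in> Sc" "i \<in> J k" using scalar[OF kK k] uJ Cons by auto
      have wJ: "set w \<subseteq> J k" using uJ Cons by auto
      let ?A = "?C As" and ?B = "?C Bs"
      have IH: "\<phi> (?C qs) = 0" if "qs \<noteq> []" "distinct_adj (map fst qs)" "?len qs < ?len ps"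
        "\<And>k u. (k, u) \<in> set qs \<Longrightarrow> k \<in> K \<and> set u \<subseteq> J k" for qs
        using less.hyps[OF that(3,1,2,4)] .
      have bil: "nc_bilinear (\<lambda>x y. \<phi> (P * x * Q) * \<phi> (R * y * S))" for P Q R S
        unfolding nc_bilinear_def
        by (simp add: distrib_left distrib_right nc_functional_add nc_functional_smult nc_smult_mult_left
            nc_smult_mult_right algebra_simps)
      have in_ps: "k' \<in> K \<and> set u' \<subseteq> J k'" if "(k', u') \<in> set As \<union> set Bs" for k' u'
        using less.prems(3)[of k' u'] that ps by auto
      \<comment> \<open>Equal letters have the same index, because the sets of letters are
        disjoint.\<close>
      have same: "k' = k" if "(k', u') \<in> set As \<union> set Bs" "p < length u'" "u' ! p = i" for k' u' p
        using in_ps[OF that(1)] disjoint[of k' k] kK i(2) that(2,3) nth_mem[of p u'] by blast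
      \<comment> \<open>Replacing \<open>u\<close> by a shorter word over the same letters keeps the
        product alternating, so its centered version vanishes by induction.\<close>
      have term1: "\<phi> (?A * nc_mono 1 v * ?B) = m v * \<phi> (?A * ?B)" if "set v \<subseteq> J k" "length v < length u" for v
      proof -
        have "\<phi> (?C (As @ (k, v) # Bs)) = 0"
          using less.prems(2,3) that ps by (intro IH) auto
        then show ?thesis
          by (subst nc_mono_centered[of _ m])
            (simp add: distrib_left distrib_right nc_functional_add nc_functional_smult nc_scalar_simps mult.assoc)
      qed
      have "splitting (\<lambda>x y. \<phi> (nc_mono 1 w * x) * \<phi> (?A * y)) i ?B = 0"
      proof (rule splitting_centered_prod)
        show "nc_bilinear (\<lambda>x y. \<phi> (nc_mono 1 w * x) * \<phi> (?A * y))"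
          using bil[of "nc_mono 1 w" 1 ?A 1] by simp
        fix ys k' u' zs p assume Bs: "Bs = ys @ (k', u') # zs" and p: "p < length u'" "u' ! p = i"
        have k': "k' = k" using same[of k' u' p] p Bs by simp
        let ?a = "take p u'"
        have aJ: "set ?a \<subseteq> J k" using in_ps[of k' u'] Bs k' set_take_subset[of p u'] by auto
        have ys: "ys \<noteq> []" "distinct_adj (map fst ys)" "distinct_adj (k # map fst ys)"
          "distinct_adj (map fst ys @ [k])" "distinct_adj (k # map fst ys @ [k])"
          using distinct_adj_between[of "map fst As" k "map fst ys" "map fst zs"] less.prems(2)
          by (simp_all add: ps Bs k')
        have ysK: "\<And>k u. (k, u) \<in> set ys \<Longrightarrow> k \<in> K \<and> set u \<subseteq> J k" using in_ps Bs by auto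
        have len: "length ?a \<le> length u'" by simp
        \<comment> \<open>Undoing the centering at both ends expresses the enclosed part by four
          shorter alternating centered products.\<close>
        have "\<phi> (?C ys) = 0" "\<phi> (?C ((k, w) # ys)) = 0" "\<phi> (?C (ys @ [(k, ?a)])) = 0"
          "\<phi> (?C ((k, w) # ys @ [(k, ?a)])) = 0"
          using ys ysK kK wJ aJ len by (intro IH; force simp: ps Bs Cons)+
        then have "\<phi> (nc_mono 1 w * (?C ys * nc_mono 1 ?a)) = 0"
          by (subst (1 2) nc_mono_centered[of _ m])
            (simp add: distrib_left distrib_right nc_functional_add nc_functional_smult nc_scalar_simps mult.assoc)
        then show "\<phi> (nc_mono 1 w * (?C ys * nc_mono 1 ?a)) *
            \<phi> (?A * (nc_mono 1 (drop (Suc p) u') * ?C zs)) = 0" by simp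
      qed
      moreover have "splitting (\<lambda>x y. \<phi> (x * nc_mono 1 w * ?B) * \<phi> y) i ?A = 0"
      proof (rule splitting_centered_prod)
        show "nc_bilinear (\<lambda>x y. \<phi> (x * nc_mono 1 w * ?B) * \<phi> y)"
          using bil[of 1 "nc_mono 1 w * ?B" 1 1] by (simp add: mult.assoc)
        fix ys k' u' zs p assume As: "As = ys @ (k', u') # zs" and p: "p < length u'" "u' ! p = i"
        have k': "k' = k" using same[of k' u' p] p As by simp
        let ?b = "drop (Suc p) u'"
        have bJ: "set ?b \<subseteq> J k" using in_ps[of k' u'] As k' set_drop_subset[of "Suc p" u'] by auto
        have zs: "zs \<noteq> []" "distinct_adj (map fst zs)" "distinct_adj (k # map fst zs)"
          using distinct_adj_between[of "map fst ys" k "map fst zs" "map fst Bs"] less.prems(2)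
          by (simp_all add: ps As k')
        have zsK: "\<And>k u. (k, u) \<in> set zs \<Longrightarrow> k \<in> K \<and> set u \<subseteq> J k" using in_ps As by auto
        have len: "length ?b \<le> length u'" by simp
        \<comment> \<open>Here the vanishing factor is the part between the partner and the expanded
          letter; it has only one uncentered end, hence two products.\<close>
        have "\<phi> (?C zs) = 0" "\<phi> (?C ((k, ?b) # zs)) = 0"
          using zs zsK kK bJ len by (intro IH; force simp: ps As Cons)+
        then have "\<phi> (nc_mono 1 ?b * ?C zs) = 0"
          by (subst nc_mono_centered[of _ m]) (simp add: distrib_right nc_functional_add nc_functional_smult nc_scalar_simps)
        then show "\<phi> (?C ys * nc_mono 1 (take p u') * nc_mono 1 w * ?B) * \<phi> (nc_mono 1 ?b * ?C zs) = 0"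
          by simp
      qed
      moreover have "splitting (\<lambda>x y. \<phi> x * \<phi> (?A * y * ?B)) i (nc_mono 1 w) =
          (\<Sum>p<length w. if w ! p = i then m (take p w) * m (drop (Suc p) w) else 0) * \<phi> (?A * ?B)"
      proof -
        have "\<phi> (?A * nc_mono 1 (drop (Suc p) w) * ?B) = m (drop (Suc p) w) * \<phi> (?A * ?B)" for p
          using wJ set_drop_subset[of "Suc p" w] by (intro term1) (auto simp: Cons)
        then show ?thesis
          unfolding splitting_mono sum_distrib_right by (simp, intro sum.cong refl) simp
      qed
      \<comment> \<open>Only pairings within \<open>u\<close> survive. They sum to
        \<open>m u\<close> times the product without \<open>u\<close>, exactly what the centering of
        \<open>u\<close> subtracts.\<close>
      ultimately have "\<phi> (?A * nc_mono 1 u * ?B) = m u * \<phi> (?A * ?B)"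
        unfolding Cons schwinger_dyson[OF i(1)] recursion[OF i(1)] by simp
      then show ?thesis
        by (simp add: ps centered_def[of m u] distrib_left distrib_right nc_functional_add nc_functional_smult
            nc_scalar_simps mult.assoc)
    qed
  qed
qed

text \<open>A polynomial in the kernel of the state is a combination of centered words, since the
  centering constants add up to its value 0. The factors are expanded from the left, one at a time;
  \<open>ps\<close> collects the words already chosen.\<close>

lemma free_subalgebras_disjoint_vars:
  fixes J :: "'k \<Rightarrow> 'i set"
  assumes disjoint: "\<And>k k'. k \<in> K \<Longrightarrow> k' \<in> K \<Longrightarrow> k \<noteq> k' \<Longrightarrow> J k \<inter> J k' = {}"
    and scalar: "\<And>k. k \<in> K \<Longrightarrow> k \<noteq> k0 \<Longrightarrow> J k \<subseteq> Sc"
    and B: "\<And>k x. k \<in> K \<Longrightarrow> x \<in> B k \<Longrightarrow> nc_vars x \<subseteq> J k"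
  shows "free_subalgebras \<phi> K B"
proof -
  have words: "\<phi> (centered_prod m ps * prod_list xs) = 0"
    if "length xs = length ks" "set ks \<subseteq> K" "distinct_adj (map fst ps @ ks)" "ps \<noteq> [] \<or> ks \<noteq> []"
      "\<And>k u. (k, u) \<in> set ps \<Longrightarrow> k \<in> K \<and> set u \<subseteq> J k"
      "\<And>j. j < length ks \<Longrightarrow> nc_vars (xs ! j) \<subseteq> J (ks ! j) \<and> \<phi> (xs ! j) = 0" for ps ks xs
    using that
  proof (induction xs ks arbitrary: ps rule: list_induct2)
    case Nil
    then have "\<phi> (centered_prod m ps) = 0"
      by (intro alternating_centered_zero[of K J k0] disjoint scalar) auto
    then show ?case by simp
  next
    case (Cons x xs k ks)
    have x: "nc_vars x \<subseteq> J k" "\<phi> x = 0" using Cons.prems(5)[of 0] by auto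
    let ?S = "Poly_Mapping.keys x" and ?c = "Poly_Mapping.lookup x"
    have single_sum: "nc_mono (\<Sum>w\<in>A. f w) [] = (\<Sum>w\<in>A. nc_mono (f w) [])" for A and f :: "'i nc_word \<Rightarrow> complex"
      by (induction A rule: infinite_finite_induct) (simp_all add: single_add)
    have "(\<Sum>w\<in>?S. nc_smult (?c w) (centered m (letters w))) =
        (\<Sum>w\<in>?S. nc_mono (?c w) (letters w)) + (\<Sum>w\<in>?S. nc_mono (- (?c w * m (letters w))) [])"
      by (simp add: centered_def nc_smult_add_right sum.distrib del: nc_word.collapse)
    also have "(\<Sum>w\<in>?S. nc_mono (- (?c w * m (letters w))) []) = nc_mono (- \<phi> x) []"
      by (simp add: nc_functional_def sum_negf flip: single_sum)
    finally have x_eq: "x = (\<Sum>w\<in>?S. nc_smult (?c w) (centered m (letters w)))"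
      using nc_poly_sum[of x] x(2) by simp
    have zero: "\<phi> (centered_prod m ps * (centered m (letters w) * prod_list xs)) = 0" if w: "w \<in> ?S" for w
    proof -
      have "\<phi> (centered_prod m (ps @ [(k, letters w)]) * prod_list xs) = 0"
      proof (rule Cons.IH)
        show "set ks \<subseteq> K" "distinct_adj (map fst (ps @ [(k, letters w)]) @ ks)"
          "ps @ [(k, letters w)] \<noteq> [] \<or> ks \<noteq> []"
          using Cons.prems by auto
        show "k' \<in> K \<and> set u \<subseteq> J k'" if "(k', u) \<in> set (ps @ [(k, letters w)])" for k' u
          using that Cons.prems(1,4) x(1) w by (auto simp: nc_vars_def)
        show "nc_vars (xs ! j) \<subseteq> J (ks ! j) \<and> \<phi> (xs ! j) = 0" if "j < length ks" for j
          using Cons.prems(5)[of "Suc j"] that by simp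
      qed
      then show ?thesis by (simp add: mult.assoc)
    qed
    have "\<phi> (centered_prod m ps * (x * prod_list xs)) =
        \<phi> (centered_prod m ps * ((\<Sum>w\<in>?S. nc_smult (?c w) (centered m (letters w))) * prod_list xs))"
      using x_eq by simp
    also have "\<dots> = (\<Sum>w\<in>?S. ?c w * \<phi> (centered_prod m ps * (centered m (letters w) * prod_list xs)))"
      by (simp add: sum_distrib_left sum_distrib_right nc_functional_sum nc_smult_mult_left
          nc_smult_mult_right nc_functional_smult)
    also have "\<dots> = 0" using zero by simp
    finally show ?case by simp
  qed
  show ?thesis
    unfolding free_subalgebras_def
  proof (intro allI impI)
    fix ks :: "'k list" and xs :: "'i nc_poly list"
    assume "ks \<noteq> []" "length xs = length ks" "set ks \<subseteq> K" "distinct_adj ks"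
      and j: "\<forall>j<length ks. xs ! j \<in> B (ks ! j) \<and> \<phi> (xs ! j) = 0"
    moreover have "nc_vars (xs ! j) \<subseteq> J (ks ! j) \<and> \<phi> (xs ! j) = 0" if "j < length ks" for j
      using B[of "ks ! j" "xs ! j"] j that \<open>set ks \<subseteq> K\<close> by (simp add: subset_iff)
    ultimately show "\<phi> (prod_list xs) = 0" using words[of xs ks "[]"] by simp
  qed
qed

end

section \<open>Restriction to a set of letters\<close>

text \<open>
  If the recursion is only known for words in \<open>J\<close>, cutting the moments off outside \<open>J\<close> makes it hold
  for all words.
\<close>

lemma scalar_covariance_restrict:
  fixes J :: "'i set"
  assumes "m [] = 1" "\<And>u v. m (u @ v) = m (v @ u)"
    and rec: "\<And>i w. i \<in> J \<Longrightarrow> set w \<subseteq> J \<Longrightarrow> m (i # w) =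
      \<kappa> i * (\<Sum>p<length w. if w ! p = i then m (take p w) * m (drop (Suc p) w) else 0)"
  shows "scalar_covariance (\<lambda>w. if set w \<subseteq> J then m w else 0) J \<kappa>"
proof
  fix i w assume i: "i \<in> J"
  show "(if set (i # w) \<subseteq> J then m (i # w) else 0) = \<kappa> i * (\<Sum>p<length w. if w ! p = i
      then (if set (take p w) \<subseteq> J then m (take p w) else 0) *
        (if set (drop (Suc p) w) \<subseteq> J then m (drop (Suc p) w) else 0) else 0)"
  proof (cases "set w \<subseteq> J")
    case True
    then have "set (take p w) \<subseteq> J" "set (drop (Suc p) w) \<subseteq> J" for p
      using set_take_subset set_drop_subset by fast+
    then show ?thesis using rec[OF i True] i True by (simp cong: if_cong)
  next
    case False
    \<comment> \<open>The first letter and its partner lie in \<open>J\<close>, so a letter outside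
      \<open>J\<close> survives in one of the two parts.\<close>
    have "\<not> set (take p w) \<subseteq> J \<or> \<not> set (drop (Suc p) w) \<subseteq> J" if "p < length w" "w ! p = i" for p
    proof (rule ccontr)
      assume "\<not> ?thesis"
      moreover have "set w = set (take p w @ i # drop (Suc p) w)"
        using id_take_nth_drop[OF that(1)] that(2) by metis
      ultimately show False using False i by auto
    qed
    then have "(\<Sum>p<length w. if w ! p = i
      then (if set (take p w) \<subseteq> J then m (take p w) else 0) *
        (if set (drop (Suc p) w) \<subseteq> J then m (drop (Suc p) w) else 0) else 0) = 0"
      by (intro sum.neutral) auto
    then show ?thesis using False by simp
  qed
qed (use assms in auto)

text \<open>Transports freeness back from the cut-off moments: the algebras contain only polynomials
  in the letters of \<open>J\<close>, where both states agree.\<close>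

lemma free_subalgebras_cong:
  assumes "free_subalgebras (nc_functional m') K B"
    and "\<And>w. set w \<subseteq> J \<Longrightarrow> m w = m' w"
    and B: "\<And>k x. k \<in> K \<Longrightarrow> x \<in> B k \<Longrightarrow> nc_vars x \<subseteq> J"
  shows "free_subalgebras (nc_functional m) K B"
  unfolding free_subalgebras_def
proof (intro allI impI)
  fix ks and xs :: "'a nc_poly list"
  assume *: "ks \<noteq> []" "length xs = length ks" "set ks \<subseteq> K" "distinct_adj ks"
    and j: "\<forall>j<length ks. xs ! j \<in> B (ks ! j) \<and> nc_functional m (xs ! j) = 0"
  have eq: "nc_functional m x = nc_functional m' x" if "nc_vars x \<subseteq> J" for x
    using that assms(2) by (rule nc_functional_cong)
  have vars: "nc_vars x \<subseteq> J" if x: "x \<in> set xs" for x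
  proof -
    obtain l where l: "l < length ks" "xs ! l = x" using x *(2) by (metis in_set_conv_nth)
    then show ?thesis using B[of "ks ! l" x] j subsetD[OF *(3) nth_mem[OF l(1)]] by auto
  qed
  have alg: "unital_subalgebra nc_smult {x :: 'a nc_poly. nc_vars x \<subseteq> J}"
    by (rule unital_subalgebra_vars)
  have "nc_vars (prod_list ys) \<subseteq> J" if "\<And>x. x \<in> set ys \<Longrightarrow> nc_vars x \<subseteq> J" for ys :: "'a nc_poly list"
    using that alg by (induction ys) (auto simp: unital_subalgebra_def)
  then have "nc_vars (prod_list xs) \<subseteq> J" using vars by blast
  then have "nc_functional m (prod_list xs) = nc_functional m' (prod_list xs)" by (rule eq)
  moreover have "\<forall>j<length ks. xs ! j \<in> B (ks ! j) \<and> nc_functional m' (xs ! j) = 0"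
    using j eq[OF vars] *(2) by (metis nth_mem)
  ultimately show "nc_functional m (prod_list xs) = 0"
    using assms(1) * unfolding free_subalgebras_def by metis
qed

section \<open>Moments of the semicircle law\<close>

definition semicircle_moment :: "nat \<Rightarrow> real" where
  "semicircle_moment m = (LBINT t:{-2..2}. t ^ m * (1 / (2 * pi) * sqrt (4 - t\<^sup>2)))"

lemma semicircle_moment_integral:
  "((\<lambda>t. t ^ m * (1 / (2 * pi) * sqrt (4 - t\<^sup>2))) has_integral semicircle_moment m) {-2..2}"
proof -
  have "continuous_on {-2..2::real} (\<lambda>t. t ^ m * (1 / (2 * pi) * sqrt (4 - t\<^sup>2)))"
    by (intro continuous_intros)
  then have int: "set_integrable lborel {-2..2} (\<lambda>t. t ^ m * (1 / (2 * pi) * sqrt (4 - t\<^sup>2)))"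
    by (rule borel_integrable_atLeastAtMost')
  from set_borel_integral_eq_integral[OF int] show ?thesis
    unfolding semicircle_moment_def by (simp add: has_integral_integral)
qed

lemma semicircle_moment_0: "semicircle_moment 0 = 1"
proof -
  \<comment> \<open>An antiderivative of the density. Its two parts fail to be differentiable at the
    endpoints, hence the interior version of the fundamental theorem.\<close>
  let ?F = "\<lambda>t. 1 / (2 * pi) * (t / 2 * sqrt (4 - t\<^sup>2) + 2 * arcsin (t / 2))"
  have "((\<lambda>t. t ^ 0 * (1 / (2 * pi) * sqrt (4 - t\<^sup>2))) has_integral (?F 2 - ?F (-2))) {-2..2}"
  proof (rule fundamental_theorem_of_calculus_interior)
    show "continuous_on {-2..2} ?F" by (intro continuous_intros) auto
    fix t :: real assume t: "t \<in> {-2<..<2}"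
    have "t * t < 2 * 2"
      using t abs_square_less_1[of "t / 2"] by (auto simp: power2_eq_square abs_less_iff)
    then have pos: "0 < 4 - t\<^sup>2" by (simp add: power2_eq_square)
    have half: "sqrt (1 - (t / 2)\<^sup>2) = sqrt (4 - t\<^sup>2) / 2"
    proof -
      have eq: "1 - (t / 2)\<^sup>2 = (4 - t\<^sup>2) / 4" by (simp add: power2_eq_square field_simps)
      show ?thesis unfolding eq real_sqrt_divide by simp
    qed
    define s where "s = sqrt (4 - t\<^sup>2)"
    have s: "0 < s" "s * s = 4 - t\<^sup>2" using pos by (simp_all add: s_def)
    have dh: "((\<lambda>t. t / 2) has_real_derivative 1 / 2) (at t)" by (auto intro!: derivative_eq_intros)
    have "((\<lambda>t. 4 - t\<^sup>2) has_real_derivative - (2 * t)) (at t)" by (auto intro!: derivative_eq_intros)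
    from DERIV_chain2[OF DERIV_real_sqrt[OF pos] this]
    have ds: "((\<lambda>t. sqrt (4 - t\<^sup>2)) has_real_derivative inverse s / 2 * (- (2 * t))) (at t)"
      unfolding s_def .
    have "- 1 < t / 2" "t / 2 < 1" using t by auto
    from DERIV_chain2[OF DERIV_arcsin[OF this] dh]
    have da: "((\<lambda>t. arcsin (t / 2)) has_real_derivative inverse (s / 2) * (1 / 2)) (at t)"
      unfolding half s_def .
    have "(?F has_real_derivative 1 / (2 * pi) * (1 / 2 * s + t / 2 * (- (2 * t) * (inverse s / 2)) +
        2 * (1 / 2 * inverse (s / 2)))) (at t)"
      by (rule DERIV_cong[OF DERIV_cmult[OF DERIV_add[OF DERIV_mult[OF dh ds] DERIV_cmult[OF da]]]])
        (simp only: s_def mult_ac add_ac)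
    moreover have "1 / 2 * s + t / 2 * (- (2 * t) * (inverse s / 2)) + 2 * (1 / 2 * inverse (s / 2)) = s"
    proof -
      have "1 / 2 * s + t / 2 * (- (2 * t) * (inverse s / 2)) + 2 * (1 / 2 * inverse (s / 2)) =
          s / 2 + (4 - t\<^sup>2) / (2 * s)"
        using s(1) by (simp add: field_simps power2_eq_square)
      also have "\<dots> = s" unfolding s(2)[symmetric] using s(1) by (simp add: field_simps)
      finally show ?thesis .
    qed
    ultimately show "(?F has_vector_derivative t ^ 0 * (1 / (2 * pi) * sqrt (4 - t\<^sup>2))) (at t)"
      unfolding has_real_derivative_iff_has_vector_derivative[symmetric] s_def[symmetric] by simp
  qed simp
  moreover have "?F 2 - ?F (-2) = 1" by (simp add: arcsin_minus_1 field_simps)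
  ultimately show ?thesis using semicircle_moment_integral[of 0] has_integral_unique by metis
qed

text \<open>Integrate the derivative of t^k (4 - t^2)^(3/2), a function that vanishes at both
  endpoints. For k = 0 the truncated index k - 1 is multiplied by 0, and the identity says that the
  first moment vanishes.\<close>

lemma semicircle_moment_parts:
  "real k * 4 * semicircle_moment (k - 1) = (real k + 3) * semicircle_moment (k + 1)"
proof -
  let ?F = "\<lambda>t. 1 / (2 * pi) * (t ^ k * (4 - t\<^sup>2) * sqrt (4 - t\<^sup>2))"
  let ?f = "\<lambda>m t. t ^ m * (1 / (2 * pi) * sqrt (4 - t\<^sup>2))"
  have int1: "((\<lambda>t. real k * 4 * ?f (k - 1) t - (real k + 3) * ?f (k + 1) t) has_integral (?F 2 - ?F (-2))) {-2..2}"
  proof (rule fundamental_theorem_of_calculus_interior)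
    show "continuous_on {-2..2} ?F" by (intro continuous_intros)
    fix t :: real assume t: "t \<in> {-2<..<2}"
    have "t * t < 2 * 2"
      using t abs_square_less_1[of "t / 2"] by (auto simp: power2_eq_square abs_less_iff)
    then have pos: "0 < 4 - t\<^sup>2" by (simp add: power2_eq_square)
    define s where "s = sqrt (4 - t\<^sup>2)"
    have s: "0 < s" "4 - t\<^sup>2 = s * s" using pos by (simp_all add: s_def)
    have d: "((\<lambda>t. t ^ k) has_real_derivative real k * t ^ (k - 1)) (at t)"
      "((\<lambda>t. 4 - t\<^sup>2) has_real_derivative - (2 * t)) (at t)"
      by (auto intro!: derivative_eq_intros)
    have d': "((\<lambda>t. sqrt (4 - t\<^sup>2)) has_real_derivative inverse s / 2 * (- (2 * t))) (at t)"
      unfolding s_def by (rule DERIV_chain2[OF DERIV_real_sqrt[OF pos] d(2)])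
    have der: "(?F has_real_derivative 1 / (2 * pi) * ((real k * t ^ (k - 1) * (4 - t\<^sup>2) + t ^ k * (- (2 * t))) * s +
        t ^ k * (4 - t\<^sup>2) * (- (2 * t) * (inverse s / 2)))) (at t)"
      by (rule DERIV_cong[OF DERIV_cmult[OF DERIV_mult[OF DERIV_mult[OF d] d']]])
        (simp only: s_def mult_ac add_ac)
    have e1: "t ^ k * (4 - t\<^sup>2) * (- (2 * t) * (inverse s / 2)) = - (t ^ (k + 1) * s)"
      unfolding s(2) using s(1) by (simp add: field_simps)
    have e2: "real k * t ^ (k - 1) * (4 - t\<^sup>2) = 4 * real k * t ^ (k - 1) - real k * t ^ (k + 1)"
      by (cases k) (simp_all add: algebra_simps power2_eq_square)
    have e3: "c * ((4 * real k * t ^ (k - 1) - real k * t ^ (k + 1) + t ^ k * (- (2 * t))) * s + - (t ^ (k + 1) * s)) =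
        real k * 4 * (t ^ (k - 1) * (c * s)) - (real k + 3) * (t ^ (k + 1) * (c * s))" for c
      by (simp add: algebra_simps)
    show "(?F has_vector_derivative real k * 4 * ?f (k - 1) t - (real k + 3) * ?f (k + 1) t) (at t)"
      using der unfolding has_real_derivative_iff_has_vector_derivative[symmetric] e1 e2 e3
      unfolding s_def .
  qed simp
  have int2: "((\<lambda>t. real k * 4 * ?f (k - 1) t - (real k + 3) * ?f (k + 1) t) has_integral
      (real k * 4 * semicircle_moment (k - 1) - (real k + 3) * semicircle_moment (k + 1))) {-2..2}"
    by (intro has_integral_diff has_integral_mult_right semicircle_moment_integral)
  show ?thesis using has_integral_unique[OF int1 int2] by simp
qed

text \<open>
  Both sequences satisfy \<open>(n + 4) * S (n + 2) = 4 * (n + 1) * S n\<close>; for \<open>S\<close> this follows from the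
  generating function identity \<open>y = 1 + X\<^sup>2 * y\<^sup>2\<close>.
\<close>

lemma segner_imp_semicircle_moment:
  fixes S :: "nat \<Rightarrow> complex"
  assumes S0: "S 0 = 1" and rec: "\<And>n. S (Suc n) = (\<Sum>p<n. S p * S (n - Suc p))"
  shows "S n = of_real (semicircle_moment n)"
proof -
  define y where "y = Abs_fps S"
  let ?X = "fps_X :: complex fps"
  have y_eq: "y = 1 + ?X ^ 2 * (y * y)"
  proof (rule fps_ext)
    fix n
    show "fps_nth y n = fps_nth (1 + ?X ^ 2 * (y * y)) n"
    proof (cases n)
      case 0
      then show ?thesis by (simp add: y_def S0)
    next
      case (Suc n')
      show ?thesis
      proof (cases n')
        case 0
        then show ?thesis using Suc rec[of 0] by (simp add: y_def fps_X_power_mult_nth)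
      next
        case (Suc l)
        have "S (Suc (Suc l)) = (\<Sum>p<Suc l. S p * S (l - p))" using rec[of "Suc l"] by simp
        also have "\<dots> = (\<Sum>p=0..l. S p * S (l - p))"
          by (intro sum.cong) auto
        finally show ?thesis using Suc \<open>n = Suc n'\<close>
          by (simp add: y_def fps_X_power_mult_nth fps_mult_nth[of "Abs_fps S" "Abs_fps S"])
      qed
    qed
  qed
  \<comment> \<open>The quadratic equation for \<open>y\<close> makes 1 - 2 z a square root of 1 - 4
    X^2; this turns the derivative of that equation into a linear differential equation for
    \<open>y\<close>.\<close>
  define z where "z = ?X ^ 2 * y"
  have zy: "z * y = y - 1" using y_eq by (simp add: z_def mult.assoc algebra_simps)
  have d: "fps_deriv y * (1 - 2 * z) = 2 * ?X * y ^ 2"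
  proof -
    have "fps_deriv y = fps_deriv (1 + ?X ^ 2 * (y * y))" by (rule arg_cong[OF y_eq])
    also have "\<dots> = 2 * ?X * y ^ 2 + ?X ^ 2 * (2 * y * fps_deriv y)"
      by (simp add: fps_deriv_power' power2_eq_square algebra_simps)
    finally have "fps_deriv y - 2 * z * fps_deriv y = 2 * ?X * y ^ 2"
      by (simp add: z_def algebra_simps)
    then show ?thesis by (simp add: algebra_simps)
  qed
  have sq: "(1 - 2 * z) * (1 - 2 * z) = 1 - 4 * ?X ^ 2"
  proof -
    have "z * z = ?X ^ 2 * (z * y)" by (simp add: z_def mult_ac)
    also have "\<dots> = z - ?X ^ 2" unfolding zy by (simp add: z_def algebra_simps)
    finally have zz: "z * z = z - ?X ^ 2" .
    have "(1 - 2 * z) * (1 - 2 * z) = 1 - 4 * z + 4 * (z * z)" by (simp add: algebra_simps)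
    then show ?thesis unfolding zz by (simp add: algebra_simps)
  qed
  have "?X * ((1 - 4 * ?X ^ 2) * fps_deriv y) = ?X * (1 - 2 * z) * (fps_deriv y * (1 - 2 * z))"
    unfolding sq[symmetric] by (simp only: mult_ac)
  also have "\<dots> = 2 * (?X ^ 2 * y * y) * (1 - 2 * z)" unfolding d by (simp add: power2_eq_square mult_ac)
  also have "?X ^ 2 * y * y = y - 1" using zy by (simp add: z_def)
  also have "2 * (y - 1) * (1 - 2 * z) = 2 * y - 2 - 4 * (z * y) + 4 * z" by (simp add: algebra_simps)
  also have "\<dots> = 2 - 2 * y + 4 * z" unfolding zy by (simp add: algebra_simps)
  finally have ode: "?X * fps_deriv y - 4 * (?X ^ 3 * fps_deriv y) = 2 - 2 * y + 4 * (?X ^ 2 * y)"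
    by (simp add: z_def algebra_simps power3_eq_cube power2_eq_square)
  \<comment> \<open>Compare the coefficients of X^(n + 2) in the differential equation.\<close>
  have step: "(of_nat n + 4) * S (n + 2) = 4 * (of_nat n + 1) * S n" for n
  proof -
    have four: "fps_nth (4 * f) j = 4 * fps_nth f j" "fps_nth (2 * f) j = 2 * fps_nth f j" for f :: "complex fps" and j
      by (metis numeral_fps_const fps_mult_left_const_nth)+
    have "fps_nth (?X * fps_deriv y - 4 * (?X ^ 3 * fps_deriv y)) (n + 2) = fps_nth (2 - 2 * y + 4 * (?X ^ 2 * y)) (n + 2)"
      by (simp only: ode)
    moreover have "fps_nth (2 :: complex fps) (n + 2) = 0" by (simp add: fps_numeral_nth)
    moreover have "fps_nth (?X * fps_deriv y) (n + 2) = (of_nat n + 2) * S (n + 2)"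
      by (simp add: y_def algebra_simps)
    moreover have "fps_nth (?X ^ 3 * fps_deriv y) (n + 2) = of_nat n * S n"
      unfolding fps_X_power_mult_nth by (cases n) (simp_all add: y_def algebra_simps)
    moreover have "fps_nth (?X ^ 2 * y) (n + 2) = S n" "fps_nth y (n + 2) = S (n + 2)"
      by (simp_all add: fps_X_power_mult_nth y_def)
    ultimately have "(of_nat n + 2) * S (n + 2) - 4 * (of_nat n * S n) = 0 - 2 * S (n + 2) + 4 * S n"
      by (simp only: fps_sub_nth fps_add_nth four)
    then show ?thesis by (simp add: algebra_simps)
  qed
  \<comment> \<open>The recursion has step two, so two consecutive values are carried along.\<close>
  have "S n = of_real (semicircle_moment n) \<and> S (Suc n) = of_real (semicircle_moment (Suc n))"
  proof (induction n)
    case 0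
    show ?case using S0 rec[of 0] semicircle_moment_0 semicircle_moment_parts[of 0] by simp
  next
    case (Suc n)
    have "(of_nat n + 4) * S (n + 2) = of_real (4 * (real n + 1) * semicircle_moment n)"
      unfolding step using Suc by simp
    also have "4 * (real n + 1) * semicircle_moment n = (real n + 4) * semicircle_moment (n + 2)"
      using semicircle_moment_parts[of "Suc n"] by (simp add: algebra_simps)
    finally have "(of_nat n + 4) * S (n + 2) = (of_nat n + 4) * of_real (semicircle_moment (n + 2))" by simp
    moreover have "(of_nat n + 4 :: complex) \<noteq> 0"
      by (metis add_eq_0_iff_both_eq_0 numeral_neq_zero of_nat_add of_nat_eq_0_iff of_nat_numeral)
    ultimately show ?case using Suc by simp
  qed
  then show ?thesis by simp
qed

section \<open>Integrals over the unit interval\<close>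

lemma unit_integral_add:
  "set_integrable lborel {0<..<1} f \<Longrightarrow> set_integrable lborel {0<..<1} g \<Longrightarrow>
    unit_integral (\<lambda>x. f x + g x) = unit_integral f + unit_integral g"
  unfolding unit_integral_def by (rule set_integral_add)

lemma unit_integrable_bounded:
  fixes f :: "real \<Rightarrow> real"
  assumes "(\<lambda>x::real. indicator {0<..<1} x * f x) \<in> borel_measurable borel"
    and "\<And>x. 0 < x \<Longrightarrow> x < 1 \<Longrightarrow> \<bar>f x\<bar> \<le> B"
  shows "set_integrable lborel {0<..<1} f"
  unfolding set_integrable_def
proof (rule Bochner_Integration.integrable_bound)
  show "integrable lborel (\<lambda>x::real. indicator {0<..<1} x * B)"
    by (intro integrable_mult_left integrable_real_indicator) auto
  show "(\<lambda>x. indicator {0<..<1} x *\<^sub>R f x) \<in> borel_measurable lborel" using assms(1) by simp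
  show "AE x in lborel. norm (indicator {0<..<1} x *\<^sub>R f x) \<le> norm (indicator {0<..<1} x * B)"
  proof (rule AE_I2)
    fix x :: real
    show "norm (indicator {0<..<1} x *\<^sub>R f x) \<le> norm (indicator {0<..<1} x * B)"
      using assms(2)[of x] by (cases "x \<in> {0<..<1}") auto
  qed
qed

lemma unit_integrable_continuous:
  "continuous_on {0..1} f \<Longrightarrow> set_integrable lborel {0<..<1} (f :: real \<Rightarrow> real)"
  by (rule set_integrable_subset[OF borel_integrable_atLeastAtMost']) auto

lemma unit_integral_has_integral:
  assumes "continuous_on {0..1} f" "(f has_integral y) {0..1}"
  shows "unit_integral f = y"
proof -
  have "unit_integral f = integral {0<..<1} f"
    unfolding unit_integral_def by (rule set_borel_integral_eq_integral(2)[OF unit_integrable_continuous[OF assms(1)]])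
  also have "\<dots> = integral {0..1} f" by (rule integral_open_interval_real[symmetric])
  finally show ?thesis using assms(2) by (simp add: integral_unique)
qed

lemma unit_integral_interval:
  "unit_integral (\<lambda>y. of_bool (l \<le> y \<and> y \<le> u)) = max 0 (min 1 u - max 0 l)"
  "set_integrable lborel {0<..<1} (\<lambda>y. of_bool (l \<le> y \<and> y \<le> u) :: real)"
proof -
  have ae: "AE y in lborel. y \<notin> {0, 1 :: real}" by (rule AE_not_eq_finite) simp
  have eq: "AE y in lborel. indicator {0<..<1} y *\<^sub>R of_bool (l \<le> y \<and> y \<le> u) =
      (indicator {max 0 l..min 1 u} y :: real)"
    using ae by eventually_elim (auto simp: indicator_def)
  have meas: "(\<lambda>y. indicator {0<..<1} y *\<^sub>R (of_bool (l \<le> y \<and> y \<le> u) :: real)) \<in> borel_measurable lborel"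
    unfolding of_bool_def by measurable
  have int: "integrable lborel (indicator {max 0 l..min 1 u} :: real \<Rightarrow> real)"
    by (intro integrable_real_indicator) (auto simp: emeasure_lborel_Icc_eq)
  show "unit_integral (\<lambda>y. of_bool (l \<le> y \<and> y \<le> u)) = max 0 (min 1 u - max 0 l)"
    unfolding unit_integral_def set_lebesgue_integral_def integral_cong_AE[OF meas borel_measurable_integrable[OF int] eq]
  proof (cases "max 0 l \<le> min 1 u")
    case False
    then have empty: "{max 0 l..min 1 u} = {}" and neg: "min 1 u - max 0 l \<le> 0" by auto
    show "(LINT x|lborel. indicator {max 0 l..min 1 u} x) = max 0 (min 1 u - max 0 l)"
      unfolding empty max_absorb1[OF neg] by simp
  qed simp
  show "set_integrable lborel {0<..<1} (\<lambda>y. of_bool (l \<le> y \<and> y \<le> u) :: real)"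
    unfolding set_integrable_def integrable_cong_AE[OF meas borel_measurable_integrable[OF int] eq] by (rule int)
qed

section \<open>Row masses of the limiting bands\<close>

lemma unit_integral_band:
  assumes "0 < x" "x < 1" "0 < c"
  shows "unit_integral (\<lambda>y. of_bool (\<bar>x - y\<bar> \<le> c)) = min c x + min c (1 - x)"
proof -
  have "unit_integral (\<lambda>y. of_bool (\<bar>x - y\<bar> \<le> c)) = unit_integral (\<lambda>y. of_bool (x - c \<le> y \<and> y \<le> x + c))"
    by (intro arg_cong[of _ _ unit_integral] ext arg_cong[of _ _ of_bool]) auto
  also have "\<dots> = min c x + min c (1 - x)"
    unfolding unit_integral_interval using assms by (auto simp: min_def max_def)
  finally show ?thesis .
qed

text \<open>The cyclic band is an arc on a circle of length 1, so its length does not depend on x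
  and is capped by the full circle. For c < 1/2 the arc consists of the ordinary band and its two
  wrapped pieces.\<close>

lemma unit_integral_cyclic_band:
  assumes "0 < x" "x < 1" "0 < c"
  shows "unit_integral (\<lambda>y. of_bool (min \<bar>x - y\<bar> (1 - \<bar>x - y\<bar>) \<le> c)) = min 1 (2 * c)"
proof (cases "1 / 2 \<le> c")
  case True
  have "unit_integral (\<lambda>y. of_bool (min \<bar>x - y\<bar> (1 - \<bar>x - y\<bar>) \<le> c)) = unit_integral (\<lambda>y. 1)"
    using True by (intro unit_integral_cong) (auto simp: min_def)
  then show ?thesis using True by simp
next
  case False
  let ?i = "\<lambda>l u y. of_bool (l \<le> y \<and> y \<le> u) :: real"
  have "unit_integral (\<lambda>y. of_bool (min \<bar>x - y\<bar> (1 - \<bar>x - y\<bar>) \<le> c)) =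
      unit_integral (\<lambda>y. ?i (x - c) (x + c) y + (?i (x + 1 - c) 1 y + ?i 0 (x + c - 1) y))"
    using False assms by (intro unit_integral_cong) (auto simp: min_def of_bool_def abs_if)
  also have "\<dots> = unit_integral (?i (x - c) (x + c)) + (unit_integral (?i (x + 1 - c) 1) + unit_integral (?i 0 (x + c - 1)))"
    by (subst unit_integral_add, simp_all add: unit_integral_interval(2) set_integral_add(1))
      (rule unit_integral_add; rule unit_integral_interval)
  also have "\<dots> = 2 * c"
    unfolding unit_integral_interval using assms False by (auto simp: min_def max_def)
  finally show ?thesis using False by simp
qed

text \<open>For x in the unit interval, the length of the part of the interval within distance c of
  x: the limiting row mass of a non-periodic band, before normalisation.\<close>

definition tent :: "real \<Rightarrow> real \<Rightarrow> real" where
  "tent c x = min c x + min c (1 - x)"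

lemma continuous_tent: "continuous_on A (tent c)"
  unfolding tent_def by (intro continuous_intros)

text \<open>This is the area of the band in the unit square. Each of the two minima is integrated
  piecewise, with its kink at c or at 1 - c.\<close>

lemma unit_integral_tent:
  assumes "0 < c" "c < 1"
  shows "unit_integral (tent c) = 2 * c - c\<^sup>2"
proof (rule unit_integral_has_integral[OF continuous_tent])
  have "((\<lambda>x. min c x) has_integral ((c\<^sup>2 - 0\<^sup>2) / 2) + (1 - c) * c) {0..1}"
  proof (rule has_integral_combine[of 0 c 1])
    show "((\<lambda>x. min c x) has_integral (c\<^sup>2 - 0\<^sup>2) / 2) {0..c}"
      by (rule has_integral_eq[where f = "\<lambda>x. x", OF _ ident_has_integral]) (use assms in auto)
    show "((\<lambda>x. min c x) has_integral (1 - c) * c) {c..1}"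
      by (rule has_integral_eq[where f = "\<lambda>x. c", OF _ has_integral_const_real[of c c 1, unfolded content_real[OF less_imp_le[OF assms(2)]] real_scaleR_def]])
        (use assms in auto)
  qed (use assms in auto)
  moreover have "((\<lambda>x. min c (1 - x)) has_integral ((1 - c) - 0) * c + ((1 - (1 - c)) * 1 - ((1\<^sup>2 - (1 - c)\<^sup>2) / 2))) {0..1}"
  proof (rule has_integral_combine[of 0 "1 - c" 1])
    have le: "0 \<le> 1 - c" "1 - c \<le> 1" using assms by auto
    show "((\<lambda>x. min c (1 - x)) has_integral ((1 - c) - 0) * c) {0..1 - c}"
      by (rule has_integral_eq[where f = "\<lambda>x. c", OF _ has_integral_const_real[of c 0 "1 - c", unfolded content_real[OF le(1)] real_scaleR_def]])
        (use assms in auto)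
    show "((\<lambda>x. min c (1 - x)) has_integral (1 - (1 - c)) * 1 - ((1\<^sup>2 - (1 - c)\<^sup>2) / 2)) {1 - c..1}"
      by (rule has_integral_eq[where f = "\<lambda>x. 1 - x", OF _ has_integral_diff[OF has_integral_const_real[of "1 :: real" "1 - c" 1,
            unfolded content_real[OF le(2)] real_scaleR_def] ident_has_integral[OF le(2)]]])
        (use assms in auto)
  qed (use assms in auto)
  ultimately have int: "((\<lambda>x. min c x + min c (1 - x)) has_integral
      ((c\<^sup>2 - 0\<^sup>2) / 2 + (1 - c) * c) + (((1 - c) - 0) * c + ((1 - (1 - c)) * 1 - (1\<^sup>2 - (1 - c)\<^sup>2) / 2))) {0..1}"
    by (rule has_integral_add)
  have eq: "((c\<^sup>2 - 0\<^sup>2) / 2 + (1 - c) * c) + (((1 - c) - 0) * c + ((1 - (1 - c)) * 1 - (1\<^sup>2 - (1 - c)\<^sup>2) / 2)) = 2 * c - c\<^sup>2"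
    by (simp add: power2_eq_square field_simps)
  show "(tent c has_integral 2 * c - c\<^sup>2) {0..1}"
    using int unfolding eq tent_def[abs_def] .
qed

text \<open>
  Chebyshev's correlation inequality: both functions are nondecreasing in \<open>min x (1 - x)\<close>, and
  \<open>tent c\<close> takes its mean value at \<open>c * (1 - c)\<close>.
\<close>

lemma unit_integral_tent_mult:
  assumes c: "0 < c" "c < 1" and d: "0 < d" "d < 1"
  shows "(2 * c - c\<^sup>2) * (2 * d - d\<^sup>2) < unit_integral (\<lambda>x. tent c x * tent d x)"
proof -
  define p where "p = c * (1 - c)"
  have p0: "0 < p" using c by (simp add: p_def)
  have pc: "p \<le> c" "p \<le> 1 - c" using c by (simp_all add: p_def mult_left_le mult_left_le_one_le)
  have c_le: "c \<le> 1 - p"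
  proof -
    have "0 \<le> (1 - c) * (1 - c)" by simp
    then show ?thesis by (simp add: p_def algebra_simps)
  qed
  have p_half: "p \<le> 1 / 2" using pc by linarith
  have mean: "tent c p = 2 * c - c\<^sup>2"
  proof -
    have "tent c p = p + c" using pc c_le by (simp add: tent_def)
    then show ?thesis by (simp add: p_def power2_eq_square algebra_simps)
  qed
  have mono: "tent e s \<le> tent e t" if "s \<le> t" "t \<le> 1 / 2" for e s t
    using that unfolding tent_def by (auto simp: min_def)
  have sym: "tent e (1 - x) = tent e x" for e x by (simp add: tent_def)
  define F where "F = (\<lambda>x. (tent c x - tent c p) * (tent d x - tent d p))"
  \<comment> \<open>By symmetry x may be taken at most 1/2, where both tents are nondecreasing;
    hence the two differences have the same sign on either side of \<open>p\<close>.\<close>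
  have F0: "0 \<le> F x" if "0 < x" "x < 1" for x
  proof -
    have *: "0 \<le> F t" if "t \<le> 1 / 2" for t
    proof (cases "t \<le> p")
      case True
      then show ?thesis using mono[OF True p_half] unfolding F_def by (intro mult_nonpos_nonpos) auto
    next
      case False
      then show ?thesis using mono[of p t] that unfolding F_def by (intro mult_nonneg_nonneg) auto
    qed
    show ?thesis using *[of x] *[of "1 - x"] by (cases "x \<le> 1 / 2") (auto simp: F_def sym)
  qed
  \<comment> \<open>Strictness comes from the points near 0: for x \<le> \<delta> both tents lie at
    least \<delta> below their values at \<open>p\<close>. The bounds by \<open>d\<close> and
    \<open>1 - d\<close> keep 2 \<delta> on the first linear piece of \<open>tent d\<close>.\<close>
  define \<delta> where "\<delta> = min p (min d (1 - d)) / 2"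
  have \<delta>: "0 < \<delta>" "2 * \<delta> \<le> p" "2 * \<delta> \<le> d" "2 * \<delta> \<le> 1 - d" using p0 d by (auto simp: \<delta>_def min_def)
  have F\<delta>: "\<delta>\<^sup>2 \<le> F x" if "0 < x" "x \<le> \<delta>" for x
  proof -
    have 1: "tent c x - tent c p \<le> - \<delta>"
      using that \<delta> pc c_le by (auto simp: tent_def min_def)
    have "tent d (2 * \<delta>) \<le> tent d p" using \<delta> p_half by (intro mono) auto
    moreover have "tent d (2 * \<delta>) = 2 * \<delta> + d" "tent d x = x + d"
      using that \<delta> by (simp_all add: tent_def)
    ultimately have 2: "tent d x - tent d p \<le> - \<delta>" using that by linarith
    have "\<delta> * \<delta> \<le> (tent c p - tent c x) * (tent d p - tent d x)"
      using 1 2 \<delta>(1) by (intro mult_mono) auto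
    then show ?thesis by (simp add: F_def power2_eq_square algebra_simps)
  qed
  have int: "set_integrable lborel {0<..<1} (\<lambda>x. tent c x * tent d x)"
    "set_integrable lborel {0<..<1} (tent c)" "set_integrable lborel {0<..<1} (tent d)"
    "set_integrable lborel {0<..<1} F"
    unfolding F_def by (intro unit_integrable_continuous continuous_intros continuous_tent)+
  have "0 < \<delta>\<^sup>2 * \<delta>" using \<delta>(1) by simp
  also have "\<dots> = unit_integral (\<lambda>x. \<delta>\<^sup>2 * of_bool (0 \<le> x \<and> x \<le> \<delta>))"
    unfolding unit_integral_cmult unit_integral_interval using \<delta> d by (simp add: min_def max_def)
  also have "\<dots> \<le> unit_integral F"
    unfolding unit_integral_def
  proof (rule set_integral_mono)
    show "set_integrable lborel {0<..<1} (\<lambda>x. \<delta>\<^sup>2 * of_bool (0 \<le> x \<and> x \<le> \<delta>))"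
      by (intro set_integrable_mult_right unit_integral_interval)
    show "\<delta>\<^sup>2 * of_bool (0 \<le> x \<and> x \<le> \<delta>) \<le> F x" if "x \<in> {0<..<1}" for x
      using that F0[of x] F\<delta>[of x] by (cases "x \<le> \<delta>") auto
  qed (rule int)
  \<comment> \<open>\<open>tent c p\<close> is the mean of \<open>tent c\<close>, so the terms with
    \<open>tent d p\<close> cancel and \<open>F\<close> integrates to the covariance of the two
    tents.\<close>
  also have "unit_integral F = unit_integral (\<lambda>x. tent c x * tent d x) - tent d p * unit_integral (tent c)
      - tent c p * unit_integral (tent d) + tent c p * tent d p"
  proof -
    have i: "set_integrable lborel {0<..<1} (\<lambda>x. - tent d p * tent c x)"
      "set_integrable lborel {0<..<1} (\<lambda>x. - tent c p * tent d x + tent c p * tent d p)"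
      "set_integrable lborel {0<..<1} (\<lambda>x. - tent d p * tent c x + (- tent c p * tent d x + tent c p * tent d p))"
      "set_integrable lborel {0<..<1} (\<lambda>x. - tent c p * tent d x)"
      by (intro unit_integrable_continuous continuous_on_add continuous_on_mult continuous_on_const continuous_tent)+
    have i5: "set_integrable lborel {0<..<1} (\<lambda>x::real. tent c p * tent d p)"
      by (rule unit_integrable_continuous[OF continuous_on_const])
    have "unit_integral F = unit_integral (\<lambda>x. tent c x * tent d x +
        (- tent d p * tent c x + (- tent c p * tent d x + tent c p * tent d p)))"
      by (intro arg_cong[of _ _ unit_integral]) (auto simp: F_def algebra_simps)
    also have "\<dots> = unit_integral (\<lambda>x. tent c x * tent d x) + (- tent d p * unit_integral (tent c) +
        (- tent c p * unit_integral (tent d) + tent c p * tent d p))"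
      by (simp only: unit_integral_add[OF int(1) i(3)] unit_integral_add[OF i(1,2)] unit_integral_add[OF i(4) i5]
          unit_integral_cmult unit_integral_const)
    finally show ?thesis by simp
  qed
  finally show ?thesis
    unfolding mean unit_integral_tent[OF c] unit_integral_tent[OF d] by (simp add: algebra_simps)
qed

lemma interior_limit_integrable:
  assumes "interior_limit g f"
  shows "set_integrable lborel {0<..<1} f"
proof -
  obtain B where B: "\<forall>\<^sub>F n in sequentially. \<forall>j<n. \<bar>g n j\<bar> \<le> B"
    using interior_limit_bounded[OF assms] by blast
  have "\<bar>f x\<bar> \<le> B" if x: "0 < x" "x < 1" for x
  proof (rule tendsto_upperbound)
    show "(\<lambda>n. \<bar>g n (nat \<lfloor>real n * x\<rfloor>)\<bar>) \<longlonglongrightarrow> \<bar>f x\<bar>"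
      using x by (intro tendsto_rabs interior_limitD[OF assms] floor_average_tendsto) auto
    show "\<forall>\<^sub>F n in sequentially. \<bar>g n (nat \<lfloor>real n * x\<rfloor>)\<bar> \<le> B"
      using B eventually_gt_at_top[of 0]
    proof eventually_elim
      case (elim n)
      have "real n * x < real n * 1" using elim(2) x by (intro mult_strict_left_mono) simp_all
      then have "\<lfloor>real n * x\<rfloor> < int n" unfolding floor_less_iff by simp
      then have "nat \<lfloor>real n * x\<rfloor> < n" using x by (simp add: nat_less_iff)
      with elim(1) show ?case by simp
    qed
  qed simp
  then show ?thesis by (rule unit_integrable_bounded[OF interior_limit_measurable[OF assms]])
qed

lemma unit_integral_sum:
  assumes "finite P" "\<And>p. p \<in> P \<Longrightarrow> set_integrable lborel {0<..<1} (f p)"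
  shows "unit_integral (\<lambda>x. \<Sum>p\<in>P. f p x) = (\<Sum>p\<in>P. unit_integral (f p))"
proof -
  have "(LINT x|lborel. (\<Sum>p\<in>P. indicator {0<..<1} x *\<^sub>R f p x)) = (\<Sum>p\<in>P. LINT x|lborel. indicator {0<..<1} x *\<^sub>R f p x)"
    using assms(2) by (intro Bochner_Integration.integral_sum) (simp add: set_integrable_def)
  then show ?thesis by (simp add: unit_integral_def set_lebesgue_integral_def sum_distrib_left)
qed

section \<open>The limit of the band matrices\<close>

definition word_mat :: "nat \<Rightarrow> ('i \<Rightarrow> complex mat) \<Rightarrow> 'i list \<Rightarrow> complex mat" where
  "word_mat n A w = foldr (\<lambda>i B. A i * B) w (1\<^sub>m n)"

lemma word_mat_simps [simp]: "word_mat n A [] = 1\<^sub>m n" "word_mat n A (i # w) = A i * word_mat n A w"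
  by (simp_all add: word_mat_def)

lemma word_mat_carrier: "(\<And>i. i \<in> set w \<Longrightarrow> A i \<in> carrier_mat n n) \<Longrightarrow> word_mat n A w \<in> carrier_mat n n"
  unfolding word_mat_def by (rule foldr_mat_entry(1))

lemma word_mat_append:
  assumes "\<And>i. i \<in> set u \<union> set v \<Longrightarrow> A i \<in> carrier_mat n n" "j < n" "k < n"
  shows "word_mat n A (u @ v) $$ (j, k) = (\<Sum>l<n. word_mat n A u $$ (j, l) * word_mat n A v $$ (l, k))"
proof -
  have v: "word_mat n A v \<in> carrier_mat n n" using assms(1) by (intro word_mat_carrier) auto
  have u: "word_mat n A w \<in> carrier_mat n n" if "set w \<subseteq> set u" for w
    using assms(1) that by (intro word_mat_carrier) auto
  have "word_mat n A (w @ v) = word_mat n A w * word_mat n A v" if "set w \<subseteq> set u" for w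
    using that
  proof (induction w)
    case Nil
    then show ?case using v by simp
  next
    case (Cons i w)
    then have "A i \<in> carrier_mat n n" "word_mat n A w \<in> carrier_mat n n"
      using assms(1) u by auto
    then show ?case using Cons v by (simp add: assoc_mult_mat[of _ n n _ n _ n])
  qed
  then show ?thesis
    using u[of u] v assms(2,3) by (simp add: scalar_prod_def atLeast0LessThan)
qed

lemma word_mat_rev:
  assumes "\<And>i. i \<in> set u \<Longrightarrow> A i \<in> carrier_mat n n"
    and "\<And>i a b. i \<in> set u \<Longrightarrow> a < n \<Longrightarrow> b < n \<Longrightarrow> A i $$ (b, a) = cnj (A i $$ (a, b))"
    and "j < n" "k < n"
  shows "word_mat n A (rev u) $$ (j, k) = cnj (word_mat n A u $$ (k, j))"
  using assms
proof (induction u arbitrary: k)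
  case (Cons i u)
  note carrier = Cons.prems(1) and herm = Cons.prems(2) and j = Cons.prems(3) and k = Cons.prems(4)
  have i: "word_mat n A [i] $$ (a, b) = A i $$ (a, b)" if "a < n" "b < n" for a b
    using carrier[of i] that by simp
  have "word_mat n A (rev (i # u)) $$ (j, k) = (\<Sum>l<n. word_mat n A (rev u) $$ (j, l) * word_mat n A [i] $$ (l, k))"
    using word_mat_append[of "rev u" "[i]" A n j k] carrier j k by simp
  also have "\<dots> = (\<Sum>l<n. cnj (word_mat n A [i] $$ (k, l) * word_mat n A u $$ (l, j)))"
  proof (rule sum.cong[OF refl])
    fix l assume "l \<in> {..<n}"
    then have l: "l < n" by simp
    have "word_mat n A (rev u) $$ (j, l) = cnj (word_mat n A u $$ (l, j))"
      by (rule Cons.IH[OF carrier[OF list.set_intros(2)] herm[OF list.set_intros(2)] j l])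
    moreover have "A i $$ (l, k) = cnj (A i $$ (k, l))" by (rule herm[OF list.set_intros(1) k l])
    ultimately show "word_mat n A (rev u) $$ (j, l) * word_mat n A [i] $$ (l, k) =
        cnj (word_mat n A [i] $$ (k, l) * word_mat n A u $$ (l, j))"
      unfolding i[OF l k] i[OF k l] by (simp only: complex_cnj_mult mult.commute)
  qed
  also have "\<dots> = cnj (word_mat n A ([i] @ u) $$ (k, j))"
    using word_mat_append[of "[i]" u A n k j] carrier j k by (simp only: cnj_sum) simp
  finally show ?case by simp
qed auto

text \<open>A letter outside \<open>I\<close> either is the first letter, whose covariance is 0, or
  survives in one of the two parts when the first letter is paired.\<close>

lemma ov_moment_vanishing_letter:
  assumes "\<And>i f x. i \<notin> I \<Longrightarrow> \<eta> i f x = 0" "\<And>i x. \<eta> i (\<lambda>x. 0) x = 0" "\<not> set w \<subseteq> I"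
  shows "ov_moment \<eta> w = (\<lambda>x. 0)"
  using assms(3)
proof (induction "length w" arbitrary: w rule: less_induct)
  case less
  then obtain i w' where w: "w = i # w'" by (cases w) auto
  show ?case
  proof
    fix x
    have "(if w' ! p = i then \<eta> i (ov_moment \<eta> (take p w')) x * ov_moment \<eta> (drop (Suc p) w') x else 0) = 0"
      if p: "p < length w'" for p
    proof (cases "w' ! p = i \<and> i \<in> I")
      case True
      then have "w' = take p w' @ i # drop (Suc p) w'" using id_take_nth_drop[OF p] by simp
      then have "set w' = set (take p w') \<union> {i} \<union> set (drop (Suc p) w')"
        by (metis Un_insert_right list.simps(15) set_append sup_bot_right Un_assoc Un_commute insert_is_Un)
      then have "\<not> set (take p w') \<subseteq> I \<or> \<not> set (drop (Suc p) w') \<subseteq> I"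
        using less.prems True w by auto
      moreover have "length (take p w') < length w" "length (drop (Suc p) w') < length w" by (simp_all add: w)
      ultimately have "ov_moment \<eta> (take p w') = (\<lambda>x. 0) \<or> ov_moment \<eta> (drop (Suc p) w') = (\<lambda>x. 0)"
        using less.hyps by blast
      then show ?thesis using assms(2) by auto
    qed (use assms(1) in auto)
    then show "ov_moment \<eta> w x = 0" by (simp add: w)
  qed
qed

lemma generated_algebra_subalgebra: "unital_subalgebra scl (generated_algebra scl S)"
  unfolding generated_algebra_def
proof (rule hull_in)
  fix T :: "'a set set" assume T: "Ball T (unital_subalgebra scl)"
  have "1 \<in> B" "\<And>x y. x \<in> B \<Longrightarrow> y \<in> B \<Longrightarrow> x + y \<in> B \<and> x * y \<in> B" "\<And>z x. x \<in> B \<Longrightarrow> scl z x \<in> B"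
    if "B \<in> T" for B
    using bspec[OF T that] by (simp_all add: unital_subalgebra_def)
  then show "unital_subalgebra scl (\<Inter> T)" unfolding unital_subalgebra_def by simp
qed

lemma generated_algebra_incl: "x \<in> S \<Longrightarrow> x \<in> generated_algebra scl S"
  unfolding generated_algebra_def by (rule hull_inc)

text \<open>For a letter of variance 1 this element is centered; the witnesses against freeness are
  built from it.\<close>

lemma generated_algebra_centered_square:
  assumes "nc_mono 1 [j] \<in> S"
  shows "nc_mono 1 [j, j] + nc_mono (- 1) [] \<in> generated_algebra nc_smult S"
proof -
  have alg: "unital_subalgebra nc_smult (generated_algebra nc_smult S)" by (rule generated_algebra_subalgebra)
  have "nc_mono 1 [j] \<in> generated_algebra nc_smult S" by (rule generated_algebra_incl[OF assms])
  then have "nc_mono 1 [j] * nc_mono 1 [j] + nc_smult (- 1) 1 \<in> generated_algebra nc_smult S"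
    using alg unfolding unital_subalgebra_def by blast
  then show ?thesis by (simp add: nc_mono_mult nc_smult_def)
qed

text \<open>The profile is demanded for all letters, with covariance 0 outside \<open>I\<close>, so
  that the limit moments make sense for all words over the index type and vanish on words that leave
  \<open>I\<close>.\<close>

locale band_matrix_limit =
  fixes M :: "nat \<Rightarrow> 'w measure" and I :: "'i set" and \<beta> :: "'i \<Rightarrow> complex"
    and X Y :: "nat \<Rightarrow> 'i \<Rightarrow> 'w \<Rightarrow> complex mat"
    and \<sigma> :: "'i \<Rightarrow> nat \<Rightarrow> real" and N :: "'i \<Rightarrow> nat \<Rightarrow> nat \<Rightarrow> nat \<Rightarrow> bool"
    and \<eta> :: "'i \<Rightarrow> (real \<Rightarrow> real) \<Rightarrow> real \<Rightarrow> real"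
  assumes wigner: "wigner_family M I \<beta> X"
    and profile: "band_profile (\<sigma> i) (N i) (\<eta> i)"
    and carrier: "i \<in> I \<Longrightarrow> Y n i \<omega> \<in> carrier_mat n n"
    and entries: "i \<in> I \<Longrightarrow> a < n \<Longrightarrow> b < n \<Longrightarrow>
      Y n i \<omega> $$ (a, b) = of_real (\<sigma> i n * of_bool (N i n a b)) * X n i \<omega> $$ (a, b)"
    and outside: "i \<notin> I \<Longrightarrow> \<eta> i f x = 0"
    and vanishing: "\<eta> i (\<lambda>x. 0) x = 0"
begin

definition limit_moment :: "'i list \<Rightarrow> complex" where
  "limit_moment w = of_real (unit_integral (ov_moment \<eta> w))"

definition mean_trace :: "nat \<Rightarrow> 'i list \<Rightarrow> complex" where
  "mean_trace n w = (\<Sum>j<n. \<integral>\<omega>. word_mat n (\<lambda>i. Y n i \<omega>) w $$ (j, j) \<partial>M n) / of_nat n"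

lemma mean_trace_limit: "set w \<subseteq> I \<Longrightarrow> (\<lambda>n. mean_trace n w) \<longlonglongrightarrow> limit_moment w"
  unfolding mean_trace_def limit_moment_def word_mat_def
  by (rule limit_of_word_moments(2)[OF wigner profile carrier entries])

lemma word_mat_integrable:
  "set w \<subseteq> I \<Longrightarrow> j < n \<Longrightarrow> integrable (M n) (\<lambda>\<omega>. word_mat n (\<lambda>i. Y n i \<omega>) w $$ (j, j))"
  unfolding word_mat_def by (rule limit_of_word_moments(1)[OF wigner profile carrier entries])

lemma limit_moment_outside: "\<not> set w \<subseteq> I \<Longrightarrow> limit_moment w = 0"
  using ov_moment_vanishing_letter[of I \<eta> w] outside vanishing by (simp add: limit_moment_def)

lemma limit_moment_Nil: "limit_moment [] = 1"
  by (simp add: limit_moment_def)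

text \<open>The recursion singles out the first letter and hides the cyclic symmetry; it is
  inherited from the traces of the matrices.\<close>

lemma limit_moment_tracial: "limit_moment (u @ v) = limit_moment (v @ u)"
proof (cases "set (u @ v) \<subseteq> I")
  case True
  have int: "(\<Sum>j<n. \<integral>\<omega>. word_mat n (\<lambda>i. Y n i \<omega>) w $$ (j, j) \<partial>M n) =
      (\<integral>\<omega>. (\<Sum>j<n. word_mat n (\<lambda>i. Y n i \<omega>) w $$ (j, j)) \<partial>M n)" if "set w \<subseteq> I" for n w
    using word_mat_integrable[OF that] by (intro Bochner_Integration.integral_sum[symmetric]) auto
  have "(\<Sum>j<n. word_mat n (\<lambda>i. Y n i \<omega>) (u @ v) $$ (j, j)) = (\<Sum>j<n. word_mat n (\<lambda>i. Y n i \<omega>) (v @ u) $$ (j, j))" for n \<omega>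
  proof -
    have c: "Y n i \<omega> \<in> carrier_mat n n" if "i \<in> set u \<union> set v" for i
      using True that by (intro carrier) auto
    have "(\<Sum>j<n. word_mat n (\<lambda>i. Y n i \<omega>) (u @ v) $$ (j, j)) =
        (\<Sum>j<n. \<Sum>l<n. word_mat n (\<lambda>i. Y n i \<omega>) u $$ (j, l) * word_mat n (\<lambda>i. Y n i \<omega>) v $$ (l, j))"
      using c by (intro sum.cong refl word_mat_append) auto
    also have "\<dots> = (\<Sum>l<n. \<Sum>j<n. word_mat n (\<lambda>i. Y n i \<omega>) v $$ (l, j) * word_mat n (\<lambda>i. Y n i \<omega>) u $$ (j, l))"
      by (subst sum.swap) (simp only: mult.commute)
    also have "\<dots> = (\<Sum>l<n. word_mat n (\<lambda>i. Y n i \<omega>) (v @ u) $$ (l, l))"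
      using c by (intro sum.cong refl word_mat_append[symmetric]) auto
    finally show ?thesis .
  qed
  then have "mean_trace n (u @ v) = mean_trace n (v @ u)" for n
    unfolding mean_trace_def using int[of "u @ v" n] int[of "v @ u" n] True by (simp add: Un_commute)
  then show ?thesis
    using LIMSEQ_unique[OF mean_trace_limit[of "u @ v"]] mean_trace_limit[of "v @ u"] True
    by (simp add: Un_commute)
next
  case False
  then show ?thesis using limit_moment_outside[of "u @ v"] limit_moment_outside[of "v @ u"] by (simp add: Un_commute)
qed

lemma entries_hermitian:
  assumes "i \<in> I" "\<omega> \<in> space (M n)" "a < n" "b < n"
  shows "Y n i \<omega> $$ (b, a) = cnj (Y n i \<omega> $$ (a, b))"
proof -
  have "N i n b a = N i n a b" using profile[of i] unfolding band_profile_def by blast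
  then show ?thesis
    using wigner_entries.hermitian[OF wigner_entries_of_family[OF wigner] assms] assms by (simp add: entries)
qed

lemma sum_swap3:
  "(\<Sum>u\<in>A. \<Sum>j\<in>C. \<Sum>k\<in>D. f u j k) = (\<Sum>j\<in>C. \<Sum>k\<in>D. \<Sum>u\<in>A. f u j k)"
proof -
  have "(\<Sum>u\<in>A. \<Sum>j\<in>C. \<Sum>k\<in>D. f u j k) = (\<Sum>j\<in>C. \<Sum>u\<in>A. \<Sum>k\<in>D. f u j k)" by (rule sum.swap)
  also have "\<dots> = (\<Sum>j\<in>C. \<Sum>k\<in>D. \<Sum>u\<in>A. f u j k)" by (intro sum.cong refl sum.swap)
  finally show ?thesis .
qed

text \<open>With P the combination of word matrices with coefficients \<open>z\<close>, this is the
  normalised expected trace of the adjoint of P times P, a sum of squared absolute values of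
  entries.\<close>

lemma mean_trace_positive:
  fixes S :: "'i list set" and z :: "'i list \<Rightarrow> complex"
  assumes "finite S" "\<And>w. w \<in> S \<Longrightarrow> set w \<subseteq> I"
  shows "(\<Sum>u\<in>S. \<Sum>v\<in>S. cnj (z u) * z v * mean_trace n (rev u @ v)) \<in> \<real>\<^sub>\<ge>\<^sub>0"
proof -
  let ?W = "\<lambda>\<omega>. word_mat n (\<lambda>i. Y n i \<omega>)"
  define g where "g \<omega> = (\<Sum>j<n. \<Sum>k<n. (cmod (\<Sum>v\<in>S. z v * ?W \<omega> v $$ (k, j)))\<^sup>2)" for \<omega>
  have words: "set (rev u @ v) \<subseteq> I" if "u \<in> S" "v \<in> S" for u v
    using assms(2)[OF that(1)] assms(2)[OF that(2)] by auto
  have "(\<Sum>u\<in>S. \<Sum>v\<in>S. cnj (z u) * z v * (\<Sum>j<n. \<integral>\<omega>. ?W \<omega> (rev u @ v) $$ (j, j) \<partial>M n)) =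
      (\<integral>\<omega>. (\<Sum>u\<in>S. \<Sum>v\<in>S. \<Sum>j<n. cnj (z u) * z v * ?W \<omega> (rev u @ v) $$ (j, j)) \<partial>M n)"
  proof -
    have int: "integrable (M n) (\<lambda>\<omega>. cnj (z u) * z v * ?W \<omega> (rev u @ v) $$ (j, j))"
      if "u \<in> S" "v \<in> S" "j < n" for u v j
      by (rule integrable_mult_right[OF word_mat_integrable[OF words[OF that(1,2)] that(3)]])
    have int2: "integrable (M n) (\<lambda>\<omega>. \<Sum>j<n. cnj (z u) * z v * ?W \<omega> (rev u @ v) $$ (j, j))"
      if "u \<in> S" "v \<in> S" for u v
      using int[OF that] by (intro Bochner_Integration.integrable_sum) auto
    have "(\<Sum>u\<in>S. \<Sum>v\<in>S. cnj (z u) * z v * (\<Sum>j<n. \<integral>\<omega>. ?W \<omega> (rev u @ v) $$ (j, j) \<partial>M n)) =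
        (\<Sum>u\<in>S. \<Sum>v\<in>S. \<integral>\<omega>. (\<Sum>j<n. cnj (z u) * z v * ?W \<omega> (rev u @ v) $$ (j, j)) \<partial>M n)"
    proof (intro sum.cong refl)
      fix u v assume uv: "u \<in> S" "v \<in> S"
      have "(\<integral>\<omega>. (\<Sum>j<n. cnj (z u) * z v * ?W \<omega> (rev u @ v) $$ (j, j)) \<partial>M n) =
          (\<Sum>j<n. \<integral>\<omega>. cnj (z u) * z v * ?W \<omega> (rev u @ v) $$ (j, j) \<partial>M n)"
        using int[OF uv] by (intro Bochner_Integration.integral_sum) auto
      then show "cnj (z u) * z v * (\<Sum>j<n. \<integral>\<omega>. ?W \<omega> (rev u @ v) $$ (j, j) \<partial>M n) =
          (\<integral>\<omega>. (\<Sum>j<n. cnj (z u) * z v * ?W \<omega> (rev u @ v) $$ (j, j)) \<partial>M n)"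
        by (simp only: integral_mult_right_zero sum_distrib_left)
    qed
    also have "\<dots> = (\<Sum>u\<in>S. \<integral>\<omega>. (\<Sum>v\<in>S. \<Sum>j<n. cnj (z u) * z v * ?W \<omega> (rev u @ v) $$ (j, j)) \<partial>M n)"
      using int2 by (intro sum.cong refl Bochner_Integration.integral_sum[symmetric]) auto
    also have "\<dots> = (\<integral>\<omega>. (\<Sum>u\<in>S. \<Sum>v\<in>S. \<Sum>j<n. cnj (z u) * z v * ?W \<omega> (rev u @ v) $$ (j, j)) \<partial>M n)"
    proof (rule Bochner_Integration.integral_sum[symmetric])
      fix u assume "u \<in> S"
      then show "integrable (M n) (\<lambda>\<omega>. \<Sum>v\<in>S. \<Sum>j<n. cnj (z u) * z v * ?W \<omega> (rev u @ v) $$ (j, j))"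
        using int2 by (intro Bochner_Integration.integrable_sum[of S]) auto
    qed
    finally show ?thesis .
  qed
  also have "\<dots> = (\<integral>\<omega>. complex_of_real (g \<omega>) \<partial>M n)"
  proof (intro Bochner_Integration.integral_cong refl)
    fix \<omega> assume \<omega>: "\<omega> \<in> space (M n)"
    have entry: "?W \<omega> (rev u @ v) $$ (j, j) = (\<Sum>k<n. cnj (?W \<omega> u $$ (k, j)) * ?W \<omega> v $$ (k, j))"
      if "u \<in> S" "v \<in> S" "j < n" for u v j
    proof -
      have uv: "i \<in> I" if "i \<in> set u \<union> set v" for i
        using assms(2)[OF \<open>u \<in> S\<close>] assms(2)[OF \<open>v \<in> S\<close>] that by auto
      have "?W \<omega> (rev u @ v) $$ (j, j) = (\<Sum>k<n. ?W \<omega> (rev u) $$ (j, k) * ?W \<omega> v $$ (k, j))"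
        using uv that by (intro word_mat_append carrier) auto
      also have "\<dots> = (\<Sum>k<n. cnj (?W \<omega> u $$ (k, j)) * ?W \<omega> v $$ (k, j))"
      proof (rule sum.cong[OF refl])
        fix k assume "k \<in> {..<n}"
        then have "?W \<omega> (rev u) $$ (j, k) = cnj (?W \<omega> u $$ (k, j))"
          using uv that \<omega> by (intro word_mat_rev carrier entries_hermitian) auto
        then show "?W \<omega> (rev u) $$ (j, k) * ?W \<omega> v $$ (k, j) = cnj (?W \<omega> u $$ (k, j)) * ?W \<omega> v $$ (k, j)"
          by (simp only:)
      qed
      finally show ?thesis .
    qed
    have "(\<Sum>u\<in>S. \<Sum>v\<in>S. \<Sum>j<n. cnj (z u) * z v * ?W \<omega> (rev u @ v) $$ (j, j)) =
        (\<Sum>u\<in>S. \<Sum>v\<in>S. \<Sum>j<n. \<Sum>k<n. cnj (z u * ?W \<omega> u $$ (k, j)) * (z v * ?W \<omega> v $$ (k, j)))"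
      by (intro sum.cong refl) (simp add: entry sum_distrib_left mult_ac)
    also have "\<dots> = (\<Sum>j<n. \<Sum>k<n. \<Sum>u\<in>S. \<Sum>v\<in>S. cnj (z u * ?W \<omega> u $$ (k, j)) * (z v * ?W \<omega> v $$ (k, j)))"
    proof -
      define f where "f u v j k = cnj (z u * ?W \<omega> u $$ (k, j)) * (z v * ?W \<omega> v $$ (k, j))" for u v j k
      have "(\<Sum>u\<in>S. \<Sum>v\<in>S. \<Sum>j<n. \<Sum>k<n. f u v j k) = (\<Sum>u\<in>S. \<Sum>j<n. \<Sum>k<n. \<Sum>v\<in>S. f u v j k)"
        by (intro sum.cong refl sum_swap3)
      also have "\<dots> = (\<Sum>j<n. \<Sum>k<n. \<Sum>u\<in>S. \<Sum>v\<in>S. f u v j k)" by (rule sum_swap3)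
      finally show ?thesis unfolding f_def .
    qed
    also have "\<dots> = (\<Sum>j<n. \<Sum>k<n. cnj (\<Sum>u\<in>S. z u * ?W \<omega> u $$ (k, j)) * (\<Sum>v\<in>S. z v * ?W \<omega> v $$ (k, j)))"
      by (simp only: sum_product cnj_sum)
    also have "\<dots> = complex_of_real (g \<omega>)"
      unfolding g_def of_real_sum complex_norm_square by (simp only: mult.commute)
    finally show "(\<Sum>u\<in>S. \<Sum>v\<in>S. \<Sum>j<n. cnj (z u) * z v * ?W \<omega> (rev u @ v) $$ (j, j)) = complex_of_real (g \<omega>)" .
  qed
  also have "\<dots> = of_real (\<integral>\<omega>. g \<omega> \<partial>M n)" by (rule integral_complex_of_real)
  finally have eq: "(\<Sum>u\<in>S. \<Sum>v\<in>S. cnj (z u) * z v * (\<Sum>j<n. \<integral>\<omega>. ?W \<omega> (rev u @ v) $$ (j, j) \<partial>M n)) =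
      of_real (\<integral>\<omega>. g \<omega> \<partial>M n)" .
  have "(\<Sum>u\<in>S. \<Sum>v\<in>S. cnj (z u) * z v * mean_trace n (rev u @ v)) = of_real ((\<integral>\<omega>. g \<omega> \<partial>M n) / real n)"
    unfolding mean_trace_def of_real_divide eq[symmetric]
    by (simp only: times_divide_eq_right of_real_of_nat_eq flip: sum_divide_distrib)
  moreover have "0 \<le> (\<integral>\<omega>. g \<omega> \<partial>M n)" unfolding g_def by (intro integral_nonneg_AE AE_I2 sum_nonneg) auto
  ultimately show ?thesis by simp
qed

text \<open>Words with a letter outside \<open>I\<close> have moment 0 and drop out; for the others
  positivity passes to the limit from the matrices, as the set of nonnegative reals is
  closed.\<close>

lemma limit_moment_positive: "nc_functional limit_moment (nc_star p * p) \<in> \<real>\<^sub>\<ge>\<^sub>0"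
proof -
  let ?K = "Poly_Mapping.keys p"
  define S where "S = {w \<in> letters ` ?K. set w \<subseteq> I}"
  define z where "z w = Poly_Mapping.lookup p (NC_Word w)" for w
  have S: "finite S" "\<And>w. w \<in> S \<Longrightarrow> set w \<subseteq> I" by (auto simp: S_def)
  have inj: "inj_on letters ?K" by (meson inj_onI nc_word.expand)
  have "nc_functional limit_moment (nc_star p * p) =
      (\<Sum>u\<in>letters ` ?K. \<Sum>v\<in>letters ` ?K. cnj (z u) * z v * limit_moment (rev u @ v))"
    by (simp add: nc_functional_star_mult sum.reindex[OF inj] z_def)
  also have "\<dots> = (\<Sum>u\<in>S. \<Sum>v\<in>letters ` ?K. cnj (z u) * z v * limit_moment (rev u @ v))"
  proof (rule sum.mono_neutral_right)
    show "\<forall>u\<in>letters ` ?K - S. (\<Sum>v\<in>letters ` ?K. cnj (z u) * z v * limit_moment (rev u @ v)) = 0"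
    proof
      fix u assume "u \<in> letters ` ?K - S"
      then have "\<not> set (rev u @ v) \<subseteq> I" for v by (auto simp: S_def)
      then show "(\<Sum>v\<in>letters ` ?K. cnj (z u) * z v * limit_moment (rev u @ v)) = 0"
        by (simp add: limit_moment_outside)
    qed
  qed (auto simp: S_def)
  also have "\<dots> = (\<Sum>u\<in>S. \<Sum>v\<in>S. cnj (z u) * z v * limit_moment (rev u @ v))"
  proof (rule sum.cong[OF refl], rule sum.mono_neutral_right)
    fix u
    show "\<forall>v\<in>letters ` ?K - S. cnj (z u) * z v * limit_moment (rev u @ v) = 0"
    proof
      fix v assume "v \<in> letters ` ?K - S"
      then have "\<not> set (rev u @ v) \<subseteq> I" by (auto simp: S_def)
      then show "cnj (z u) * z v * limit_moment (rev u @ v) = 0" by (simp add: limit_moment_outside)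
    qed
  qed (auto simp: S_def)
  finally have eq: "nc_functional limit_moment (nc_star p * p) =
      (\<Sum>u\<in>S. \<Sum>v\<in>S. cnj (z u) * z v * limit_moment (rev u @ v))" .
  have "(\<lambda>n. \<Sum>u\<in>S. \<Sum>v\<in>S. cnj (z u) * z v * mean_trace n (rev u @ v)) \<longlonglongrightarrow>
      (\<Sum>u\<in>S. \<Sum>v\<in>S. cnj (z u) * z v * limit_moment (rev u @ v))"
    using S(2) by (intro tendsto_sum tendsto_mult_left mean_trace_limit) auto
  then show ?thesis
    unfolding eq using mean_trace_positive[OF S, of z]
    by (rule closed_sequentially[OF closed_nonneg_Reals_complex, rotated])
qed

lemma converges:
  "converges_in_joint_distribution M I Y nc_smult (nc_functional limit_moment) (\<lambda>i. nc_mono 1 [i])"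
  unfolding converges_in_joint_distribution_def nc_eval_generators
proof (intro allI impI)
  fix p :: "'i nc_poly" assume p: "nc_vars p \<subseteq> I"
  let ?K = "Poly_Mapping.keys p" and ?c = "Poly_Mapping.lookup p"
  have w: "set (letters w) \<subseteq> I" if "w \<in> ?K" for w using p that by (auto simp: nc_vars_def)
  have "(\<integral>\<omega>. 1 / of_nat n * trace_mat (nc_eval_mat n (\<lambda>i. Y n i \<omega>) p) \<partial>M n) =
      (\<Sum>w\<in>?K. ?c w * mean_trace n (letters w))" for n
  proof -
    have int: "integrable (M n) (\<lambda>\<omega>. ?c w * word_mat n (\<lambda>i. Y n i \<omega>) (letters w) $$ (j, j))"
      if "w \<in> ?K" "j < n" for w j
      by (rule integrable_mult_right[OF word_mat_integrable[OF w[OF that(1)] that(2)]])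
    have "(\<integral>\<omega>. 1 / of_nat n * trace_mat (nc_eval_mat n (\<lambda>i. Y n i \<omega>) p) \<partial>M n) =
        1 / of_nat n * (\<integral>\<omega>. (\<Sum>j<n. \<Sum>w\<in>?K. ?c w * word_mat n (\<lambda>i. Y n i \<omega>) (letters w) $$ (j, j)) \<partial>M n)"
      by (simp add: trace_mat_def nc_eval_mat_def word_mat_def)
    also have "\<dots> = 1 / of_nat n * (\<Sum>j<n. \<integral>\<omega>. (\<Sum>w\<in>?K. ?c w * word_mat n (\<lambda>i. Y n i \<omega>) (letters w) $$ (j, j)) \<partial>M n)"
      using int by (intro arg_cong2[where f = "(*)"] refl Bochner_Integration.integral_sum Bochner_Integration.integrable_sum) auto
    also have "\<dots> = 1 / of_nat n * (\<Sum>j<n. \<Sum>w\<in>?K. \<integral>\<omega>. ?c w * word_mat n (\<lambda>i. Y n i \<omega>) (letters w) $$ (j, j) \<partial>M n)"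
      using int by (intro arg_cong2[where f = "(*)"] sum.cong refl Bochner_Integration.integral_sum) auto
    also have "\<dots> = (\<Sum>w\<in>?K. ?c w * mean_trace n (letters w))"
      unfolding integral_mult_right_zero mean_trace_def
      by (subst sum.swap) (simp add: sum_distrib_left sum_divide_distrib)
    finally show ?thesis .
  qed
  moreover have "(\<lambda>n. \<Sum>w\<in>?K. ?c w * mean_trace n (letters w)) \<longlonglongrightarrow> nc_functional limit_moment p"
    unfolding nc_functional_def using w by (intro tendsto_sum tendsto_mult_left mean_trace_limit) auto
  ultimately show "(\<lambda>n. \<integral>\<omega>. 1 / of_nat n * trace_mat (nc_eval_mat n (\<lambda>i. Y n i \<omega>) p) \<partial>M n)
      \<longlonglongrightarrow> nc_functional limit_moment p" by simp
qed

lemma limit_is_star_prob_space: "star_prob_space nc_smult nc_star (nc_functional limit_moment)"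
  by (rule nc_star_prob_space[of limit_moment, OF limit_moment_Nil limit_moment_positive])

lemma ov_moment_integrable: "set_integrable lborel {0<..<1} (ov_moment \<eta> w)"
proof (rule interior_limit_integrable)
  show "interior_limit (\<lambda>n. ov_moment (\<lambda>i f a. \<Sum>b<n. (\<sigma> i n)\<^sup>2 * of_bool (N i n a b) * f b) w) (ov_moment \<eta> w)"
  proof (rule interior_limit_ov_moment)
    show "limit_operator (\<lambda>n a b. (\<sigma> i n)\<^sup>2 * of_bool (N i n a b)) (\<eta> i)" for i
      using profile[of i] unfolding band_profile_def by blast
  qed
qed

text \<open>The covariance of \<open>i\<close> yields a constant function, so the integral of each
  product splits. The word \<open>w\<close> may contain arbitrary letters.\<close>

lemma limit_moment_averaging:
  assumes "\<And>f x. 0 < x \<Longrightarrow> x < 1 \<Longrightarrow> \<eta> i f x = k * unit_integral f"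
  shows "limit_moment (i # w) = of_real k *
    (\<Sum>p<length w. if w ! p = i then limit_moment (take p w) * limit_moment (drop (Suc p) w) else 0)"
proof -
  let ?c = "\<lambda>p. if w ! p = i then k * unit_integral (ov_moment \<eta> (take p w)) else 0"
  have "unit_integral (ov_moment \<eta> (i # w)) = unit_integral (\<lambda>x. \<Sum>p<length w. ?c p * ov_moment \<eta> (drop (Suc p) w) x)"
  proof (rule unit_integral_cong)
    fix x :: real assume x: "0 < x" "x < 1"
    show "ov_moment \<eta> (i # w) x = (\<Sum>p<length w. ?c p * ov_moment \<eta> (drop (Suc p) w) x)"
      unfolding ov_moment.simps assms[OF x] by (intro sum.cong refl) simp
  qed
  also have "\<dots> = (\<Sum>p<length w. unit_integral (\<lambda>x. ?c p * ov_moment \<eta> (drop (Suc p) w) x))"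
    by (intro unit_integral_sum set_integrable_mult_right ov_moment_integrable) auto
  also have "\<dots> = k * (\<Sum>p<length w. if w ! p = i
      then unit_integral (ov_moment \<eta> (take p w)) * unit_integral (ov_moment \<eta> (drop (Suc p) w)) else 0)"
    unfolding unit_integral_cmult sum_distrib_left by (intro sum.cong) auto
  finally show ?thesis
    unfolding limit_moment_def by (simp add: if_distrib[of of_real] cong: if_cong)
qed

text \<open>If all letters preserve constant functions, every moment function is constant on the
  interval and all integrals split. In contrast to the averaging case, the operators may be local,
  but all letters of the word come from \<open>J\<close>.\<close>

lemma limit_moment_constant:
  assumes \<eta>: "\<And>i f y x. i \<in> J \<Longrightarrow> (\<And>x. 0 < x \<Longrightarrow> x < 1 \<Longrightarrow> f x = y) \<Longrightarrow> 0 < x \<Longrightarrow> x < 1 \<Longrightarrow> \<eta> i f x = k i * y"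
    and "i \<in> J" "set w \<subseteq> J"
  shows "limit_moment (i # w) = of_real (k i) *
    (\<Sum>p<length w. if w ! p = i then limit_moment (take p w) * limit_moment (drop (Suc p) w) else 0)"
proof -
  let ?U = "\<lambda>w. unit_integral (ov_moment \<eta> w)"
  have const: "ov_moment \<eta> w x = ?U w" if "set w \<subseteq> J" "0 < x" "x < 1" for w x
    using that
  proof (induction "length w" arbitrary: w x rule: less_induct)
    case less
    show ?case
    proof (cases w)
      case (Cons i w')
      let ?R = "\<Sum>p<length w'. if w' ! p = i then k i * ?U (take p w') * ?U (drop (Suc p) w') else 0"
      have sub: "set (take p w') \<subseteq> J" "set (drop p w') \<subseteq> J" for p
        using less.prems(1) set_take_subset[of p w'] set_drop_subset[of p w'] unfolding Cons by auto
      have IH: "ov_moment \<eta> (take p w') x = ?U (take p w')" "ov_moment \<eta> (drop (Suc p) w') x = ?U (drop (Suc p) w')"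
        if "0 < x" "x < 1" for p x
        using less.hyps[OF _ sub(1)[of p] that] less.hyps[OF _ sub(2)[of "Suc p"] that] by (simp_all add: Cons)
      have eq: "ov_moment \<eta> w x = ?R" if x: "0 < x" "x < 1" for x
        unfolding Cons ov_moment.simps
      proof (intro sum.cong refl if_cong)
        fix p
        have "\<eta> i (ov_moment \<eta> (take p w')) x = k i * ?U (take p w')"
          using less.prems(1) IH(1) x by (intro \<eta>) (auto simp: Cons)
        then show "\<eta> i (ov_moment \<eta> (take p w')) x * ov_moment \<eta> (drop (Suc p) w') x =
            k i * ?U (take p w') * ?U (drop (Suc p) w')" using IH(2)[OF x] by simp
      qed
      have "?U w = unit_integral (\<lambda>x. ?R)" using eq by (intro unit_integral_cong) auto
      then show ?thesis using eq[OF less.prems(2,3)] by simp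
    qed simp
  qed
  have sub: "set (take p w) \<subseteq> J" "set (drop p w) \<subseteq> J" for p
    using assms(3) set_take_subset[of p w] set_drop_subset[of p w] by auto
  have "?U (i # w) = unit_integral (\<lambda>x. k i * (\<Sum>p<length w. if w ! p = i then ?U (take p w) * ?U (drop (Suc p) w) else 0))"
  proof (rule unit_integral_cong)
    fix x :: real assume x: "0 < x" "x < 1"
    show "ov_moment \<eta> (i # w) x = k i * (\<Sum>p<length w. if w ! p = i then ?U (take p w) * ?U (drop (Suc p) w) else 0)"
      unfolding ov_moment.simps sum_distrib_left
    proof (intro sum.cong refl)
      fix p
      have "\<eta> i (ov_moment \<eta> (take p w)) x = k i * ?U (take p w)"
        by (rule \<eta>[OF assms(2) const[OF sub(1)] x])
      then show "(if w ! p = i then \<eta> i (ov_moment \<eta> (take p w)) x * ov_moment \<eta> (drop (Suc p) w) x else 0) =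
          k i * (if w ! p = i then ?U (take p w) * ?U (drop (Suc p) w) else 0)"
        using const[OF sub(2)[of "Suc p"] x] by simp
    qed
  qed
  then show ?thesis
    unfolding limit_moment_def by (simp add: if_distrib[of of_real] cong: if_cong)
qed

text \<open>For a = a_i and b = a_j^2 - 1 freeness would give \<phi>(a b a b) = 0. Let h be the
  function \<open>\<eta> j (\<lambda>x. 1)\<close>. The identity covariance of \<open>i\<close> lets
  the h between the two letters \<open>i\<close> multiply the one outside, so the value is the
  integral of h^2 minus 1, the variance of h.\<close>

lemma not_free_families_identity:
  assumes "i \<in> A" "j \<in> B" "i \<noteq> j" "\<And>f. \<eta> i f = f"
    and "unit_integral (\<eta> j (\<lambda>x. 1)) = 1" "unit_integral (\<lambda>x. \<eta> j (\<lambda>x. 1) x * \<eta> j (\<lambda>x. 1) x) > 1"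
  shows "\<not> free_families nc_smult (nc_functional limit_moment) [A, B] (\<lambda>i. nc_mono 1 [i])"
proof
  assume free: "free_families nc_smult (nc_functional limit_moment) [A, B] (\<lambda>i. nc_mono 1 [i])"
  let ?a = "nc_mono 1 [i]" and ?b = "nc_mono 1 [j, j] + nc_mono (- 1) []"
  have a: "?a \<in> generated_algebra nc_smult ((\<lambda>i. nc_mono 1 [i]) ` A)"
    using assms(1) by (intro generated_algebra_incl) auto
  have b: "?b \<in> generated_algebra nc_smult ((\<lambda>i. nc_mono 1 [i]) ` B)"
    using assms(2) by (intro generated_algebra_centered_square) auto
  have \<phi>a: "nc_functional limit_moment ?a = 0" by (simp add: limit_moment_def)
  have \<phi>b: "nc_functional limit_moment ?b = 0"
    using assms(5) by (simp add: nc_functional_add limit_moment_def)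
  have "nc_functional limit_moment (prod_list [?a, ?b, ?a, ?b]) = 0"
  proof (rule free[unfolded free_families_def free_subalgebras_def, rule_format, of "[0, 1, 0, 1]"])
    fix l :: nat assume "l < length [0 :: nat, 1, 0, 1]"
    then consider "l = 0" | "l = 1" | "l = 2" | "l = 3" by fastforce
    then show "[?a, ?b, ?a, ?b] ! l \<in> generated_algebra nc_smult ((\<lambda>i. nc_mono 1 [i]) ` ([A, B] ! ([0, 1, 0, 1] ! l))) \<and>
        nc_functional limit_moment ([?a, ?b, ?a, ?b] ! l) = 0"
      using a b \<phi>a \<phi>b by cases simp_all
  qed auto
  moreover have "prod_list [?a, ?b, ?a, ?b] = nc_mono 1 [i, j, j, i, j, j] + nc_mono (- 1) [i, j, j, i] +
      (nc_mono (- 1) [i, i, j, j] + nc_mono 1 [i, i])"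
    by (simp add: distrib_left distrib_right nc_mono_mult)
  ultimately have "limit_moment [i, j, j, i, j, j] - limit_moment [i, j, j, i] - limit_moment [i, i, j, j] +
      limit_moment [i, i] = 0"
    by (simp only: nc_functional_add nc_functional_mono) (simp add: algebra_simps)
  moreover have "unit_integral (ov_moment \<eta> [i, j, j, i]) = 1" "unit_integral (ov_moment \<eta> [i, i, j, j]) = 1"
    "unit_integral (ov_moment \<eta> [i, i]) = 1"
    "unit_integral (ov_moment \<eta> [i, j, j, i, j, j]) = unit_integral (\<lambda>x. \<eta> j (\<lambda>x. 1) x * \<eta> j (\<lambda>x. 1) x)"
    using assms(3,5) not_sym[OF assms(3)] by (simp_all add: assms(4))
  ultimately have "complex_of_real (unit_integral (\<lambda>x. \<eta> j (\<lambda>x. 1) x * \<eta> j (\<lambda>x. 1) x)) = 1"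
    unfolding limit_moment_def by simp
  then show False using assms(6) by simp
qed

text \<open>Freeness would give \<phi>((a_i^2 - 1)(a_j^2 - 1)) = 0, but the value is the covariance
  of the functions \<open>\<eta> i (\<lambda>x. 1)\<close> and
  \<open>\<eta> j (\<lambda>x. 1)\<close> on the unit interval.\<close>

lemma not_free_family_correlated:
  assumes "i \<in> J" "j \<in> J" "i \<noteq> j"
    and "unit_integral (\<eta> i (\<lambda>x. 1)) = 1" "unit_integral (\<eta> j (\<lambda>x. 1)) = 1"
    and "unit_integral (\<lambda>x. \<eta> i (\<lambda>x. 1) x * \<eta> j (\<lambda>x. 1) x) > 1"
  shows "\<not> free_family nc_smult (nc_functional limit_moment) J (\<lambda>i. nc_mono 1 [i])"
proof
  assume free: "free_family nc_smult (nc_functional limit_moment) J (\<lambda>i. nc_mono 1 [i])"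
  let ?b = "\<lambda>j. nc_mono 1 [j, j] + nc_mono (- 1) []"
  have b: "?b j \<in> generated_algebra nc_smult {nc_mono 1 [j]}" for j
    by (intro generated_algebra_centered_square) auto
  have \<phi>b: "nc_functional limit_moment (?b i) = 0" "nc_functional limit_moment (?b j) = 0"
    using assms(4,5) by (simp_all add: nc_functional_add limit_moment_def)
  have "nc_functional limit_moment (prod_list [?b i, ?b j]) = 0"
  proof (rule free[unfolded free_family_def free_subalgebras_def, rule_format, of "[i, j]"])
    fix l :: nat assume "l < length [i, j]"
    then consider "l = 0" | "l = 1" by fastforce
    then show "[?b i, ?b j] ! l \<in> generated_algebra nc_smult {nc_mono 1 [[i, j] ! l]} \<and>
        nc_functional limit_moment ([?b i, ?b j] ! l) = 0"
      using b \<phi>b by cases simp_all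
  qed (use assms in auto)
  moreover have "prod_list [?b i, ?b j] = nc_mono 1 [i, i, j, j] + nc_mono (- 1) [i, i] +
      (nc_mono (- 1) [j, j] + nc_mono 1 [])"
    by (simp add: distrib_left distrib_right nc_mono_mult)
  ultimately have "limit_moment [i, i, j, j] - limit_moment [i, i] - limit_moment [j, j] + limit_moment [] = 0"
    by (simp only: nc_functional_add nc_functional_mono) (simp add: algebra_simps)
  moreover have "unit_integral (ov_moment \<eta> [i, i]) = 1" "unit_integral (ov_moment \<eta> [j, j]) = 1"
    "unit_integral (ov_moment \<eta> [i, i, j, j]) = unit_integral (\<lambda>x. \<eta> i (\<lambda>x. 1) x * \<eta> j (\<lambda>x. 1) x)"
    using assms(3,4,5) not_sym[OF assms(3)] by simp_all
  ultimately have "complex_of_real (unit_integral (\<lambda>x. \<eta> i (\<lambda>x. 1) x * \<eta> j (\<lambda>x. 1) x)) = 1"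
    unfolding limit_moment_def by simp
  then show False using assms(6) by simp
qed

end

section \<open>Rescaled semicircular elements and the five kinds of bands\<close>

lemma band_profile_zero: "band_profile (\<lambda>n. 0) (\<lambda>n j k. False) (\<lambda>f x. 0)"
  unfolding band_profile_def limit_operator_def
  by (intro conjI exI[of _ 0] allI impI) (simp_all add: interior_limit_const)

lemma periodic_correction_square: "(periodic_correction c)\<^sup>2 * (1 / max 1 (2 * c)) = 1"
  by (simp add: periodic_correction_def)

lemma nc_mono_power: "nc_mono z [i] ^ n = nc_mono (z ^ n) (replicate n i)"
  by (induction n) (simp_all add: nc_mono_one nc_mono_mult)

text \<open>Every pair of letters contributes the variance \<open>k\<close>, and rescaling
  contributes r^2, so the rescaled moments satisfy Segner's recurrence for the Catalan numbers,
  interlaced with zeros.\<close>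

lemma segner_standard_semicircular:
  assumes m: "m [] = 1"
    and rec: "\<And>n. m (replicate (Suc n) i) = of_real k * (\<Sum>p<n. m (replicate p i) * m (replicate (n - Suc p) i))"
    and r: "r\<^sup>2 * k = 1"
  shows "standard_semicircular nc_star (nc_functional m) (nc_mono (of_real r) [i])"
proof -
  define S where "S n = of_real r ^ n * m (replicate n i)" for n
  have rk: "of_real r * (of_real r * of_real k) = (1 :: complex)"
    using r by (metis mult.assoc of_real_1 of_real_mult power2_eq_square)
  have "S (Suc n) = (\<Sum>p<n. S p * S (n - Suc p))" for n
  proof -
    have "S (Suc n) = (\<Sum>p<n. of_real r ^ Suc n * of_real k * (m (replicate p i) * m (replicate (n - Suc p) i)))"
      unfolding S_def rec by (simp only: sum_distrib_left mult.assoc)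
    also have "\<dots> = (\<Sum>p<n. S p * S (n - Suc p))"
    proof (rule sum.cong[OF refl])
      fix p assume "p \<in> {..<n}"
      then have "Suc n = p + (n - Suc p) + 2" by simp
      then have "of_real r ^ Suc n * of_real k = of_real r ^ p * of_real r ^ (n - Suc p) * (of_real r * (of_real r * of_real k :: complex))"
        by (simp only: power_add power2_eq_square mult_ac)
      then show "of_real r ^ Suc n * of_real k * (m (replicate p i) * m (replicate (n - Suc p) i)) = S p * S (n - Suc p)"
        unfolding rk S_def by (simp add: mult_ac)
    qed
    finally show ?thesis .
  qed
  then have "S n = of_real (semicircle_moment n)" for n
    by (intro segner_imp_semicircle_moment) (simp_all add: S_def m)
  then show ?thesis
    unfolding standard_semicircular_def semicircle_moment_def[symmetric]
    by (simp add: nc_mono_power S_def)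
qed

text \<open>The algebra is the polynomial ring itself, each letter being its own limit. The
  semicircular system rests on constant row masses, the freeness of the families on covariances that
  are multiples of the mean. Periodic bands of proportion below 1/2 have the first property only,
  which is why they are grouped with \<open>I4\<close>.\<close>

theorem theorem4p3p6:
  fixes M :: "nat \<Rightarrow> 'w measure"
    and X :: "nat \<Rightarrow> 'i \<Rightarrow> 'w \<Rightarrow> complex mat"
    and \<beta> :: "'i \<Rightarrow> complex"
    and b :: "'i \<Rightarrow> nat \<Rightarrow> nat"
    and c :: "'i \<Rightarrow> real"
    and I1' I1'' I2 I3 I4 :: "'i set"
    and Y :: "nat \<Rightarrow> 'i \<Rightarrow> 'w \<Rightarrow> complex mat"
  assumes disj: "I1' \<inter> I1'' = {}" "(I1' \<union> I1'') \<inter> I2 = {}" "(I1' \<union> I1'' \<union> I2) \<inter> I3 = {}"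
      "(I1' \<union> I1'' \<union> I2 \<union> I3) \<inter> I4 = {}"
    and wigner: "wigner_family M (I1' \<union> I1'' \<union> I2 \<union> I3 \<union> I4) \<beta> X"
    and b1': "\<And>i. i \<in> I1' \<Longrightarrow> slow_growth (b i)"
    and b1'': "\<And>i. i \<in> I1'' \<Longrightarrow> proportional_growth (b i) (c i)"
    and b2: "\<And>i. i \<in> I2 \<Longrightarrow> slow_growth (b i)"
    and b3: "\<And>i. i \<in> I3 \<Longrightarrow> full_proportion (b i)"
    and b4: "\<And>i. i \<in> I4 \<Longrightarrow> proper_proportion (b i) (c i)"
    and Y1: "\<And>n i \<omega>. i \<in> I1' \<union> I1'' \<Longrightarrow> Y n i \<omega> = Lambda n (b i n) (X n i \<omega>)"
    and Y2: "\<And>n i \<omega>. i \<in> I2 \<Longrightarrow> Y n i \<omega> = Theta_slow n (b i n) (X n i \<omega>)"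
    and Y3: "\<And>n i \<omega>. i \<in> I3 \<Longrightarrow> Y n i \<omega> = Theta_prop 1 n (b i n) (X n i \<omega>)"
    and Y4: "\<And>n i \<omega>. i \<in> I4 \<Longrightarrow> Y n i \<omega> = Theta_prop (c i) n (b i n) (X n i \<omega>)"
  shows "\<exists>(scl :: complex \<Rightarrow> 'i nc_poly \<Rightarrow> 'i nc_poly) star \<phi> (a :: 'i \<Rightarrow> 'i nc_poly).
    star_prob_space scl star \<phi> \<and>
    (\<forall>i \<in> I1' \<union> I1'' \<union> I2 \<union> I3 \<union> I4. star (a i) = a i) \<and>
    converges_in_joint_distribution M (I1' \<union> I1'' \<union> I2 \<union> I3 \<union> I4) Y scl \<phi> a \<and>
    semicircular_system scl star \<phi> (I1' \<union> I1'' \<union> I2 \<union> I3)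
      (\<lambda>i. if i \<in> I1'' then scl (of_real (periodic_correction (c i))) (a i) else a i) \<and>
    free_families scl \<phi>
      [{i \<in> I1''. 1/2 \<le> c i}, I3, {i \<in> I1''. c i < 1/2} \<union> I4] a \<and>
    (I2 \<noteq> {} \<and> I4 \<noteq> {} \<longrightarrow> \<not> free_families scl \<phi> [I2, I4] a) \<and>
    (I1' \<noteq> {} \<and> I4 \<noteq> {} \<longrightarrow> \<not> free_families scl \<phi> [I1', I4] a) \<and>
    ((\<exists>i\<in>I4. \<exists>j\<in>I4. i \<noteq> j) \<longrightarrow> \<not> free_family scl \<phi> I4 a)"
proof -
  define I where "I = I1' \<union> I1'' \<union> I2 \<union> I3 \<union> I4"
  define \<sigma> where "\<sigma> i = (if i \<in> I1' \<union> I1'' \<union> I2 then (\<lambda>n. 1 / sqrt (2 * real (b i n)))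
    else if i \<in> I3 then (\<lambda>n. 1 / (sqrt (2 * 1 - 1\<^sup>2) * sqrt (real n)))
    else if i \<in> I4 then (\<lambda>n. 1 / (sqrt (2 * c i - (c i)\<^sup>2) * sqrt (real n))) else (\<lambda>n. 0))" for i
  define N where "N i = (if i \<in> I1' \<union> I1'' then (\<lambda>n j k. cyclic_dist n j k \<le> int (b i n))
    else if i \<in> I then (\<lambda>n j k. \<bar>int j - int k\<bar> \<le> int (b i n)) else (\<lambda>n j k. False))" for i
  define \<eta> :: "'i \<Rightarrow> (real \<Rightarrow> real) \<Rightarrow> real \<Rightarrow> real" where
    "\<eta> i = (if i \<in> I1' \<union> I2 then (\<lambda>f. f)
    else if i \<in> I1'' then (\<lambda>f x. 1 / (2 * c i) *
      unit_integral (\<lambda>y. of_bool (min \<bar>x - y\<bar> (1 - \<bar>x - y\<bar>) \<le> c i) * f y))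
    else if i \<in> I3 then (\<lambda>f x. 1 / (2 * 1 - 1\<^sup>2) * unit_integral (\<lambda>y. of_bool (\<bar>x - y\<bar> \<le> 1) * f y))
    else if i \<in> I4 then (\<lambda>f x. 1 / (2 * c i - (c i)\<^sup>2) * unit_integral (\<lambda>y. of_bool (\<bar>x - y\<bar> \<le> c i) * f y))
    else (\<lambda>f x. 0))" for i
  have cases5: "i \<in> I1' \<and> i \<notin> I1'' \<and> i \<notin> I2 \<and> i \<notin> I3 \<and> i \<notin> I4 \<or>
      i \<notin> I1' \<and> i \<in> I1'' \<and> i \<notin> I2 \<and> i \<notin> I3 \<and> i \<notin> I4 \<or>
      i \<notin> I1' \<and> i \<notin> I1'' \<and> i \<in> I2 \<and> i \<notin> I3 \<and> i \<notin> I4 \<or>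
      i \<notin> I1' \<and> i \<notin> I1'' \<and> i \<notin> I2 \<and> i \<in> I3 \<and> i \<notin> I4 \<or>
      i \<notin> I1' \<and> i \<notin> I1'' \<and> i \<notin> I2 \<and> i \<notin> I3 \<and> i \<in> I4" if "i \<in> I" for i
  proof -
    have "i \<in> I1' \<or> i \<in> I1'' \<or> i \<in> I2 \<or> i \<in> I3 \<or> i \<in> I4" using that by (simp add: I_def disj_ac)
    moreover have "\<not> (i \<in> I1' \<and> i \<in> I1'')" using disj(1) by blast
    moreover have "\<not> ((i \<in> I1' \<or> i \<in> I1'') \<and> i \<in> I2)" using disj(2) by blast
    moreover have "\<not> ((i \<in> I1' \<or> i \<in> I1'' \<or> i \<in> I2) \<and> i \<in> I3)" using disj(3) by blast
    moreover have "\<not> ((i \<in> I1' \<or> i \<in> I1'' \<or> i \<in> I2 \<or> i \<in> I3) \<and> i \<in> I4)" using disj(4) by blast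
    ultimately show ?thesis by argo
  qed
  interpret band_matrix_limit M I \<beta> X Y \<sigma> N \<eta>
  proof
    show "wigner_family M I \<beta> X" unfolding I_def by (rule wigner)
    show "band_profile (\<sigma> i) (N i) (\<eta> i)" for i
    proof (cases "i \<in> I")
      case False
      then have "i \<notin> I1'" "i \<notin> I1''" "i \<notin> I2" "i \<notin> I3" "i \<notin> I4" by (auto simp: I_def)
      then show ?thesis using False by (simp add: \<sigma>_def N_def \<eta>_def band_profile_zero)
    next
      case True
      from cases5[OF True] show ?thesis
      proof (elim disjE conjE)
        assume "i \<in> I1'" "i \<notin> I1''" "i \<notin> I2" "i \<notin> I3" "i \<notin> I4"
        then show ?thesis using band_profile_slow(2)[OF b1'] by (simp add: \<sigma>_def N_def \<eta>_def)
      next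
        assume "i \<notin> I1'" "i \<in> I1''" "i \<notin> I2" "i \<notin> I3" "i \<notin> I4"
        then show ?thesis using band_profile_periodic[OF b1''] by (simp add: \<sigma>_def N_def \<eta>_def)
      next
        assume "i \<notin> I1'" "i \<notin> I1''" "i \<in> I2" "i \<notin> I3" "i \<notin> I4"
        then show ?thesis using band_profile_slow(1)[OF b2] True by (simp add: \<sigma>_def N_def \<eta>_def)
      next
        assume i: "i \<notin> I1'" "i \<notin> I1''" "i \<notin> I2" "i \<in> I3" "i \<notin> I4"
        have "proportional_growth (b i) 1" using b3[OF i(4)] by (simp add: full_proportion_def)
        from band_profile_proportional[OF this] show ?thesis using i True by (simp add: \<sigma>_def N_def \<eta>_def)
      next
        assume i: "i \<notin> I1'" "i \<notin> I1''" "i \<notin> I2" "i \<notin> I3" "i \<in> I4"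
        have "proportional_growth (b i) (c i)" using b4[OF i(5)] by (simp add: proper_proportion_def)
        from band_profile_proportional[OF this] show ?thesis using i True by (simp add: \<sigma>_def N_def \<eta>_def)
      qed
    qed
    show "Y n i \<omega> \<in> carrier_mat n n" if "i \<in> I" for n i \<omega>
      using cases5[OF that]
      by (elim disjE conjE) (simp_all add: Y1 Y2 Y3 Y4 Lambda_def Theta_slow_def Theta_prop_def
          band_matrix_def periodic_band_matrix_def)
    show "Y n i \<omega> $$ (a, b') = of_real (\<sigma> i n * of_bool (N i n a b')) * X n i \<omega> $$ (a, b')"
      if "i \<in> I" "a < n" "b' < n" for n i \<omega> a b'
      using cases5[OF that(1)] that
      by (elim disjE conjE) (simp_all add: Y1 Y2 Y3 Y4 Lambda_def Theta_slow_def Theta_prop_def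
          band_matrix_def periodic_band_matrix_def \<sigma>_def N_def)
    show "\<eta> i f x = 0" if "i \<notin> I" for i f x using that by (simp add: \<eta>_def I_def)
    show "\<eta> i (\<lambda>x. 0) x = 0" for i x by (simp add: \<eta>_def)
  qed
  let ?\<phi> = "nc_functional limit_moment" and ?a = "\<lambda>i. nc_mono 1 [i]"

  define J where "J = I1' \<union> I1'' \<union> I2 \<union> I3"
  \<comment> \<open>\<open>k\<close> is the limiting variance: for periodic bands the row mass min 1
    (2 c) divided by 2 c, which is 1 / max 1 (2 c).\<close>
  define k where "k i = (if i \<in> I1'' then 1 / max 1 (2 * c i) else 1)" for i
  define r where "r i = (if i \<in> I1'' then periodic_correction (c i) else 1)" for i
  have c1'': "0 < c i" "c i \<le> 1" if "i \<in> I1''" for i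
    using b1''[OF that] by (auto simp: proportional_growth_def)
  \<comment> \<open>On constant functions the identity and the integral operators of constant row
    mass act alike, as multiplication by \<open>k i\<close>.\<close>
  have averaging: "\<eta> i f x = k i * y"
    if i: "i \<in> J" and f: "\<And>x. 0 < x \<Longrightarrow> x < 1 \<Longrightarrow> f x = y" and x: "0 < x" "x < 1" for i f y x
  proof -
    have iI: "i \<in> I" using i by (auto simp: I_def J_def)
    from cases5[OF iI] show ?thesis
    proof (elim disjE conjE)
      assume i: "i \<notin> I1'" "i \<in> I1''" "i \<notin> I2" "i \<notin> I3" "i \<notin> I4"
      have "unit_integral (\<lambda>t. of_bool (min \<bar>x - t\<bar> (1 - \<bar>x - t\<bar>) \<le> c i) * f t) =
          unit_integral (\<lambda>t. y * of_bool (min \<bar>x - t\<bar> (1 - \<bar>x - t\<bar>) \<le> c i))"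
        using f by (intro unit_integral_cong) simp
      also have "\<dots> = y * min 1 (2 * c i)"
        unfolding unit_integral_cmult unit_integral_cyclic_band[OF x c1''(1)[OF i(2)]] ..
      finally show ?thesis
        using i c1''[OF i(2)] by (simp add: \<eta>_def k_def min_def max_def)
    next
      assume i: "i \<notin> I1'" "i \<notin> I1''" "i \<notin> I2" "i \<in> I3" "i \<notin> I4"
      have "unit_integral (\<lambda>t. of_bool (\<bar>x - t\<bar> \<le> 1) * f t) = unit_integral (\<lambda>t. y)"
        using f x by (intro unit_integral_cong) (simp add: abs_le_iff)
      then show ?thesis using i by (simp add: \<eta>_def k_def)
    qed (use f[OF x] i in \<open>auto simp: \<eta>_def k_def J_def\<close>)
  qed
  have rec_J: "limit_moment (i # w) = of_real (k i) *
      (\<Sum>p<length w. if w ! p = i then limit_moment (take p w) * limit_moment (drop (Suc p) w) else 0)"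
    if "i \<in> J" "set w \<subseteq> J" for i w
    by (rule limit_moment_constant[OF averaging that])
  have corrected: "(if i \<in> I1'' then nc_smult (of_real (periodic_correction (c i))) (?a i) else ?a i) =
      nc_mono (of_real (r i)) [i]" for i
    by (simp add: r_def)
  have "standard_semicircular nc_star ?\<phi> (nc_mono (of_real (r i)) [i])" if i: "i \<in> J" for i
  proof (rule segner_standard_semicircular[of _ _ "k i"])
    show "limit_moment [] = 1" by (rule limit_moment_Nil)
    show "(r i)\<^sup>2 * k i = 1" using periodic_correction_square[of "c i"] unfolding r_def k_def
      by (cases "i \<in> I1''") (simp_all only: if_True if_False power_one mult_1_right)
    fix n
    have "limit_moment (i # replicate n i) = of_real (k i) * (\<Sum>p<length (replicate n i). if replicate n i ! p = i
        then limit_moment (take p (replicate n i)) * limit_moment (drop (Suc p) (replicate n i)) else 0)"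
      using i by (intro rec_J) auto
    also have "(\<Sum>p<length (replicate n i). if replicate n i ! p = i
        then limit_moment (take p (replicate n i)) * limit_moment (drop (Suc p) (replicate n i)) else 0) =
      (\<Sum>p<n. limit_moment (replicate p i) * limit_moment (replicate (n - Suc p) i))"
      by (intro sum.cong) (auto simp: min_def)
    finally show "limit_moment (replicate (Suc n) i) =
        of_real (k i) * (\<Sum>p<n. limit_moment (replicate p i) * limit_moment (replicate (n - Suc p) i))" by simp
  qed
  moreover have "free_subalgebras ?\<phi> J (\<lambda>i. generated_algebra nc_smult {nc_mono (of_real (r i)) [i]})"
  proof -
    have vars: "nc_vars x \<subseteq> {i}" if "x \<in> generated_algebra nc_smult {nc_mono (of_real (r i)) [i]}" for x i
      using that by (rule nc_vars_generated) (auto simp: nc_vars_def)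
    \<comment> \<open>Letters of \<open>I4\<close> produce non-constant functions, so the recursion
      is known for words over \<open>J\<close> only and the moments are cut off there.\<close>
    interpret restricted: scalar_covariance "\<lambda>w. if set w \<subseteq> J then limit_moment w else 0" J "\<lambda>i. of_real (k i)"
      by (rule scalar_covariance_restrict[OF limit_moment_Nil limit_moment_tracial rec_J])
    have "free_subalgebras (nc_functional (\<lambda>w. if set w \<subseteq> J then limit_moment w else 0)) J
        (\<lambda>i. generated_algebra nc_smult {nc_mono (of_real (r i)) [i]})"
      by (rule restricted.free_subalgebras_disjoint_vars[where J = "\<lambda>i. {i}"]) (use vars in auto)
    then show ?thesis by (rule free_subalgebras_cong[where J = J]) (use vars in auto)
  qed
  ultimately have semicircular: "semicircular_system nc_smult nc_star ?\<phi> J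
      (\<lambda>i. if i \<in> I1'' then nc_smult (of_real (periodic_correction (c i))) (?a i) else ?a i)"
    unfolding semicircular_system_def free_family_def corrected by simp

  define Js where "Js = [{i \<in> I1''. 1/2 \<le> c i}, I3, {i \<in> I1''. c i < 1/2} \<union> I4]"
  \<comment> \<open>For these letters the limiting band is the whole square, so their covariance is
    a multiple of the mean and the recursion holds in front of arbitrary words.\<close>
  define Sc where "Sc = {i \<in> I1''. 1/2 \<le> c i} \<union> I3"
  have full: "\<eta> i f x = k i * unit_integral f" if i: "i \<in> Sc" and x: "0 < x" "x < 1" for i f x
  proof (cases "i \<in> I3")
    case True
    then have "i \<in> I" by (simp add: I_def)
    from cases5[OF this] have i': "i \<notin> I1'" "i \<notin> I1''" "i \<notin> I2" using True by auto
    have "unit_integral (\<lambda>y. of_bool (\<bar>x - y\<bar> \<le> 1) * f y) = unit_integral f"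
      using x by (intro unit_integral_cong) (simp add: abs_le_iff)
    then show ?thesis using i' True by (simp add: \<eta>_def k_def)
  next
    case False
    then have i1: "i \<in> I1''" "1/2 \<le> c i" using i by (auto simp: Sc_def)
    then have "i \<in> I" by (simp add: I_def)
    from cases5[OF this] have i': "i \<notin> I1'" "i \<notin> I2" using i1 by auto
    \<comment> \<open>The cyclic distance of two points never exceeds 1/2, so the indicator is
      constantly 1.\<close>
    have "unit_integral (\<lambda>y. of_bool (min \<bar>x - y\<bar> (1 - \<bar>x - y\<bar>) \<le> c i) * f y) = unit_integral f"
      using i1 by (intro unit_integral_cong) (auto simp: min_def)
    then show ?thesis using i' i1 by (simp add: \<eta>_def k_def max_def)
  qed
  interpret averaged: scalar_covariance limit_moment Sc "\<lambda>i. of_real (k i)"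
  proof
    show "limit_moment (i # w) = of_real (k i) *
        (\<Sum>p<length w. if w ! p = i then limit_moment (take p w) * limit_moment (drop (Suc p) w) else 0)"
      if "i \<in> Sc" for i w
      by (rule limit_moment_averaging[OF full[OF that]])
  qed (rule limit_moment_Nil limit_moment_tracial)+
  have "free_subalgebras ?\<phi> {..<length Js} (\<lambda>l. generated_algebra nc_smult (?a ` (Js ! l)))"
  \<comment> \<open>The third family is the one allowed to contain letters that are not of averaging
    type.\<close>
  proof (rule averaged.free_subalgebras_disjoint_vars[where J = "\<lambda>l. Js ! l" and ?k0.0 = 2])
    show "Js ! l \<inter> Js ! l' = {}" if "l \<in> {..<length Js}" "l' \<in> {..<length Js}" "l \<noteq> l'" for l l'
    proof -
      have "l \<in> {0, 1, 2}" "l' \<in> {0, 1, 2}" using that by (auto simp: Js_def)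
      then show ?thesis using that(3) disj by (auto simp: Js_def)
    qed
    show "Js ! l \<subseteq> Sc" if "l \<in> {..<length Js}" "l \<noteq> 2" for l
    proof -
      have "l \<in> {0, 1}" using that by (auto simp: Js_def)
      then show ?thesis by (auto simp: Js_def Sc_def)
    qed
    show "nc_vars x \<subseteq> Js ! l" if "x \<in> generated_algebra nc_smult (?a ` (Js ! l))" for l x
      using that by (rule nc_vars_generated) (auto simp: nc_vars_def)
  qed
  then have families: "free_families nc_smult ?\<phi> Js ?a" unfolding free_families_def .

  have c4: "0 < c i" "c i < 1" if "i \<in> I4" for i
    using b4[OF that] by (auto simp: proper_proportion_def proportional_growth_def)
  have tent4: "\<eta> i (\<lambda>x. 1) x = 1 / (2 * c i - (c i)\<^sup>2) * tent (c i) x" if i: "i \<in> I4" and x: "0 < x" "x < 1" for i x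
  proof -
    have "i \<in> I" using i by (simp add: I_def)
    from cases5[OF this] have "i \<notin> I1'" "i \<notin> I1''" "i \<notin> I2" "i \<notin> I3" using i by auto
    then show ?thesis using i unit_integral_band[OF x c4(1)[OF i]] by (simp add: \<eta>_def tent_def)
  qed
  have pos4: "0 < 2 * c i - (c i)\<^sup>2" if "i \<in> I4" for i
  proof -
    have "c i * c i < c i * 2" using c4[OF that] by (intro mult_strict_left_mono) auto
    then show ?thesis by (simp add: power2_eq_square)
  qed
  have mean4: "unit_integral (\<eta> i (\<lambda>x. 1)) = 1" if i: "i \<in> I4" for i
  proof -
    have "unit_integral (\<eta> i (\<lambda>x. 1)) = unit_integral (\<lambda>x. 1 / (2 * c i - (c i)\<^sup>2) * tent (c i) x)"
      using tent4[OF i] by (intro unit_integral_cong) auto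
    also have "\<dots> = 1" unfolding unit_integral_cmult unit_integral_tent[OF c4[OF i]] using pos4[OF i] by simp
    finally show ?thesis .
  qed
  \<comment> \<open>The case i = j is used against the slowly growing bands, the case i \<noteq> j
    within \<open>I4\<close>.\<close>
  have corr4: "1 < unit_integral (\<lambda>x. \<eta> i (\<lambda>x. 1) x * \<eta> j (\<lambda>x. 1) x)" if ij: "i \<in> I4" "j \<in> I4" for i j
  proof -
    let ?s = "1 / (2 * c i - (c i)\<^sup>2) * (1 / (2 * c j - (c j)\<^sup>2))"
    have s: "0 < ?s" using pos4[OF ij(1)] pos4[OF ij(2)] by simp
    have "unit_integral (\<lambda>x. \<eta> i (\<lambda>x. 1) x * \<eta> j (\<lambda>x. 1) x) = unit_integral (\<lambda>x. ?s * (tent (c i) x * tent (c j) x))"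
      using tent4[OF ij(1)] tent4[OF ij(2)] by (intro unit_integral_cong) simp
    also have "\<dots> = ?s * unit_integral (\<lambda>x. tent (c i) x * tent (c j) x)" by (rule unit_integral_cmult)
    also have "\<dots> > ?s * ((2 * c i - (c i)\<^sup>2) * (2 * c j - (c j)\<^sup>2))"
      by (rule mult_strict_left_mono[OF unit_integral_tent_mult[OF c4[OF ij(1)] c4[OF ij(2)]] s])
    finally show ?thesis using pos4[OF ij(1)] pos4[OF ij(2)] by simp
  qed
  \<comment> \<open>Periodic and non-periodic bands of slow growth share the identity covariance, so
    one argument covers \<open>I1'\<close> and \<open>I2\<close>.\<close>
  have not_free: "\<not> free_families nc_smult ?\<phi> [A, I4] ?a" if A: "A \<subseteq> I1' \<union> I2" "A \<noteq> {}" and I4: "I4 \<noteq> {}" for A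
  proof -
    obtain i j where ij: "i \<in> A" "j \<in> I4" using A(2) I4 by blast
    have "i \<noteq> j" using ij A(1) disj by blast
    moreover have "\<eta> i f = f" for f using ij(1) A(1) by (auto simp: \<eta>_def)
    ultimately show ?thesis
      by (rule not_free_families_identity[OF ij _ _ mean4[OF ij(2)] corr4[OF ij(2) ij(2)]])
  qed
  have not_free4: "\<not> free_family nc_smult ?\<phi> I4 ?a" if "i \<in> I4" "j \<in> I4" "i \<noteq> j" for i j
    by (rule not_free_family_correlated[OF that mean4[OF that(1)] mean4[OF that(2)] corr4[OF that(1,2)]])
  show ?thesis
  proof (intro exI conjI)
    show "star_prob_space nc_smult nc_star ?\<phi>" by (rule limit_is_star_prob_space)
    show "\<forall>i\<in>I1' \<union> I1'' \<union> I2 \<union> I3 \<union> I4. nc_star (?a i) = ?a i" by simp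
    show "converges_in_joint_distribution M (I1' \<union> I1'' \<union> I2 \<union> I3 \<union> I4) Y nc_smult ?\<phi> ?a"
      using converges unfolding I_def .
    show "semicircular_system nc_smult nc_star ?\<phi> (I1' \<union> I1'' \<union> I2 \<union> I3)
        (\<lambda>i. if i \<in> I1'' then nc_smult (of_real (periodic_correction (c i))) (?a i) else ?a i)"
      using semicircular unfolding J_def .
    show "free_families nc_smult ?\<phi> [{i \<in> I1''. 1/2 \<le> c i}, I3, {i \<in> I1''. c i < 1/2} \<union> I4] ?a"
      using families unfolding Js_def .
    show "I2 \<noteq> {} \<and> I4 \<noteq> {} \<longrightarrow> \<not> free_families nc_smult ?\<phi> [I2, I4] ?a"
      using not_free[of I2] by blast
    show "I1' \<noteq> {} \<and> I4 \<noteq> {} \<longrightarrow> \<not> free_families nc_smult ?\<phi> [I1', I4] ?a"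
      using not_free[of I1'] by blast
    show "(\<exists>i\<in>I4. \<exists>j\<in>I4. i \<noteq> j) \<longrightarrow> \<not> free_family nc_smult ?\<phi> I4 ?a"
      using not_free4 by blast
  qed
qed

end
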